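(* Let $\Gamma$ be a finitely generated group, let $X$ be one of its Cayley graphs with respect to some finite and symmetric generating set, and let $(p_n)_{n=1}^\infty\subset[1,2)$ with $p_n\to2$. Then $\Gamma$ is amenable if and only if there exists a sequence $(\mathbb P_n)_{n=1}^\infty$ of $\Gamma$-invariant site percolations on $X$ such that each $\mathbb P_n$ has no infinite components and for every $s\in\Gamma$ $$\lim_{n\to\infty}\mathbb E_n\big[\Phi\big(|K(o)|^{-1/p_n}\mathbf 1_{K(o)}\big)(s)\big]=1,$$ where $K(o)$ denotes the random cluster of the identity $o$ in $X$ and $|K(o)|^{-1/p_n}\mathbf 1_{K(o)}:=0$ if $K(o)=\emptyset$. Moreover, in this case $$\varphi_n(s):=\mathbb E_n\big[\Phi\big(|K(o)|^{-1/p_n}\mathbf 1_{K(o)}\big)(s)\big]$$ is positive definite and the Schur multipliers $M_{\varphi_n}$, regarded in $B(C_\lambda^*(\Gamma))$, respectively in $B(C_u^*(\Gamma))$, converge to the identity in the strong operator topology as $n\to\infty$.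
   Context: Cayley graph: for a finite symmetric generating set $S$ of $\Gamma$, the (right) Cayley graph has vertex set $\Gamma$ and an undirected edge between $x,y$ iff $x^{-1}y\in S$; $\Gamma$ acts on it by left multiplication. $o$ is the identity of $\Gamma$. Percolation: a site percolation on a countable, locally finite graph $X=(V,E)$ is a probability measure on $\{0,1\}^V$ with the Borel $\sigma$-field generated by the cylinder events. A configuration $\omega\in\{0,1\}^V$ is identified with the induced subgraph of $X$ on $\{x\in V:\omega_x=1\}$. The cluster $K(x)$ is the connected component of $x$ in this subgraph (empty if $\omega_x=0$). The percolation is $\Gamma$-invariant if it is invariant under the action induced by the $\Gamma$-action on $X$. It has no infinite components if almost surely all connected components of the configuration are finite. $\mathbb E_n$ is expectation with respect to $\mathbb P_n$. For $f\in\ell^2(\Gamma)$, $\Phi(f)(s)=\sum_{t\in\Gamma}f(t)\overline{f(ts)}$. A function $\varphi:\Gamma\to\mathbb C$ is positive definite if $[\varphi(s^{-1}t)]_{s,t\in F}$ is a positive (semidefinite) matrix for every finite $F\subset\Gamma$. For $T\in B(\ell^2(\Gamma))$ put $T(x,y)=\langle\delta_x,T\delta_y\rangle$. The Schur multiplier $M_\varphi$ is $T\mapsto[\varphi(xy^{-1})T(x,y)]_{x,y\in\Gamma}$ (well defined for positive definite $\varphi$); it restricts to bounded operators on $C_u^*(\Gamma)$, the norm closure of the operators $T$ of finite propagation (those for which there is a finite $F\subset\Gamma$ with $T(x,y)\neq0\Rightarrow xy^{-1}\in F$), and on the reduced group $C^*$-algebra $C_\lambda^*(\Gamma)\subset B(\ell^2(\Gamma))$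 generated by the left regular representation $(\lambda(s)f)(x)=f(s^{-1}x)$. For a Banach space $A$, the strong operator topology on $B(A)$ is induced by the seminorms $M\mapsto\|M(T)\|$, $T\in A$. $\Gamma$ is amenable if there is a left-translation-invariant mean (state) on $\ell^\infty(\Gamma)$. *)

theory Defs
  imports "HOL-Probability.Probability"
begin

section \<open>The Hilbert space of square-summable functions\<close>

typedef 'a ell2 = "{f :: 'a \<Rightarrow> complex. (\<lambda>x. (cmod (f x))\<^sup>2) summable_on UNIV}"
  morphisms ell2_fun Abs_ell2
  by (rule exI[of _ "\<lambda>_. 0"]) simp

setup_lifting type_definition_ell2

lemma ell2_mult_summable:
  fixes f g :: "'a \<Rightarrow> complex"
  assumes "(\<lambda>x. (cmod (f x))\<^sup>2) summable_on UNIV" "(\<lambda>x. (cmod (g x))\<^sup>2) summable_on UNIV"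
  shows "(\<lambda>x. cnj (f x) * g x) summable_on UNIV"
proof -
  have "(\<lambda>x. (cmod (f x))\<^sup>2 + (cmod (g x))\<^sup>2) summable_on UNIV"
    using assms by (rule summable_on_add)
  moreover have "cmod (cnj (f x) * g x) \<le> (cmod (f x))\<^sup>2 + (cmod (g x))\<^sup>2" for x
    using sum_squares_bound[of "cmod (f x)" "cmod (g x)"]
      mult_nonneg_nonneg[OF norm_ge_zero[of "f x"] norm_ge_zero[of "g x"]]
    unfolding norm_mult complex_mod_cnj by linarith
  ultimately have "(\<lambda>x. cmod (cnj (f x) * g x)) summable_on UNIV"
    by (rule summable_on_comparison_test) auto
  then show ?thesis
    by (rule abs_summable_summable)
qed

lemma ell2_add_summable:
  fixes f g :: "'a \<Rightarrow> complex"
  assumes "(\<lambda>x. (cmod (f x))\<^sup>2) summable_on UNIV" "(\<lambda>x. (cmod (g x))\<^sup>2) summable_on UNIV"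
  shows "(\<lambda>x. (cmod (f x + g x))\<^sup>2) summable_on UNIV"
proof -
  have "(\<lambda>x. 2 * (cmod (f x))\<^sup>2 + 2 * (cmod (g x))\<^sup>2) summable_on UNIV"
    using assms by (intro summable_on_add summable_on_cmult_right)
  moreover have "(cmod (f x + g x))\<^sup>2 \<le> 2 * (cmod (f x))\<^sup>2 + 2 * (cmod (g x))\<^sup>2" for x
  proof -
    have "(cmod (f x + g x))\<^sup>2 \<le> (cmod (f x) + cmod (g x))\<^sup>2"
      by (intro power_mono norm_triangle_ineq) auto
    also have "\<dots> \<le> 2 * (cmod (f x))\<^sup>2 + 2 * (cmod (g x))\<^sup>2"
      using sum_squares_bound[of "cmod (f x)" "cmod (g x)"] by (simp add: power2_sum)
    finally show ?thesis .
  qed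
  ultimately show ?thesis
    by (rule summable_on_comparison_test) auto
qed

lemma ell2_scale_summable:
  fixes f :: "'a \<Rightarrow> complex"
  assumes "(\<lambda>x. (cmod (f x))\<^sup>2) summable_on UNIV"
  shows "(\<lambda>x. (cmod (c * f x))\<^sup>2) summable_on UNIV"
  using summable_on_cmult_right[OF assms, of "(cmod c)\<^sup>2"]
  by (simp add: norm_mult power_mult_distrib)

instantiation ell2 :: (type) real_vector
begin

lift_definition zero_ell2 :: "'a ell2" is "\<lambda>_. 0" by simp

lift_definition plus_ell2 :: "'a ell2 \<Rightarrow> 'a ell2 \<Rightarrow> 'a ell2" is "\<lambda>f g x. f x + g x"
  by (simp add: ell2_add_summable)

lift_definition uminus_ell2 :: "'a ell2 \<Rightarrow> 'a ell2" is "\<lambda>f x. - f x" by simp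

lift_definition minus_ell2 :: "'a ell2 \<Rightarrow> 'a ell2 \<Rightarrow> 'a ell2" is "\<lambda>f g x. f x - g x"
  using ell2_add_summable[of _ "\<lambda>x. - _ x"] by simp

lift_definition scaleR_ell2 :: "real \<Rightarrow> 'a ell2 \<Rightarrow> 'a ell2" is "\<lambda>r f x. complex_of_real r * f x"
  using ell2_scale_summable by blast

instance
  by standard (transfer; simp add: fun_eq_iff algebra_simps)+

end

lift_definition scaleC :: "complex \<Rightarrow> 'a ell2 \<Rightarrow> 'a ell2" is "\<lambda>c f x. c * f x"
  using ell2_scale_summable by blast

text \<open>The inner product is linear in the second argument.\<close>

lift_definition cinner :: "'a ell2 \<Rightarrow> 'a ell2 \<Rightarrow> complex" is
  "\<lambda>f g. \<Sum>\<^sub>\<infinity>x. cnj (f x) * g x" .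

lemma cinner_summable: "(\<lambda>x. cnj (ell2_fun f x) * ell2_fun g x) summable_on UNIV"
  using ell2_fun[of f] ell2_fun[of g] by (intro ell2_mult_summable) auto

lemma cinner_self: "cinner f f = complex_of_real (\<Sum>\<^sub>\<infinity>x. (cmod (ell2_fun f x))\<^sup>2)"
proof -
  have "cinner f f = (\<Sum>\<^sub>\<infinity>x. complex_of_real ((cmod (ell2_fun f x))\<^sup>2))"
    unfolding cinner.rep_eq
    by (intro infsum_cong) (metis complex_norm_square mult.commute)
  also have "\<dots> = complex_of_real (\<Sum>\<^sub>\<infinity>x. (cmod (ell2_fun f x))\<^sup>2)"
    by (rule infsumI[OF has_sum_of_real[OF has_sum_infsum]]) (use ell2_fun[of f] in auto)
  finally show ?thesis .
qed

instantiation ell2 :: (type) real_inner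
begin

definition "norm f = sqrt (\<Sum>\<^sub>\<infinity>x. (cmod (ell2_fun f x))\<^sup>2)"
definition "inner f g = Re (cinner f g)"
definition "sgn f = f /\<^sub>R norm f" for f :: "'a ell2"
definition "dist f g = norm (f - g)" for f g :: "'a ell2"
definition
  "(uniformity :: ('a ell2 \<times> 'a ell2) filter) = (INF e\<in>{0<..}. principal {(x, y). dist x y < e})"
definition
  "open (U :: 'a ell2 set) \<longleftrightarrow> (\<forall>x\<in>U. \<forall>\<^sub>F (x', y) in uniformity. x' = x \<longrightarrow> y \<in> U)"

instance
proof
  fix f g h :: "'a ell2" and r :: real
  show "dist f g = norm (f - g)" by (rule dist_ell2_def)
  show "sgn f = f /\<^sub>R norm f" by (rule sgn_ell2_def)
  show "(uniformity :: ('a ell2 \<times> 'a ell2) filter) = (INF e\<in>{0<..}. principal {(x, y). dist x y < e})"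
    by (rule uniformity_ell2_def)
  show "open U \<longleftrightarrow> (\<forall>x\<in>U. \<forall>\<^sub>F (x', y) in uniformity. x' = x \<longrightarrow> y \<in> U)" for U :: "'a ell2 set"
    by (rule open_ell2_def)
  have "cinner g f = cnj (cinner f g)"
    by (simp add: cinner.rep_eq mult.commute flip: infsum_cnj)
  then show "inner f g = inner g f"
    by (simp add: inner_ell2_def)
  have "cinner (f + g) h = cinner f h + cinner g h"
    unfolding cinner.rep_eq plus_ell2.rep_eq complex_cnj_add distrib_right
    by (intro infsum_add cinner_summable)
  then show "inner (f + g) h = inner f h + inner g h"
    by (simp add: inner_ell2_def)
  have "cinner (r *\<^sub>R f) g = complex_of_real r * cinner f g"
    unfolding cinner.rep_eq scaleR_ell2.rep_eq
    by (subst infsum_cmult_right[symmetric]) (auto simp: mult.assoc intro: cinner_summable)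
  then show "inner (r *\<^sub>R f) g = r * inner f g"
    by (simp add: inner_ell2_def)
  show "0 \<le> inner f f"
    by (simp add: inner_ell2_def cinner_self infsum_nonneg)
  show "norm f = sqrt (inner f f)"
    by (simp add: norm_ell2_def inner_ell2_def cinner_self)
  show "inner f f = 0 \<longleftrightarrow> f = 0"
  proof
    assume "inner f f = 0"
    then have "(\<Sum>\<^sub>\<infinity>x. (cmod (ell2_fun f x))\<^sup>2) = 0"
      by (simp add: inner_ell2_def cinner_self)
    then have "(cmod (ell2_fun f x))\<^sup>2 = 0" for x
      using ell2_fun[of f] by (intro nonneg_infsum_le_0D[where A = UNIV]) auto
    then show "f = 0"
      by transfer (auto simp: fun_eq_iff)
  next
    assume "f = 0"
    then show "inner f f = 0"
      by (simp add: inner_ell2_def cinner_self zero_ell2.rep_eq)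
  qed
qed

end

lift_definition delta :: "'a \<Rightarrow> 'a ell2" is "\<lambda>x y. if y = x then 1 else 0"
proof -
  fix x :: 'a
  have "(\<lambda>y. (cmod (if y = x then 1 else 0))\<^sup>2) summable_on {x}"
    by (rule summable_on_finite) simp
  then show "(\<lambda>y. (cmod (if y = x then 1 else 0))\<^sup>2) summable_on UNIV"
    by (rule summable_on_cong_neutral[THEN iffD1, rotated -1]) auto
qed

section \<open>Bounded operators\<close>

text \<open>The type of bounded linear maps in the library only requires real linearity.\<close>

definition bounded_ops :: "('a ell2 \<Rightarrow>\<^sub>L 'a ell2) set" where
  "bounded_ops = {T. \<forall>c f. blinfun_apply T (scaleC c f) = scaleC c (blinfun_apply T f)}"

lift_definition scale_op :: "complex \<Rightarrow> 'a ell2 \<Rightarrow>\<^sub>L 'a ell2" is scaleC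
proof
  fix c :: complex and f g :: "'a ell2" and r :: real
  show "scaleC c (f + g) = scaleC c f + scaleC c g"
    by transfer (simp add: algebra_simps)
  show "scaleC c (r *\<^sub>R f) = r *\<^sub>R scaleC c f"
    by transfer (simp add: algebra_simps)
  have "norm (scaleC c f) = norm f * cmod c" for f :: "'a ell2"
  proof -
    have "(\<Sum>\<^sub>\<infinity>x. (cmod (c * ell2_fun f x))\<^sup>2) = (cmod c)\<^sup>2 * (\<Sum>\<^sub>\<infinity>x. (cmod (ell2_fun f x))\<^sup>2)"
      using ell2_fun[of f]
      by (subst infsum_cmult_right[symmetric]) (auto simp: norm_mult power_mult_distrib)
    then show ?thesis
      by (simp add: norm_ell2_def scaleC.rep_eq real_sqrt_mult)
  qed
  then show "\<exists>K. \<forall>f :: 'a ell2. norm (scaleC c f) \<le> norm f * K"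
    by (metis order_refl)
qed

definition op_entry :: "('a ell2 \<Rightarrow>\<^sub>L 'a ell2) \<Rightarrow> 'a \<Rightarrow> 'a \<Rightarrow> complex" where
  "op_entry T x y = cinner (delta x) (blinfun_apply T (delta y))"

definition is_adjoint :: "('a ell2 \<Rightarrow>\<^sub>L 'a ell2) \<Rightarrow> ('a ell2 \<Rightarrow>\<^sub>L 'a ell2) \<Rightarrow> bool" where
  "is_adjoint T T' \<longleftrightarrow>
     (\<forall>f g. cinner (blinfun_apply T f) g = cinner f (blinfun_apply T' g))"

definition cstar_subalgebra :: "('a ell2 \<Rightarrow>\<^sub>L 'a ell2) set \<Rightarrow> bool" where
  "cstar_subalgebra A \<longleftrightarrow>
     A \<subseteq> bounded_ops \<and> 0 \<in> A \<and>
     (\<forall>T\<in>A. \<forall>U\<in>A. T + U \<in> A) \<and>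
     (\<forall>c. \<forall>T\<in>A. scale_op c o\<^sub>L T \<in> A) \<and>
     (\<forall>T\<in>A. \<forall>U\<in>A. T o\<^sub>L U \<in> A) \<and>
     (\<forall>T\<in>A. \<forall>T'. is_adjoint T T' \<longrightarrow> T' \<in> A) \<and>
     closed A"

section \<open>Groups\<close>

text \<open>
  Groups are rendered by the class \<^class>\<open>group_add\<close>, which is the library's class of
  not necessarily commutative groups; it is written additively.  Thus the product $xy$ is
  \<open>x + y\<close>, the identity is \<open>0\<close>, $x^{-1}y$ is \<open>- x + y\<close> and $xy^{-1}$ is \<open>x - y\<close>.
\<close>

definition is_subgroup :: "'g::group_add set \<Rightarrow> bool" where
  "is_subgroup H \<longleftrightarrow> 0 \<in> H \<and> (\<forall>x\<in>H. \<forall>y\<in>H. x + y \<in> H) \<and> (\<forall>x\<in>H. - x \<in> H)"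

definition generates :: "'g::group_add set \<Rightarrow> bool" where
  "generates S \<longleftrightarrow> is_subgroup hull S = UNIV"

definition invariant_mean :: "(('g::group_add \<Rightarrow> complex) \<Rightarrow> complex) \<Rightarrow> bool" where
  "invariant_mean m \<longleftrightarrow>
     (\<forall>f g. bounded (range f) \<longrightarrow> bounded (range g) \<longrightarrow> m (\<lambda>x. f x + g x) = m f + m g) \<and>
     (\<forall>c f. bounded (range f) \<longrightarrow> m (\<lambda>x. c * f x) = c * m f) \<and>
     (\<forall>f. bounded (range f) \<longrightarrow> range f \<subseteq> \<real>\<^sub>\<ge>\<^sub>0 \<longrightarrow> m f \<in> \<real>\<^sub>\<ge>\<^sub>0) \<and>
     m (\<lambda>_. 1) = 1 \<and>
     (\<forall>a f. bounded (range f) \<longrightarrow> m (\<lambda>x. f (- a + x)) = m f)"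

definition amenable :: "'g::group_add itself \<Rightarrow> bool" where
  "amenable _ \<longleftrightarrow> (\<exists>m :: ('g \<Rightarrow> complex) \<Rightarrow> complex. invariant_mean m)"

definition positive_definite :: "('g::group_add \<Rightarrow> complex) \<Rightarrow> bool" where
  "positive_definite \<phi> \<longleftrightarrow>
     (\<forall>F c. finite F \<longrightarrow> (\<Sum>s\<in>F. \<Sum>t\<in>F. cnj (c s) * \<phi> (- s + t) * c t) \<in> \<real>\<^sub>\<ge>\<^sub>0)"

text \<open>The left regular representation.\<close>

lift_definition translate :: "'g::group_add \<Rightarrow> 'g ell2 \<Rightarrow> 'g ell2" is "\<lambda>s f x. f (- s + x)"
proof -
  fix s :: 'g and f :: "'g \<Rightarrow> complex"
  assume "(\<lambda>x. (cmod (f x))\<^sup>2) summable_on UNIV"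
  moreover have "bij (\<lambda>x. - s + x)" by (rule bij_plus)
  ultimately show "(\<lambda>x. (cmod (f (- s + x)))\<^sup>2) summable_on UNIV"
    using summable_on_reindex_bij_betw[of "\<lambda>x. - s + x" UNIV UNIV "\<lambda>x. (cmod (f x))\<^sup>2"] by simp
qed

lift_definition left_regular :: "'g::group_add \<Rightarrow> 'g ell2 \<Rightarrow>\<^sub>L 'g ell2" is translate
proof
  fix s :: 'g and f g :: "'g ell2" and r :: real
  show "translate s (f + g) = translate s f + translate s g"
    by transfer simp
  show "translate s (r *\<^sub>R f) = r *\<^sub>R translate s f"
    by transfer simp
  have "norm (translate s f) = norm f * 1" for f :: "'g ell2"
    using infsum_reindex_bij_betw[OF bij_plus, of "\<lambda>x. (cmod (ell2_fun f x))\<^sup>2" "- s"]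
    by (simp add: norm_ell2_def translate.rep_eq)
  then show "\<exists>K. \<forall>f :: 'g ell2. norm (translate s f) \<le> norm f * K"
    by (metis order_refl)
qed

definition reduced_cstar :: "('g::group_add ell2 \<Rightarrow>\<^sub>L 'g ell2) set" where
  "reduced_cstar = cstar_subalgebra hull (range left_regular)"

definition finite_propagation :: "('g::group_add ell2 \<Rightarrow>\<^sub>L 'g ell2) \<Rightarrow> bool" where
  "finite_propagation T \<longleftrightarrow> (\<exists>F. finite F \<and> (\<forall>x y. op_entry T x y \<noteq> 0 \<longrightarrow> x - y \<in> F))"

definition uniform_roe :: "('g::group_add ell2 \<Rightarrow>\<^sub>L 'g ell2) set" where
  "uniform_roe = closure {T \<in> bounded_ops. finite_propagation T}"

section \<open>Schur multipliers\<close>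

definition is_schur_image ::
  "('g::group_add \<Rightarrow> complex) \<Rightarrow> ('g ell2 \<Rightarrow>\<^sub>L 'g ell2) \<Rightarrow> ('g ell2 \<Rightarrow>\<^sub>L 'g ell2) \<Rightarrow> bool" where
  "is_schur_image \<phi> T U \<longleftrightarrow>
     U \<in> bounded_ops \<and> (\<forall>x y. op_entry U x y = \<phi> (x - y) * op_entry T x y)"

definition schur_multiplier ::
  "('g::group_add \<Rightarrow> complex) \<Rightarrow> ('g ell2 \<Rightarrow>\<^sub>L 'g ell2) \<Rightarrow> ('g ell2 \<Rightarrow>\<^sub>L 'g ell2)" where
  "schur_multiplier \<phi> T = (THE U. is_schur_image \<phi> T U)"

text \<open>
  \<open>schur_multiplier \<phi> T\<close> is meaningful only if the matrix in question is that of a bounded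
  operator, which is what the following predicate records.
\<close>

definition schur_multiplier_defined :: "('g::group_add \<Rightarrow> complex) \<Rightarrow> bool" where
  "schur_multiplier_defined \<phi> \<longleftrightarrow> (\<forall>T\<in>bounded_ops. \<exists>!U. is_schur_image \<phi> T U)"

text \<open>\<open>bounded_maps_on A\<close> is $B(A)$, for a complex subspace \<open>A\<close> of the bounded operators.\<close>

definition bounded_maps_on ::
  "('a ell2 \<Rightarrow>\<^sub>L 'a ell2) set \<Rightarrow> (('a ell2 \<Rightarrow>\<^sub>L 'a ell2) \<Rightarrow> ('a ell2 \<Rightarrow>\<^sub>L 'a ell2)) set" where
  "bounded_maps_on A =
     {M. (\<forall>T\<in>A. M T \<in> A) \<and>
         (\<forall>T\<in>A. \<forall>U\<in>A. M (T + U) = M T + M U) \<and>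
         (\<forall>c. \<forall>T\<in>A. M (scale_op c o\<^sub>L T) = scale_op c o\<^sub>L M T) \<and>
         (\<exists>C. \<forall>T\<in>A. norm (M T) \<le> C * norm T)}"

definition sot_tendsto ::
  "('a ell2 \<Rightarrow>\<^sub>L 'a ell2) set \<Rightarrow> (nat \<Rightarrow> ('a ell2 \<Rightarrow>\<^sub>L 'a ell2) \<Rightarrow> ('a ell2 \<Rightarrow>\<^sub>L 'a ell2)) \<Rightarrow>
     (('a ell2 \<Rightarrow>\<^sub>L 'a ell2) \<Rightarrow> ('a ell2 \<Rightarrow>\<^sub>L 'a ell2)) \<Rightarrow> bool" where
  "sot_tendsto A M L \<longleftrightarrow> (\<forall>T\<in>A. (\<lambda>n. norm (M n T - L T)) \<longlonglongrightarrow> 0)"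

section \<open>Site percolation\<close>

definition cayley_edges :: "'g::group_add set \<Rightarrow> ('g \<times> 'g) set" where
  "cayley_edges S = {(x, y). - x + y \<in> S}"

definition site_percolation :: "('v \<Rightarrow> bool) measure \<Rightarrow> bool" where
  "site_percolation P \<longleftrightarrow>
     prob_space P \<and> sets P = sets (Pi\<^sub>M UNIV (\<lambda>_. count_space (UNIV :: bool set)))"

text \<open>
  \<open>E\<close> is the (symmetric) edge relation of an undirected graph; the relation below is that of the
  subgraph induced on the open sites.
\<close>

definition cluster :: "('v \<times> 'v) set \<Rightarrow> ('v \<Rightarrow> bool) \<Rightarrow> 'v \<Rightarrow> 'v set" where
  "cluster E \<omega> x = {y. \<omega> x \<and> (x, y) \<in> {(u, v) \<in> E. \<omega> u \<and> \<omega> v}\<^sup>*}"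

definition invariant_percolation :: "('g::group_add \<Rightarrow> bool) measure \<Rightarrow> bool" where
  "invariant_percolation P \<longleftrightarrow> (\<forall>a. distr P P (\<lambda>\<omega> x. \<omega> (- a + x)) = P)"

definition no_infinite_components :: "('v \<times> 'v) set \<Rightarrow> ('v \<Rightarrow> bool) measure \<Rightarrow> bool" where
  "no_infinite_components E P \<longleftrightarrow> (AE \<omega> in P. \<forall>x. finite (cluster E \<omega> x))"

definition Phi :: "('g::group_add \<Rightarrow> complex) \<Rightarrow> 'g \<Rightarrow> complex" where
  "Phi f s = (\<Sum>\<^sub>\<infinity>t. f t * cnj (f (t + s)))"

text \<open>
  For infinite \<open>K\<close> this is the zero function, since then \<open>card K = 0\<close> and \<open>0 powr a = 0\<close>.
\<close>

definition normalized_indicator :: "real \<Rightarrow> 'v set \<Rightarrow> 'v \<Rightarrow> complex" where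
  "normalized_indicator q K x =
     complex_of_real (real (card K) powr (- 1 / q)) * indicator K x"

definition cluster_function ::
  "'g::group_add set \<Rightarrow> real \<Rightarrow> ('g \<Rightarrow> bool) measure \<Rightarrow> 'g \<Rightarrow> complex" where
  "cluster_function S q P s =
     (\<integral>\<omega>. Phi (normalized_indicator q (cluster (cayley_edges S) \<omega> 0)) s \<partial>P)"

definition approximating_percolations ::
  "'g::group_add set \<Rightarrow> (nat \<Rightarrow> real) \<Rightarrow> (nat \<Rightarrow> ('g \<Rightarrow> bool) measure) \<Rightarrow> bool" where
  "approximating_percolations S p P \<longleftrightarrow>
     (\<forall>n. site_percolation (P n) \<and> invariant_percolation (P n) \<and>
          no_infinite_components (cayley_edges S) (P n)) \<and>
     (\<forall>s. (\<lambda>n. cluster_function S (p n) (P n) s) \<longlonglongrightarrow> 1)"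

end

theory Submission
  imports Defs
begin

text \<open>
Write \<open>K\<close> for the cluster of the identity.  Since \<open>\<Phi>(f)(s)\<close> is the inner product of \<open>f\<close> with its
right translate, the function under study is
\<open>\<phi>(s) = E(|K| powr (-2/q) * |{t \<in> K. t + s \<in> K}|)\<close>, a number between \<open>0\<close> and \<open>1\<close> for \<open>q \<le> 2\<close>.

Amenability yields percolations.  By an argument with Hall's marriage theorem (\<open>mean_not_doubling\<close>) an
invariant mean forbids that a fixed finite set doubles all finite sets, and this gives Foelner sets
\<open>F\<close> (\<open>amenable_foelner\<close>).  Throw independent translates of \<open>F\<close> into the group, with a density that
is a large constant times \<open>1/|F|\<close>, close all vertices on the boundary of some translate and all
vertices that are in no translate.  Every cluster then lies in one translate of \<open>F\<close>, so the clusters are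
uniformly bounded, and the identity is closed only with small probability (\<open>foelner_percolation\<close>).
For an invariant percolation with bounded clusters, transporting mass \<open>1/|K(x)|\<close> between the
vertices of a cluster shows \<open>E(|{t \<in> K. t + s \<in> K}| / |K|) = P(s \<in> K)\<close> (\<open>mass_transport\<close>), and this
is close to \<open>1\<close> because \<open>s\<close> is joined to the identity as soon as the finitely many vertices of a fixed path are
open.  The exponent \<open>2/q\<close> in place of \<open>1\<close> costs the factor \<open>b powr (1 - 2/q)\<close>, where \<open>b\<close>
bounds the cluster sizes; it tends to \<open>1\<close> as \<open>q\<close> tends to \<open>2\<close>, so it is harmless if the cluster bound is
allowed to grow slowly along the sequence (\<open>slow_index\<close>).

Percolations yield amenability.  The average of a bounded function \<open>g\<close> over \<open>-K\<close>, weighted by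
\<open>|K| powr (-2/q)\<close> and integrated over the percolation, changes by at most \<open>2 |g| (\<phi>(0) - \<phi>(a))\<close>
when \<open>g\<close> is translated by \<open>a\<close> (\<open>cluster_average_translate\<close>).  So these functionals are asymptotically
invariant, and any of their pointwise cluster points, which exist by Tychonoff's theorem, is an
invariant mean.

Schur multipliers.  For a single finite set \<open>A\<close> the kernel \<open>|A| powr (-2/q) |{t \<in> A. t + x - y \<in> A}|\<close> is a sum
over \<open>v\<close> of the products of the indicators of \<open>v - x \<in> A\<close> and \<open>v - y \<in> A\<close>.  Hence \<open>\<phi>\<close> is an average
of Gram matrices: it is positive definite, and by the Cauchy--Schwarz inequality its Schur multiplier is a
contraction (\<open>overlap_form_nonneg\<close>, \<open>overlap_form_bound\<close>).  For contractions, convergence to the identity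
need only be tested on a dense set.  On an operator whose entries live on finitely many diagonals
\<open>x - y = s\<close> it follows from \<open>\<phi>\<^sub>n(s) \<rightarrow> 1\<close> for these finitely many \<open>s\<close>
(\<open>finite_propagation_schur_bound\<close>), and such operators are dense in the uniform Roe algebra, which contains the
reduced group algebra.
\<close>

section \<open>Hall's marriage theorem for locally finite relations\<close>

text \<open>
Among all subrelations that still satisfy Hall's condition there is a minimal one, because local
finiteness makes the condition stable under intersections of chains.  A minimal one is the graph of a
function: if \<open>x\<close> had two partners, then deleting either edge would violate the condition on
some finite set, and since \<open>X \<mapsto> |Q(X)|\<close> is submodular, the two violating sets together would already
violate it for the relation itself.
\<close>

lemma hall_locally_finite:
  fixes R :: "('a \<times> 'b) set"
  assumes fin: "\<And>x. finite (R `` {x})"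
    and hall: "\<And>X. finite X \<Longrightarrow> card X \<le> card (R `` X)"
  obtains f where "inj f" and "\<And>x. (x, f x) \<in> R"
proof -
  \<comment> \<open>The sets of edges that can be removed; a maximal one leaves a minimal relation.\<close>
  define \<D> where "\<D> = {D. \<forall>X. finite X \<longrightarrow> card X \<le> card ((R - D) `` X)}"
  have fin_Image: "finite (R `` X)" if "finite X" for X
  proof -
    have "R `` X = (\<Union>x\<in>X. R `` {x})" by blast
    with that fin show ?thesis by simp
  qed
  have "\<exists>D\<in>\<D>. \<forall>D'\<in>\<D>. D \<subseteq> D' \<longrightarrow> D' = D"
  proof (rule subset_Zorn_nonempty)
    have "{} \<in> \<D>" using hall by (simp add: \<D>_def)
    then show "\<D> \<noteq> {}" by blast
    fix C assume C: "C \<noteq> {}" "subset.chain \<D> C"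
    have "card X \<le> card ((R - \<Union>C) `` X)" if X: "finite X" for X
    proof -
      let ?E = "R \<inter> X \<times> UNIV"
      have "?E \<subseteq> X \<times> R `` X" by blast
      then have "finite (?E \<inter> \<Union>C)"
        using X fin_Image[OF X] by (meson finite_Int finite_SigmaI finite_subset)
      then obtain D where D: "D \<in> C" "?E \<inter> \<Union>C \<subseteq> D"
        using finite_subset_Union_chain[of "?E \<inter> \<Union>C" C \<D>] C by blast
      then have "(R - \<Union>C) `` X = (R - D) `` X" by blast
      moreover have "D \<in> \<D>" using C(2) D(1) by (auto simp: subset.chain_def)
      ultimately show ?thesis using X by (simp add: \<D>_def)
    qed
    then show "\<Union>C \<in> \<D>" by (simp add: \<D>_def)
  qed
  then obtain D where D: "D \<in> \<D>" and maxD: "\<And>D'. D' \<in> \<D> \<Longrightarrow> D \<subseteq> D' \<Longrightarrow> D' = D" by blast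
  define Q where "Q = R - D"
  have hallQ: "card X \<le> card (Q `` X)" if "finite X" for X
    using D that by (simp add: \<D>_def Q_def)
  have finQ: "finite (Q `` X)" if "finite X" for X
    using fin_Image[OF that] by (rule rev_finite_subset) (auto simp: Q_def)
  \<comment> \<open>The witness is a violating set for the relation without the edge, with \<open>x\<close> itself taken out.\<close>
  have critical: "\<exists>X. finite X \<and> x \<notin> X \<and> card (Q `` X \<union> (Q `` {x} - {y})) \<le> card X"
    if xy: "(x, y) \<in> Q" for x y
  proof -
    have "insert (x, y) D \<notin> \<D>" using maxD[of "insert (x, y) D"] xy by (auto simp: Q_def)
    then obtain X where X: "finite X" "card ((R - insert (x, y) D) `` X) < card X"
      by (auto simp: \<D>_def not_le)
    have eq: "R - insert (x, y) D = Q - {(x, y)}" by (auto simp: Q_def)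
    have "x \<in> X"
    proof (rule ccontr)
      assume "x \<notin> X"
      then have "(Q - {(x, y)}) `` X = Q `` X" by auto
      with X hallQ[of X] eq show False by simp
    qed
    moreover from this have "(Q - {(x, y)}) `` X = Q `` (X - {x}) \<union> (Q `` {x} - {y})" by auto
    ultimately show ?thesis using X eq
      by (intro exI[of _ "X - {x}"]) (auto simp: card_Diff_singleton)
  qed
  have single: "y = z" if edges: "(x, y) \<in> Q" "(x, z) \<in> Q" for x y z
  proof (rule ccontr)
    assume "y \<noteq> z"
    obtain X where X: "finite X" "x \<notin> X" "card (Q `` X \<union> (Q `` {x} - {y})) \<le> card X"
      using critical[OF edges(1)] by blast
    obtain Y where Y: "finite Y" "x \<notin> Y" "card (Q `` Y \<union> (Q `` {x} - {z})) \<le> card Y"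
      using critical[OF edges(2)] by blast
    let ?A = "Q `` X \<union> (Q `` {x} - {y})" and ?B = "Q `` Y \<union> (Q `` {x} - {z})"
    have finAB: "finite ?A" "finite ?B" using finQ[OF X(1)] finQ[OF Y(1)] finQ[of "{x}"] by auto
    have "Q `` (insert x (X \<union> Y)) \<subseteq> ?A \<union> ?B" using \<open>y \<noteq> z\<close> by auto
    then have "card (insert x (X \<union> Y)) \<le> card (?A \<union> ?B)"
      using hallQ[of "insert x (X \<union> Y)"] X(1) Y(1) finAB
      by (meson card_mono finite_UnI finite_insert le_trans)
    moreover have "Q `` (X \<inter> Y) \<subseteq> ?A \<inter> ?B" by auto
    then have "card (X \<inter> Y) \<le> card (?A \<inter> ?B)"
      using hallQ[of "X \<inter> Y"] X(1) finAB by (meson card_mono finite_Int le_trans)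
    moreover have "card ?A + card ?B = card (?A \<union> ?B) + card (?A \<inter> ?B)"
      using finAB by (rule card_Un_Int)
    moreover have "card X + card Y = card (X \<union> Y) + card (X \<inter> Y)"
      using X(1) Y(1) by (rule card_Un_Int)
    ultimately show False using X Y by simp
  qed
  have "\<exists>y. (x, y) \<in> Q" for x
    using hallQ[of "{x}"] by (cases "Q `` {x} = {}") auto
  then obtain f where f: "\<And>x. (x, f x) \<in> Q" by metis
  have "inj f"
  proof (rule injI, rule ccontr)
    fix x x' assume "f x = f x'" "x \<noteq> x'"
    have "Q `` {x, x'} \<subseteq> {f x}"
    proof
      fix y assume "y \<in> Q `` {x, x'}"
      then consider "(x, y) \<in> Q" | "(x', y) \<in> Q" by blast
      then show "y \<in> {f x}"
        using single[OF _ f[of x]] single[OF _ f[of x']] \<open>f x = f x'\<close> by cases auto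
    qed
    then have "card (Q `` {x, x'}) \<le> 1" using card_mono[of "{f x}"] by fastforce
    with hallQ[of "{x, x'}"] \<open>x \<noteq> x'\<close> show False by simp
  qed
  moreover have "(x, f x) \<in> R" for x using f[of x] by (simp add: Q_def)
  ultimately show thesis by (rule that)
qed

section \<open>Foelner sets from an invariant mean\<close>

lemma mean_sum:
  assumes m: "invariant_mean m" and "finite J" and bdd: "\<And>j. j \<in> J \<Longrightarrow> bounded (range (h j))"
  shows "m (\<lambda>x. \<Sum>j\<in>J. h j x) = (\<Sum>j\<in>J. m (h j))"
    and "bounded (range (\<lambda>x. \<Sum>j\<in>J. h j x))"
proof -
  have "m (\<lambda>x. \<Sum>j\<in>J. h j x) = (\<Sum>j\<in>J. m (h j)) \<and> bounded (range (\<lambda>x. \<Sum>j\<in>J. h j x))"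
    using \<open>finite J\<close> bdd
  proof (induction J rule: finite_induct)
    case empty
    have "bounded (range (\<lambda>x :: 'a. 1 :: complex))" by (rule finite_imp_bounded) simp
    then have "m (\<lambda>x. 0 * 1) = 0 * m (\<lambda>_. 1)"
      using m unfolding invariant_mean_def by blast
    then show ?case by simp
  next
    case (insert j J)
    then have "bounded (range (h j))" "bounded (range (\<lambda>x. \<Sum>j\<in>J. h j x))" by auto
    moreover from this have "bounded (range (\<lambda>x. h j x + (\<Sum>j\<in>J. h j x)))"
      by (rule bounded_plus_comp)
    ultimately show ?case using insert m by (simp add: invariant_mean_def)
  qed
  then show "m (\<lambda>x. \<Sum>j\<in>J. h j x) = (\<Sum>j\<in>J. m (h j))"
    "bounded (range (\<lambda>x. \<Sum>j\<in>J. h j x))" by auto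
qed

lemma mean_translate_indicator:
  assumes m: "invariant_mean m"
  shows "m (indicator ((+) n ` A)) = m (indicator A)"
proof -
  have "indicator ((+) n ` A) = (\<lambda>x. indicator A (- n + x) :: complex)"
    by (rule ext) (force simp: indicator_def image_iff add.assoc[symmetric])
  moreover have "bounded (range (indicator A :: _ \<Rightarrow> complex))"
    by (rule finite_imp_bounded, rule finite_subset[of _ "{0, 1}"]) (auto simp: indicator_def)
  ultimately show ?thesis using m by (simp add: invariant_mean_def)
qed

text \<open>
If \<open>N\<close> doubled every finite set, Hall's theorem would give an injection \<open>f\<close> from two copies of the
group into the group with \<open>f(x, i) \<in> N + x\<close>.  Cut the \<open>i\<close>-th copy into the pieces on which
\<open>f(x, i) = n + x\<close> for a fixed \<open>n \<in> N\<close>.  The pieces have total mean \<open>2\<close>, while their translates by the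
respective \<open>n\<close> are disjoint and so have total mean at most \<open>1\<close>: this is a paradoxical
decomposition.
\<close>

lemma mean_not_doubling:
  fixes m :: "('g::group_add \<Rightarrow> complex) \<Rightarrow> complex" and N :: "'g set"
  assumes m: "invariant_mean m" and N: "finite N"
  shows "\<exists>F. finite F \<and> card ((\<lambda>(n, x). n + x) ` (N \<times> F)) < 2 * card F"
proof (rule ccontr)
  assume "\<not> ?thesis"
  then have doubling: "2 * card F \<le> card ((\<lambda>(n, x). n + x) ` (N \<times> F))" if "finite F" for F
    using that by (auto simp: not_less)
  define R :: "(('g \<times> bool) \<times> 'g) set" where "R = {((x, i), y). y - x \<in> N}"
  have R_Image: "R `` X = (\<lambda>(n, x). n + x) ` (N \<times> fst ` X)" for X
    by (force simp: R_def image_iff Image_iff)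
  have R_fin: "finite (R `` {x})" for x using N by (simp add: R_Image)
  have R_hall: "card X \<le> card (R `` X)" if X: "finite X" for X
  proof -
    have "card X \<le> card (fst ` X \<times> (UNIV :: bool set))"
      using X by (intro card_mono) force+
    also have "\<dots> = 2 * card (fst ` X)" by (simp add: card_cartesian_product)
    also have "\<dots> \<le> card (R `` X)" using doubling[of "fst ` X"] X by (simp add: R_Image)
    finally show ?thesis .
  qed
  obtain f where f: "inj f" "\<And>x. (x, f x) \<in> R"
    by (rule hall_locally_finite[OF R_fin R_hall]) blast+
  define A where "A j = {x. f (x, fst j) - x = snd j}" for j :: "bool \<times> 'g"
  define J where "J = (UNIV :: bool set) \<times> N"
  have J: "finite J" using N by (simp add: J_def)
  have bdd: "bounded (range (indicator B :: 'g \<Rightarrow> complex))" for B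
    by (rule finite_imp_bounded, rule finite_subset[of _ "{0, 1}"]) (auto simp: indicator_def)
  have one: "m (\<lambda>_. 1) = 1" using m by (simp add: invariant_mean_def)
  have mass: "(\<Sum>n\<in>N. m (indicator (A (i, n)))) = 1" for i
  proof -
    have "(\<Sum>n\<in>N. indicator (A (i, n)) x) = (1 :: complex)" for x
    proof -
      have "f (x, i) - x \<in> N" using f(2)[of "(x, i)"] by (simp add: R_def)
      moreover have "(\<Sum>n\<in>N. indicator (A (i, n)) x) =
          (\<Sum>n\<in>N. if n = f (x, i) - x then 1 else 0 :: complex)"
        by (intro sum.cong) (auto simp: A_def indicator_def)
      ultimately show ?thesis using N by simp
    qed
    then show ?thesis
      using mean_sum(1)[OF m N, of "\<lambda>n. indicator (A (i, n))"] bdd one by simp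
  qed
  define h where "h x = (\<Sum>j\<in>J. indicator ((+) (snd j) ` A j) x :: complex)" for x
  have "m h = (\<Sum>j\<in>J. m (indicator ((+) (snd j) ` A j)))"
    unfolding h_def[abs_def] using bdd by (intro mean_sum[OF m J])
  also have "\<dots> = (\<Sum>j\<in>J. m (indicator (A j)))"
    using mean_translate_indicator[OF m] by simp
  also have "\<dots> = (\<Sum>i\<in>(UNIV::bool set). \<Sum>n\<in>N. m (indicator (A (i, n))))"
    unfolding J_def by (subst sum.cartesian_product) (simp add: case_prod_beta)
  also have "\<dots> = 2" using mass by simp
  finally have m_h: "m h = 2" .
  have bdd_h: "bounded (range h)"
    unfolding h_def[abs_def] using bdd by (intro mean_sum[OF m J])
  have "h x = indicator (range f) x" for x
  proof -
    have pre: "x \<in> (+) n ` A (i, n) \<longleftrightarrow> x = f (- n + x, i)" for i n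
    proof
      assume "x \<in> (+) n ` A (i, n)"
      then obtain z where z: "x = n + z" "f (z, i) - z = n" by (auto simp: A_def)
      then have "f (z, i) = x" by (metis diff_add_cancel)
      moreover have "- n + x = z" using z(1) by simp
      ultimately show "x = f (- n + x, i)" by simp
    next
      assume "x = f (- n + x, i)"
      then have "- n + x \<in> A (i, n)" by (simp add: A_def diff_eq_eq add.assoc[symmetric])
      then show "x \<in> (+) n ` A (i, n)" by (rule rev_image_eqI) (simp add: add.assoc[symmetric])
    qed
    show ?thesis
    proof (cases "x \<in> range f")
      case True
      then obtain y i where yi: "x = f (y, i)" by auto
      then have mem: "x - y \<in> N" using f(2)[of "(y, i)"] by (simp add: R_def)
      have only: "x \<in> (+) n ` A (i', n) \<longleftrightarrow> (i', n) = (i, x - y)" for i' n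
      proof -
        have "x \<in> (+) n ` A (i', n) \<longleftrightarrow> f (y, i) = f (- n + x, i')"
          unfolding pre by (simp add: yi)
        also have "\<dots> \<longleftrightarrow> y = - n + x \<and> i = i'" by (simp add: inj_eq[OF f(1)])
        also have "y = - n + x \<longleftrightarrow> n = x - y"
          unfolding eq_diff_eq by (auto simp: add.assoc[symmetric])
        finally show ?thesis by auto
      qed
      have only': "x \<in> (+) (snd j) ` A j \<longleftrightarrow> j = (i, x - y)" for j
        using only[of "snd j" "fst j"] by simp
      have "h x = (\<Sum>j\<in>J. if j = (i, x - y) then 1 else 0)"
        unfolding h_def indicator_def only' of_bool_def ..
      moreover have "(i, x - y) \<in> J" using mem by (simp add: J_def)
      ultimately show ?thesis using True J by simp
    next
      case False
      then have "x \<notin> (+) (snd j) ` A j" for j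
        using pre[of "snd j" "fst j"] by auto
      then show ?thesis using False by (simp add: h_def)
    qed
  qed
  then have h: "h = indicator (range f)" by blast
  have bdd_one: "bounded (range (\<lambda>x::'g. 1 :: complex))" by (rule finite_imp_bounded) simp
  have bdd_neg: "bounded (range (\<lambda>x. (- 1) * h x))"
    using bdd_h bounded_uminus[of "range h"] by (simp add: image_image)
  have "m (\<lambda>x. 1 + (- 1) * h x) = m (\<lambda>_. 1) + m (\<lambda>x. (- 1) * h x)"
    using m bdd_one bdd_neg unfolding invariant_mean_def by blast
  also have "m (\<lambda>x. (- 1) * h x) = (- 1) * m h"
    using m bdd_h unfolding invariant_mean_def by blast
  finally have "m (\<lambda>x. 1 + (- 1) * h x) = - 1" using m_h one by simp
  moreover have "m (\<lambda>x. 1 + (- 1) * h x) \<in> \<real>\<^sub>\<ge>\<^sub>0"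
  proof -
    have "bounded (range (\<lambda>x. 1 + (- 1) * h x))" using bdd_one bdd_neg by (rule bounded_plus_comp)
    moreover have "range (\<lambda>x. 1 + (- 1) * h x) \<subseteq> \<real>\<^sub>\<ge>\<^sub>0" by (auto simp: h indicator_def)
    ultimately show ?thesis using m unfolding invariant_mean_def by blast
  qed
  ultimately show False by (simp add: complex_nonneg_Reals_iff)
qed

text \<open>
If some finite set \<open>B\<close> increased the size of every finite set by a factor \<open>1 + \<delta>\<close>, a power of \<open>B\<close> would
double every finite set.  The mean is invariant on the left and therefore controls \<open>B + F\<close>, whereas the edges of
the Cayley graph are right translations; inversion turns the one kind of Foelner set into the
other.
\<close>

lemma amenable_foelner:
  fixes S :: "'g::group_add set"
  assumes "amenable TYPE('g)" and S: "finite S" and "\<epsilon> > 0"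
  obtains F where "finite F" "F \<noteq> {}" "real (card {x\<in>F. \<exists>s\<in>S. x + s \<notin> F}) \<le> \<epsilon> * real (card F)"
proof -
  obtain m :: "('g \<Rightarrow> complex) \<Rightarrow> complex" where m: "invariant_mean m"
    using assms by (auto simp: amenable_def)
  define B where "B = insert 0 (uminus ` S)"
  define prd where "prd N F = (\<lambda>(n, x). n + x) ` (N \<times> F)" for N F :: "'g set"
  have prd_fin: "finite (prd N F)" if "finite N" "finite F" for N F using that by (simp add: prd_def)
  have prd_assoc: "prd (prd K N) F = prd K (prd N F)" for K N F
    by (auto simp: prd_def image_iff add.assoc) (metis add.assoc)+
  have B: "finite B" using S by (simp add: B_def)
  \<comment> \<open>Dividing by \<open>card S + 1\<close> rather than \<open>card S\<close> covers an empty generating set.\<close>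
  define \<delta> where "\<delta> = \<epsilon> / (card S + 1)"
  have \<delta>: "\<delta> > 0" using assms by (simp add: \<delta>_def)
  have "\<exists>F. finite F \<and> F \<noteq> {} \<and> real (card (prd B F)) < (1 + \<delta>) * real (card F)"
  proof (rule ccontr)
    assume "\<not> ?thesis"
    then have grow: "(1 + \<delta>) * real (card F) \<le> real (card (prd B F))" if "finite F" for F
      using that by (cases "F = {}") (auto simp: not_less)
    define N where "N k = (prd B ^^ k) {0}" for k
    have N_fin: "finite (N k)" for k by (induction k) (auto simp: N_def intro: prd_fin B)
    have N_grow: "(1 + \<delta>) ^ k * real (card F) \<le> real (card (prd (N k) F))" if F: "finite F" for k F
    proof (induction k)
      case 0
      have "prd (N 0) F = F" by (force simp: prd_def N_def)
      then show ?case by simp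
    next
      case (Suc k)
      have "(1 + \<delta>) ^ Suc k * real (card F) \<le> (1 + \<delta>) * real (card (prd (N k) F))"
        using Suc \<delta> by (simp add: mult.assoc)
      also have "\<dots> \<le> real (card (prd B (prd (N k) F)))" using grow prd_fin N_fin F by blast
      also have "prd B (prd (N k) F) = prd (N (Suc k)) F" by (simp add: N_def prd_assoc)
      finally show ?case .
    qed
    obtain k where k: "2 < (1 + \<delta>) ^ k" using real_arch_pow[of "1 + \<delta>" 2] \<delta> by auto
    obtain F where F: "finite F" "card (prd (N k) F) < 2 * card F"
      using mean_not_doubling[OF m N_fin[of k]] by (auto simp: prd_def)
    have "2 * real (card F) \<le> (1 + \<delta>) ^ k * real (card F)" using k by (intro mult_right_mono) auto
    also have "\<dots> \<le> real (card (prd (N k) F))" by (rule N_grow[OF F(1)])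
    finally show False using F(2) by linarith
  qed
  then obtain F where F: "finite F" "F \<noteq> {}" "real (card (prd B F)) < (1 + \<delta>) * real (card F)" by blast
  have "F \<subseteq> prd B F" by (force simp: prd_def B_def)
  then have small: "real (card (prd B F - F)) \<le> \<delta> * real (card F)"
    using F prd_fin[OF B F(1)] by (simp add: card_Diff_subset of_nat_diff card_mono algebra_simps)
  define F' where "F' = uminus ` F"
  have bij: "bij_betw (uminus :: 'g \<Rightarrow> 'g) A (uminus ` A)" for A by (simp add: bij_betw_def)
  have "card {x\<in>F'. \<exists>s\<in>S. x + s \<notin> F'} \<le> (\<Sum>s\<in>S. card {x\<in>F'. x + s \<notin> F'})"
  proof -
    have "{x\<in>F'. \<exists>s\<in>S. x + s \<notin> F'} = (\<Union>s\<in>S. {x\<in>F'. x + s \<notin> F'})" by blast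
    then show ?thesis using card_UN_le[OF S] by metis
  qed
  also have "\<dots> \<le> (\<Sum>s\<in>S. card (prd B F - F))"
  proof (rule sum_mono)
    fix s assume s: "s \<in> S"
    have "(\<lambda>x. - (x + s)) ` {x\<in>F'. x + s \<notin> F'} \<subseteq> prd B F - F"
    proof clarsimp
      fix x assume x: "x \<in> F'" "x + s \<notin> F'"
      have "- (x + s) = - s + - x" by (simp add: minus_add)
      moreover have "- x \<in> F" using x by (auto simp: F'_def)
      moreover have "- (x + s) \<notin> F" using x unfolding F'_def by (metis imageI minus_minus)
      ultimately show "- (x + s) \<in> prd B F \<and> - (x + s) \<notin> F"
        using s by (force simp: prd_def B_def image_iff simp del: add_uminus_conv_diff)
    qed
    moreover have "inj_on (\<lambda>x. - (x + s)) {x\<in>F'. x + s \<notin> F'}" by (auto intro: inj_onI)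
    ultimately show "card {x\<in>F'. x + s \<notin> F'} \<le> card (prd B F - F)"
      using prd_fin[OF B F(1)] by (intro card_inj_on_le) auto
  qed
  finally have "card {x\<in>F'. \<exists>s\<in>S. x + s \<notin> F'} \<le> card S * card (prd B F - F)" by simp
  then have "real (card {x\<in>F'. \<exists>s\<in>S. x + s \<notin> F'}) \<le> real (card S * card (prd B F - F))"
    by (rule of_nat_mono)
  also have "\<dots> = card S * real (card (prd B F - F))" by simp
  also have "\<dots> \<le> card S * (\<delta> * real (card F))" using small by (intro mult_left_mono) auto
  also have "\<dots> \<le> (card S + 1) * \<delta> * real (card F)"
    using \<delta> by (simp add: algebra_simps)
  also have "\<dots> = \<epsilon> * real (card F')"
    by (simp add: \<delta>_def F'_def card_image add_pos_nonneg)
  finally show thesis using F by (intro that[of F']) (auto simp: F'_def)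
qed

section \<open>Clusters in a Cayley graph\<close>

locale cayley_graph =
  fixes S :: "'g::group_add set"
  assumes finite_S: "finite S" and symmetric_S: "\<And>s. s \<in> S \<Longrightarrow> - s \<in> S" and generates_S: "generates S"
begin

abbreviation K :: "('g \<Rightarrow> bool) \<Rightarrow> 'g \<Rightarrow> 'g set" where
  "K \<equiv> cluster (cayley_edges S)"

definition open_edges :: "('g \<Rightarrow> bool) \<Rightarrow> ('g \<times> 'g) set" where
  "open_edges \<omega> = {(u, v) \<in> cayley_edges S. \<omega> u \<and> \<omega> v}"

lemma mem_K_iff: "y \<in> K \<omega> x \<longleftrightarrow> \<omega> x \<and> (x, y) \<in> (open_edges \<omega>)\<^sup>*"
  by (simp add: cluster_def open_edges_def)

lemma shift_open_edges_rtrancl: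
  assumes "(x, y) \<in> (open_edges \<omega>)\<^sup>*"
  shows "(a + x, a + y) \<in> (open_edges (\<lambda>z. \<omega> (- a + z)))\<^sup>*"
  using assms
proof (induction rule: rtrancl_induct)
  case (step y z)
  then have "(a + y, a + z) \<in> open_edges (\<lambda>z. \<omega> (- a + z))"
    by (auto simp: open_edges_def cayley_edges_def minus_add add.assoc[symmetric])
  with step show ?case by simp
qed simp

lemma mem_K_shift: "y \<in> K (\<lambda>z. \<omega> (- a + z)) x \<longleftrightarrow> - a + y \<in> K \<omega> (- a + x)"
proof
  assume "y \<in> K (\<lambda>z. \<omega> (- a + z)) x"
  then show "- a + y \<in> K \<omega> (- a + x)"
    using shift_open_edges_rtrancl[of x y "\<lambda>z. \<omega> (- a + z)" "- a"]
    by (auto simp: mem_K_iff add.assoc[symmetric])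
next
  assume "- a + y \<in> K \<omega> (- a + x)"
  then show "y \<in> K (\<lambda>z. \<omega> (- a + z)) x"
    using shift_open_edges_rtrancl[of "- a + x" "- a + y" \<omega> a]
    by (auto simp: mem_K_iff add.assoc[symmetric])
qed

lemma sym_open_edges: "sym (open_edges \<omega>)"
proof (rule symI)
  fix x y assume "(x, y) \<in> open_edges \<omega>"
  then show "(y, x) \<in> open_edges \<omega>"
    using symmetric_S[of "- x + y"] by (auto simp: open_edges_def cayley_edges_def minus_add)
qed

lemma K_open: "y \<in> K \<omega> x \<Longrightarrow> \<omega> y"
  unfolding mem_K_iff by (auto elim!: rtranclE simp: open_edges_def)

lemma K_eq:
  assumes y: "y \<in> K \<omega> x"
  shows "K \<omega> y = K \<omega> x"
proof -
  have xy: "(x, y) \<in> (open_edges \<omega>)\<^sup>*" and "\<omega> x" using y by (auto simp: mem_K_iff)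
  moreover have yx: "(y, x) \<in> (open_edges \<omega>)\<^sup>*"
    using xy sym_rtrancl[OF sym_open_edges] by (rule symD[rotated])
  moreover have "\<omega> y" using y by (rule K_open)
  ultimately show ?thesis
    unfolding set_eq_iff mem_K_iff by (simp, meson rtrancl_trans)
qed

lemma K_sym: "y \<in> K \<omega> x \<longleftrightarrow> x \<in> K \<omega> y"
  using sym_rtrancl[OF sym_open_edges, of \<omega>] K_open by (auto simp: mem_K_iff dest: symD)

text \<open>
A finite set of vertices whose openness forces \<open>x\<close> into the cluster of the identity.  The elements that have such
a set form a subgroup, by concatenating, translating and reversing paths.
\<close>

lemma connecting_set:
  "\<exists>V. finite V \<and> (\<forall>\<omega>. (\<forall>v\<in>V. \<omega> v) \<longrightarrow> x \<in> K \<omega> 0)"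
proof -
  define H where "H = {x. \<exists>V. finite V \<and> (\<forall>\<omega>. (\<forall>v\<in>V. \<omega> v) \<longrightarrow> x \<in> K \<omega> 0)}"
  have "is_subgroup H"
    unfolding is_subgroup_def
  proof (intro conjI ballI)
    show "0 \<in> H" by (auto simp: H_def mem_K_iff intro!: exI[of _ "{0}"])
  next
    fix x y assume "x \<in> H" "y \<in> H"
    then obtain V W where V: "finite V" "\<And>\<omega>. (\<forall>v\<in>V. \<omega> v) \<Longrightarrow> x \<in> K \<omega> 0"
      and W: "finite W" "\<And>\<omega>. (\<forall>v\<in>W. \<omega> v) \<Longrightarrow> y \<in> K \<omega> 0" by (auto simp: H_def)
    have "x + y \<in> K \<omega> 0" if "\<forall>v\<in>V \<union> (+) x ` W. \<omega> v" for \<omega>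
    proof -
      have "y \<in> K (\<lambda>z. \<omega> (x + z)) 0" using that by (intro W(2)) auto
      then have "x + y \<in> K \<omega> x" using mem_K_shift[of y \<omega> "- x" 0] by simp
      moreover have "x \<in> K \<omega> 0" using that by (intro V(2)) auto
      ultimately show ?thesis using K_eq by blast
    qed
    then show "x + y \<in> H" using V(1) W(1)
      by (auto simp: H_def intro!: exI[of _ "V \<union> (+) x ` W"])
  next
    fix x assume "x \<in> H"
    then obtain V where V: "finite V" "\<And>\<omega>. (\<forall>v\<in>V. \<omega> v) \<Longrightarrow> x \<in> K \<omega> 0" by (auto simp: H_def)
    have "- x \<in> K \<omega> 0" if "\<forall>v\<in>(+) (- x) ` V. \<omega> v" for \<omega>
    proof -
      have "x \<in> K (\<lambda>z. \<omega> (- x + z)) 0" using that by (intro V(2)) auto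
      then have "0 \<in> K \<omega> (- x)" using mem_K_shift[of x \<omega> x 0] by simp
      then show ?thesis using K_sym by blast
    qed
    then show "- x \<in> H" using V(1) by (auto simp: H_def intro!: exI[of _ "(+) (- x) ` V"])
  qed
  moreover have "s \<in> H" if "s \<in> S" for s
  proof -
    have "s \<in> K \<omega> 0" if "\<omega> 0" "\<omega> s" for \<omega>
    proof -
      have "(0, s) \<in> open_edges \<omega>" using \<open>s \<in> S\<close> that by (simp add: open_edges_def cayley_edges_def)
      then show ?thesis using that by (simp add: mem_K_iff)
    qed
    then show ?thesis by (auto simp: H_def intro!: exI[of _ "{0, s}"])
  qed
  ultimately have "is_subgroup hull S \<subseteq> H" by (intro hull_minimal) auto
  then show ?thesis using generates_S by (auto simp: generates_def H_def)
qed

lemma countable_group: "countable (UNIV :: 'g set)"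
proof -
  define W where "W = sum_list ` lists S"
  have neg: "- sum_list xs = sum_list (rev (map uminus xs))" for xs :: "'g list"
    by (induction xs) (simp_all add: minus_add del: add_uminus_conv_diff)
  have "is_subgroup W"
    unfolding is_subgroup_def
  proof (intro conjI ballI)
    show "0 \<in> W" by (force simp: W_def intro!: image_eqI[of _ _ "[]"])
    show "x + y \<in> W" if "x \<in> W" "y \<in> W" for x y
    proof -
      from that obtain xs ys where "xs \<in> lists S" "ys \<in> lists S" "x = sum_list xs" "y = sum_list ys"
        by (auto simp: W_def)
      then show ?thesis by (auto simp: W_def intro!: image_eqI[of _ _ "xs @ ys"])
    qed
    show "- x \<in> W" if "x \<in> W" for x
    proof -
      from that obtain xs where xs: "xs \<in> lists S" "x = sum_list xs" by (auto simp: W_def)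
      have "rev (map uminus xs) \<in> lists S" using xs(1) symmetric_S by auto
      then show ?thesis unfolding W_def xs(2) neg by (rule imageI)
    qed
  qed
  moreover have "S \<subseteq> W" by (force simp: W_def image_iff intro: bexI[of _ "[_]"])
  ultimately have "is_subgroup hull S \<subseteq> W" by (intro hull_minimal) auto
  moreover have "countable W" unfolding W_def using finite_S by (simp add: countable_finite)
  ultimately show ?thesis using generates_S countable_subset by (auto simp: generates_def)
qed

text \<open>
Infinite clusters are replaced by the empty set.  This does not affect the normalized indicator,
and the resulting random set takes values in a countable collection, so that every function of
it is measurable.
\<close>

definition fin_K :: "('g \<Rightarrow> bool) \<Rightarrow> 'g \<Rightarrow> 'g set" where
  "fin_K \<omega> x = (if finite (K \<omega> x) then K \<omega> x else {})"

lemma finite_fin_K [simp]: "finite (fin_K \<omega> x)" by (simp add: fin_K_def)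

end

section \<open>The overlap of a finite set with its translates\<close>

lemma sum_add_indicator_eq_card:
  "finite K \<Longrightarrow> (\<Sum>t\<in>K. if t + s \<in> K then c else 0) = c * of_nat (card {t \<in> K. t + s \<in> K})"
  for c :: "'a::comm_semiring_1"
  by (subst sum.inter_filter[symmetric]) (simp_all add: mult.commute)

text \<open>
The value at \<open>s\<close> of \<open>\<Phi>\<close> applied to the normalized indicator of \<open>A\<close>.  It vanishes for infinite \<open>A\<close>, since
then \<open>card A = 0\<close>.
\<close>

definition overlap :: "real \<Rightarrow> 'g::group_add set \<Rightarrow> 'g \<Rightarrow> real" where
  "overlap q A s = real (card A) powr (- 2 / q) * real (card {t \<in> A. t + s \<in> A})"

lemma Phi_normalized_indicator: "Phi (normalized_indicator q A) s = complex_of_real (overlap q A s)"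
proof (cases "finite A")
  case True
  let ?w = "complex_of_real (real (card A) powr - (2 / q))"
  have sq: "complex_of_real (real (card A) powr - (1 / q)) * complex_of_real (real (card A) powr - (1 / q)) = ?w"
    by (simp flip: of_real_mult powr_add add: field_simps)
  have "Phi (normalized_indicator q A) s = (\<Sum>\<^sub>\<infinity>t\<in>A. if t + s \<in> A then ?w else 0)"
    unfolding Phi_def
    by (rule infsum_cong_neutral) (auto simp: normalized_indicator_def sq indicator_def)
  also have "\<dots> = (\<Sum>t\<in>A. if t + s \<in> A then ?w else 0)" using True by simp
  also have "\<dots> = complex_of_real (overlap q A s)"
    using True by (subst sum_add_indicator_eq_card) (simp_all add: overlap_def)
  finally show ?thesis .
next
  case False
  then have "normalized_indicator q A = (\<lambda>_. 0)" by (auto simp: normalized_indicator_def)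
  with False show ?thesis by (simp add: Phi_def overlap_def)
qed

lemma overlap_zero: "overlap q A 0 = real (card A) powr (- 2 / q) * real (card A)"
  by (simp add: overlap_def)

lemma overlap_nonneg: "0 \<le> overlap q A s" by (simp add: overlap_def)

lemma overlap_le_1:
  assumes "0 < q" "q \<le> 2"
  shows "overlap q A s \<le> 1"
proof (cases "finite A \<and> A \<noteq> {}")
  case True
  then have c: "real (card A) \<ge> 1" by (simp add: Suc_leI card_gt_0_iff)
  have "card {t \<in> A. t + s \<in> A} \<le> card A" using True by (intro card_mono) auto
  then have "overlap q A s \<le> real (card A) powr (- 2 / q) * real (card A)"
    unfolding overlap_def by (intro mult_left_mono) auto
  also have "\<dots> = real (card A) powr (1 - 2 / q)"
    using c by (simp add: powr_diff powr_minus_divide)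
  also have "\<dots> \<le> real (card A) powr 0"
    using c assms by (intro powr_mono) (auto simp: field_simps)
  finally show ?thesis using c by simp
next
  case False
  then show ?thesis by (auto simp: overlap_def)
qed

section \<open>Measurability of clusters\<close>

locale cayley_percolation = cayley_graph S + prob_space P
  for S :: "'g::group_add set" and P :: "('g \<Rightarrow> bool) measure" +
  assumes sets_P: "sets P = sets (Pi\<^sub>M UNIV (\<lambda>_. count_space (UNIV :: bool set)))"
begin

lemma space_P: "space P = UNIV"
  using sets_eq_imp_space_eq[OF sets_P] by (simp add: space_PiM)

lemma measurable_site [measurable]: "Measurable.pred P (\<lambda>\<omega>. \<omega> x)"
  unfolding measurable_cong_sets[OF sets_P refl] by simp

lemma pred_ex: "(\<And>z :: 'g. Measurable.pred P (\<lambda>\<omega>. Q z \<omega>)) \<Longrightarrow> Measurable.pred P (\<lambda>\<omega>. \<exists>z. Q z \<omega>)"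
  using sets.sets_Collect_countable_Ex'[OF _ countable_group, of P Q] by (simp add: pred_def)

lemma pred_all: "(\<And>z :: 'g. Measurable.pred P (\<lambda>\<omega>. Q z \<omega>)) \<Longrightarrow> Measurable.pred P (\<lambda>\<omega>. \<forall>z. Q z \<omega>)"
  using sets.sets_Collect_countable_All'[OF _ countable_group, of P Q] by (simp add: pred_def)

lemma measurable_mem_K [measurable]: "Measurable.pred P (\<lambda>\<omega>. y \<in> K \<omega> x)"
proof -
  have "Measurable.pred P (\<lambda>\<omega>. (x, y) \<in> open_edges \<omega> ^^ n)" for n
  proof (induction n arbitrary: y)
    case (Suc n)
    have "Measurable.pred P (\<lambda>\<omega>. \<exists>z. (x, z) \<in> open_edges \<omega> ^^ n \<and> (z, y) \<in> cayley_edges S \<and> \<omega> z \<and> \<omega> y)"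
      using Suc[measurable] by (intro pred_ex) measurable
    then show ?case by (simp add: relcomp_unfold open_edges_def)
  qed simp
  then show ?thesis unfolding mem_K_iff rtrancl_power by measurable
qed

lemma measurable_K_eq: "Measurable.pred P (\<lambda>\<omega>. K \<omega> x = A)"
  unfolding set_eq_iff by (intro pred_all) measurable

text \<open>
A nonempty finite value is described by countably many membership events; the value \<open>{}\<close> is the
complement of all others.
\<close>

lemma measurable_fin_K: "(\<lambda>\<omega>. fin_K \<omega> x) \<in> measurable P (count_space {A. finite A})"
proof -
  have c: "countable {A :: 'g set. finite A}"
    using countable_Collect_finite_subset[OF countable_group] by simp
  have eq: "(\<lambda>\<omega>. fin_K \<omega> x) -` {A} \<inter> space P = {\<omega> \<in> space P. K \<omega> x = A}" if "finite A" "A \<noteq> {}" for A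
  proof -
    have "fin_K \<omega> x = A \<longleftrightarrow> K \<omega> x = A" for \<omega> using that by (metis fin_K_def)
    then show ?thesis by auto
  qed
  have ne: "(\<lambda>\<omega>. fin_K \<omega> x) -` {A} \<inter> space P \<in> sets P" if "finite A" "A \<noteq> {}" for A
    unfolding eq[OF that] using measurable_K_eq[of x A] by (simp add: pred_def)
  have empty: "(\<lambda>\<omega>. fin_K \<omega> x) -` {{}} \<inter> space P =
    space P - (\<Union>A\<in>{A. finite A} - {{}}. (\<lambda>\<omega>. fin_K \<omega> x) -` {A} \<inter> space P)"
    by (rule set_eqI) (simp add: space_P)
  have "(\<lambda>\<omega>. fin_K \<omega> x) -` {A} \<inter> space P \<in> sets P" if "finite A" for A
  proof (cases "A = {}")
    case True
    have "countable ({A :: 'g set. finite A} - {{}})" using c by simp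
    then show ?thesis unfolding True empty
      using ne by (intro sets.Diff sets.top sets.countable_UN') auto
  qed (rule ne[OF that])
  then show ?thesis unfolding measurable_count_space_eq_countable[OF c] by simp
qed

lemma integrable_fin_K:
  fixes h :: "'g set \<Rightarrow> 'b::{banach, second_countable_topology}"
  assumes "\<And>A. finite A \<Longrightarrow> norm (h A) \<le> B"
  shows "integrable P (\<lambda>\<omega>. h (fin_K \<omega> x))"
proof (rule integrable_const_bound[where B = B])
  show "(\<lambda>\<omega>. h (fin_K \<omega> x)) \<in> borel_measurable P"
    by (rule measurable_compose[OF measurable_fin_K]) simp
qed (simp add: assms)

lemma overlap_fin_K: "overlap q (K \<omega> x) s = overlap q (fin_K \<omega> x) s"
  by (simp add: fin_K_def overlap_def)

lemma integrable_overlap: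
  "0 < q \<Longrightarrow> q \<le> 2 \<Longrightarrow> integrable P (\<lambda>\<omega>. overlap q (K \<omega> x) s)"
  unfolding overlap_fin_K by (intro integrable_fin_K[where B = 1]) (simp add: overlap_nonneg overlap_le_1)

lemma cluster_function_eq:
  "cluster_function S q P s = complex_of_real (expectation (\<lambda>\<omega>. overlap q (K \<omega> 0) s))"
  by (simp add: cluster_function_def Phi_normalized_indicator)

end

section \<open>Percolations with bounded clusters from Foelner sets\<close>

abbreviation config_space :: "('v \<Rightarrow> bool) measure" where
  "config_space \<equiv> Pi\<^sub>M UNIV (\<lambda>_. count_space UNIV)"

lemma space_config_space [simp]: "space config_space = UNIV"
  by (simp add: space_PiM)

lemma measurable_config_spaceI:
  assumes "\<And>x. Measurable.pred M (\<lambda>\<omega>. f \<omega> x)"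
  shows "f \<in> measurable M config_space"
  using measurable_PiM_single'[of UNIV "\<lambda>x \<omega>. f \<omega> x" M "\<lambda>_. count_space UNIV"] assms
  by (auto simp: pred_def)

definition bernoulli_percolation :: "real \<Rightarrow> ('v \<Rightarrow> bool) measure" where
  "bernoulli_percolation p = Pi\<^sub>M UNIV (\<lambda>_. measure_pmf (bernoulli_pmf p))"

lemma sets_bernoulli_percolation [measurable_cong]: "sets (bernoulli_percolation p) = sets config_space"
  unfolding bernoulli_percolation_def by (intro sets_PiM_cong) simp_all

lemma space_bernoulli_percolation [simp]: "space (bernoulli_percolation p) = UNIV"
  using sets_eq_imp_space_eq[OF sets_bernoulli_percolation] by simp

lemma prob_space_bernoulli_percolation: "prob_space (bernoulli_percolation p)"
  unfolding bernoulli_percolation_def by (intro prob_space_PiM) (rule measure_pmf.prob_space_axioms)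

lemma bernoulli_percolation_const:
  assumes "finite J" "0 \<le> p" "p \<le> 1"
  shows "measure (bernoulli_percolation p) {\<zeta>. \<forall>x\<in>J. \<zeta> x = b} = (if b then p else 1 - p) ^ card J"
proof -
  interpret product_prob_space "\<lambda>_ :: 'v. measure_pmf (bernoulli_pmf p)" UNIV
    by unfold_locales
  have "emeasure (bernoulli_percolation p) {\<zeta>. \<forall>x\<in>J. \<zeta> x = b} =
      (\<Prod>x\<in>J. emeasure (measure_pmf (bernoulli_pmf p)) {b})"
    using emeasure_PiM_Collect[OF _ assms(1), of "\<lambda>_. {b}"]
    by (simp add: bernoulli_percolation_def space_PiM)
  also have "\<dots> = ennreal ((if b then p else 1 - p) ^ card J)"
    using assms by (simp add: emeasure_pmf_single ennreal_power)
  finally show ?thesis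
    using assms by (simp add: measure_def zero_le_power)
qed

lemma bernoulli_percolation_shift:
  fixes a :: "'g::group_add"
  shows "distr (bernoulli_percolation p) (bernoulli_percolation p) (\<lambda>\<zeta> x. \<zeta> (- a + x)) = bernoulli_percolation p"
  using distr_PiM_reindex[of UNIV "\<lambda>_. measure_pmf (bernoulli_pmf p)" "\<lambda>x. - a + x" "UNIV :: 'g set"]
  by (simp add: bernoulli_percolation_def measure_pmf.prob_space_axioms restrict_def[abs_def] cong: distr_cong)

context cayley_graph
begin

text \<open>
Let \<open>\<zeta>\<close> be independent Bernoulli variables: the set of the \<open>y\<close> whose translate \<open>y + F\<close> is selected.
A vertex is open if it lies in a selected translate and on the inner boundary of none.  A path of open
vertices cannot leave a selected translate that it meets, so clusters are confined to translates of
\<open>F\<close>.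
\<close>

lemma foelner_percolation:
  assumes "amenable TYPE('g)" "\<epsilon> > 0"
  obtains Q D where "cayley_percolation S Q" "invariant_percolation Q"
    "finite D" "\<And>d. d \<in> D \<Longrightarrow> - d \<in> D"
    "AE \<omega> in Q. \<forall>x. K \<omega> x \<subseteq> (+) x ` D" "measure Q {\<omega>. \<not> \<omega> 0} \<le> \<epsilon>"
proof -
  \<comment> \<open>Up to the cap in \<open>p\<close>, the expected number of selected translates that contain a given vertex; such a vertex is uncovered with probability at most \<open>exp (- c) \<le> 1 / c = \<epsilon> / 2\<close>.\<close>
  define c where "c = 2 / \<epsilon>"
  have c: "c > 0" using assms by (simp add: c_def)
  obtain F where F: "finite F" "F \<noteq> {}"
    and small: "real (card {x\<in>F. \<exists>s\<in>S. x + s \<notin> F}) \<le> \<epsilon> / (2 * c) * real (card F)"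
    by (rule amenable_foelner[OF assms(1) finite_S, of "\<epsilon> / (2 * c)"]) (use assms(2) c in auto)
  define bd where "bd = {x\<in>F. \<exists>s\<in>S. x + s \<notin> F}"
  have bd: "finite bd" using F(1) by (simp add: bd_def)
  have card_F: "real (card F) > 0" using F by (simp add: card_gt_0_iff)
  \<comment> \<open>The minimum with \<open>1\<close> matters only for \<open>card F < c\<close>, in particular possibly for finite groups.\<close>
  define p where "p = min 1 (c / card F)"
  have p: "0 \<le> p" "p \<le> 1" using c by (auto simp: p_def)
  define \<theta> :: "('g \<Rightarrow> bool) \<Rightarrow> 'g \<Rightarrow> bool" where
    "\<theta> \<zeta> x \<longleftrightarrow> (\<exists>f\<in>F. \<zeta> (x - f)) \<and> (\<forall>f\<in>bd. \<not> \<zeta> (x - f))" for \<zeta> x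
  define M :: "('g \<Rightarrow> bool) measure" where "M = bernoulli_percolation p"
  define Q where "Q = distr M config_space \<theta>"
  \<comment> \<open>If \<open>x\<close> lies in a translate of \<open>F\<close>, then this translate is contained in \<open>x + D\<close>.\<close>
  define D where "D = (\<lambda>(f, g). - f + g) ` (F \<times> F)"
  have sets_M [measurable_cong]: "sets M = sets config_space" by (simp add: M_def sets_bernoulli_percolation)
  have [simp]: "space M = UNIV" by (simp add: M_def)
  interpret M: prob_space M unfolding M_def by (rule prob_space_bernoulli_percolation)
  have \<theta> [measurable]: "\<theta> \<in> measurable M config_space"
    unfolding \<theta>_def by (intro measurable_config_spaceI pred_intros_logic pred_intros_finite F bd) measurable
  have \<theta>': "\<theta> \<in> measurable config_space config_space"
    using \<theta> measurable_cong_sets[OF sets_M refl] by blast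
  interpret Q: cayley_percolation S Q
    unfolding cayley_percolation_def cayley_percolation_axioms_def
    by (simp add: cayley_graph_axioms Q_def M.prob_space_distr \<theta>)
  have inv: "invariant_percolation Q"
    unfolding invariant_percolation_def
  proof
    fix a :: 'g
    let ?sh = "\<lambda>(\<omega> :: 'g \<Rightarrow> bool) x. \<omega> (- a + x)"
    have sh: "?sh \<in> measurable config_space config_space"
      by (intro measurable_config_spaceI) measurable
    have sh_M: "?sh \<in> measurable M M"
      using sh measurable_cong_sets[OF sets_M sets_M] by blast
    have "\<theta> (?sh \<zeta>) = ?sh (\<theta> \<zeta>)" for \<zeta>
      by (simp add: \<theta>_def fun_eq_iff add_diff_eq)
    then have comm: "?sh \<circ> \<theta> = \<theta> \<circ> ?sh" by (simp add: fun_eq_iff)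
    have "distr Q Q ?sh = distr Q config_space ?sh"
      by (rule distr_cong) (simp_all add: Q_def)
    also have "\<dots> = distr M config_space (\<theta> \<circ> ?sh)"
      unfolding Q_def by (subst distr_distr[OF sh \<theta>]) (simp only: comm)
    also have "\<dots> = distr (distr M M ?sh) config_space \<theta>"
      by (subst distr_distr[OF \<theta> sh_M]) simp
    also have "distr M M ?sh = M" unfolding M_def by (rule bernoulli_percolation_shift)
    finally show "distr Q Q ?sh = Q" by (simp add: Q_def)
  qed
  have fin: "K (\<theta> \<zeta>) x \<subseteq> (+) x ` D" for \<zeta> x
  proof (cases "\<theta> \<zeta> x")
    case True
    then obtain f where f: "f \<in> F" "\<zeta> (x - f)" by (auto simp: \<theta>_def)
    have stay: "- (x - f) + y \<in> F" if "(x, y) \<in> (open_edges (\<theta> \<zeta>))\<^sup>*" for y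
      using that
    proof (induction rule: rtrancl_induct)
      case base
      have "- (x - f) + x = f" by (simp add: minus_add diff_conv_add_uminus add.assoc del: add_uminus_conv_diff)
      then show ?case using f by simp
    next
      case (step y z)
      define u where "u = - (x - f) + y"
      have y: "y - u = x - f" unfolding u_def diff_eq_eq by (simp only: add_minus_cancel)
      have "\<theta> \<zeta> y" "- y + z \<in> S" using step(2) by (auto simp: open_edges_def cayley_edges_def)
      then have "u \<notin> bd" using f(2) y by (auto simp: \<theta>_def)
      then have "u + (- y + z) \<in> F" using step(3) \<open>- y + z \<in> S\<close> by (auto simp: bd_def u_def)
      then show ?case by (simp add: u_def add.assoc[symmetric])
    qed
    show ?thesis
    proof
      fix y assume "y \<in> K (\<theta> \<zeta>) x"
      then have "- (x - f) + y \<in> F" by (intro stay) (simp add: mem_K_iff)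
      then have "- f + (- (x - f) + y) \<in> D" using f(1) by (force simp: D_def)
      moreover have "y = x + (- f + (- (x - f) + y))"
      proof -
        have "y = (x - f) + (- (x - f) + y)" by (simp only: add_minus_cancel)
        also have "\<dots> = x + (- f + (- (x - f) + y))" by (metis add.assoc add_uminus_conv_diff)
        finally show ?thesis .
      qed
      ultimately show "y \<in> (+) x ` D" by blast
    qed
  qed (simp add: mem_K_iff subset_iff)
  have AE: "AE \<omega> in Q. \<forall>x. K \<omega> x \<subseteq> (+) x ` D"
  proof -
    have "Measurable.pred Q (\<lambda>\<omega>. \<forall>x. \<forall>y. y \<in> K \<omega> x \<longrightarrow> y \<in> (+) x ` D)"
      by (intro Q.pred_all) measurable
    then have "{\<omega> \<in> space config_space. \<forall>x. K \<omega> x \<subseteq> (+) x ` D} \<in> sets config_space"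
      by (simp add: pred_def Q.space_P Q.sets_P subset_iff)
    from AE_distr_iff[OF \<theta> this] show ?thesis unfolding Q_def using fin by simp
  qed
  have cyl: "{\<zeta>. \<forall>x\<in>J. \<zeta> x = b} \<in> sets M" if "finite J" for J b
  proof -
    have site: "Measurable.pred M (\<lambda>\<zeta>. \<zeta> x)" for x
      unfolding measurable_cong_sets[OF sets_M refl] by simp
    have "Measurable.pred M (\<lambda>\<zeta>. \<forall>x\<in>J. \<zeta> x = b)"
      using that by (cases b) (simp_all add: pred_intros_finite pred_intros_logic site)
    then show ?thesis by (simp add: pred_def)
  qed
  have "Measurable.pred Q (\<lambda>\<omega>. \<not> \<omega> 0)" by measurable
  then have "{\<omega> :: 'g \<Rightarrow> bool. \<not> \<omega> 0} \<in> sets config_space" by (simp add: pred_def Q.space_P Q.sets_P)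
  then have "measure Q {\<omega>. \<not> \<omega> 0} = measure M {\<zeta>. \<not> \<theta> \<zeta> 0}"
    unfolding Q_def by (subst measure_distr[OF \<theta>]) (auto simp: vimage_def)
  also have "\<dots> \<le> measure M ({\<zeta>. \<forall>x\<in>uminus ` F. \<zeta> x = False} \<union> (\<Union>f\<in>bd. {\<zeta>. \<forall>x\<in>{- f}. \<zeta> x = True}))"
    using F(1) bd by (intro M.finite_measure_mono sets.Un sets.finite_UN cyl) (auto simp: \<theta>_def)
  also have "\<dots> \<le> measure M {\<zeta>. \<forall>x\<in>uminus ` F. \<zeta> x = False} + measure M (\<Union>f\<in>bd. {\<zeta>. \<forall>x\<in>{- f}. \<zeta> x = True})"
    using F(1) bd by (intro measure_Un_le sets.finite_UN cyl) auto
  also have "\<dots> \<le> measure M {\<zeta>. \<forall>x\<in>uminus ` F. \<zeta> x = False} + (\<Sum>f\<in>bd. measure M {\<zeta>. \<forall>x\<in>{- f}. \<zeta> x = True})"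
    using bd by (intro add_left_mono measure_UNION_le cyl) auto
  also have "\<dots> = (1 - p) ^ card F + p * card bd"
  proof -
    have "measure M {\<zeta>. \<forall>x\<in>uminus ` F. \<zeta> x = False} = (1 - p) ^ card F"
      unfolding M_def using F(1) p by (subst bernoulli_percolation_const) (auto simp: card_image)
    moreover have "measure M {\<zeta>. \<forall>x\<in>{- f}. \<zeta> x = True} = p" for f
      unfolding M_def using p by (subst bernoulli_percolation_const) auto
    ultimately show ?thesis by (simp add: mult.commute)
  qed
  also have "\<dots> \<le> \<epsilon> / 2 + \<epsilon> / 2"
  proof (intro add_mono)
    show "(1 - p) ^ card F \<le> \<epsilon> / 2"
    proof (cases "p = 1")
      case False
      then have pc: "p * card F = c" using card_F by (auto simp: p_def min_def split: if_splits)
      have "(1 - p) ^ card F \<le> exp (- p) ^ card F"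
        using p exp_ge_add_one_self[of "- p"] by (intro power_mono) auto
      also have "\<dots> = exp (- c)" using pc by (simp add: exp_of_nat_mult[symmetric] mult.commute)
      also have "\<dots> \<le> 1 / c"
      proof -
        have "c \<le> exp c" using exp_ge_add_one_self[of c] by linarith
        then show ?thesis using c by (simp add: exp_minus field_simps)
      qed
      finally show ?thesis by (simp add: c_def)
    qed (use card_F assms(2) in \<open>simp add: zero_power\<close>)
    have "p * card bd \<le> c / card F * (\<epsilon> / (2 * c) * real (card F))"
      using small c p by (intro mult_mono) (auto simp: p_def bd_def)
    also have "\<dots> = \<epsilon> / 2" using c card_F by simp
    finally show "p * card bd \<le> \<epsilon> / 2" .
  qed
  finally have "measure Q {\<omega>. \<not> \<omega> 0} \<le> \<epsilon>" by simp
  moreover have "- d \<in> D" if "d \<in> D" for d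
    using that by (force simp: D_def minus_add image_iff)
  moreover have "finite D" using F by (simp add: D_def)
  ultimately show thesis using Q.cayley_percolation_axioms inv AE by (intro that) auto
qed

end

context cayley_percolation
begin

section \<open>Mass transport and the percolations of an amenable group\<close>

lemma measurable_shift: "(\<lambda>\<omega> x. \<omega> (- a + x)) \<in> measurable P P"
  unfolding measurable_cong_sets[OF refl sets_P] by (intro measurable_config_spaceI) measurable

lemma expectation_shift:
  fixes f :: "('g \<Rightarrow> bool) \<Rightarrow> 'b::{banach, second_countable_topology}"
  assumes "invariant_percolation P" "f \<in> borel_measurable P"
  shows "expectation (\<lambda>\<omega>. f (\<lambda>x. \<omega> (- a + x))) = expectation f"
  using integral_distr[OF measurable_shift assms(2), of a] assms(1)
  by (simp add: invariant_percolation_def)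

text \<open>
For each \<open>t\<close>, invariance under the translation by \<open>t\<close> exchanges the roles of the identity and of the
vertex \<open>t\<close>: the event \<open>t \<in> K \<and> t + s \<in> K\<close> becomes \<open>-t \<in> K \<and> s \<in> K\<close>, with the same cluster size.
Summing the weights \<open>1/|K|\<close> over all \<open>t\<close>, the first gives the left-hand side and the second gives
\<open>|K|/|K|\<close> on the event \<open>s \<in> K\<close>.  All clusters lie in the symmetric finite set \<open>D\<close>, so the
sum over \<open>t\<close> is finite.
\<close>

lemma mass_transport:
  assumes inv: "invariant_percolation P"
    and D: "finite D" "\<And>d. d \<in> D \<Longrightarrow> - d \<in> D" and sub: "AE \<omega> in P. K \<omega> 0 \<subseteq> D"
  shows "expectation (\<lambda>\<omega>. real (card {t \<in> K \<omega> 0. t + s \<in> K \<omega> 0}) / real (card (K \<omega> 0))) =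
    prob {\<omega>. s \<in> K \<omega> 0}"
proof -
  \<comment> \<open>The mass at \<open>t\<close> before and after the translation.\<close>
  define h where "h t A = (if t \<in> A \<and> t + s \<in> A then 1 / real (card A) else 0)" for t A
  define h' where "h' t A = (if - t \<in> A \<and> s \<in> A then 1 / real (card A) else 0)" for t A
  have h_fin: "h t (K \<omega> 0) = h t (fin_K \<omega> 0)" "h' t (K \<omega> 0) = h' t (fin_K \<omega> 0)" for t \<omega>
    by (auto simp: h_def h'_def fin_K_def)
  have bnd: "1 / real (card A) \<le> 1" for A :: "'g set"
    by (cases "card A") (auto simp: field_simps)
  have int_h: "integrable P (\<lambda>\<omega>. h t (K \<omega> 0))" "integrable P (\<lambda>\<omega>. h' t (K \<omega> 0))" for t
    unfolding h_fin using bnd by (auto intro!: integrable_fin_K[where B = 1] simp: h_def h'_def)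
  have transport: "h t (K (\<lambda>x. \<omega> (- t + x)) 0) = h' t (K \<omega> 0)" for t \<omega>
  proof -
    have K': "K (\<lambda>x. \<omega> (- t + x)) 0 = (+) t ` K \<omega> (- t)"
    proof (rule set_eqI)
      fix y
      have "y \<in> (+) t ` K \<omega> (- t) \<longleftrightarrow> - t + y \<in> K \<omega> (- t)"
        by (auto simp: image_iff add.assoc[symmetric] intro!: bexI[of _ "- t + y"])
      then show "y \<in> K (\<lambda>x. \<omega> (- t + x)) 0 \<longleftrightarrow> y \<in> (+) t ` K \<omega> (- t)"
        unfolding mem_K_shift by simp
    qed
    have mem: "t + y \<in> K (\<lambda>x. \<omega> (- t + x)) 0 \<longleftrightarrow> y \<in> K \<omega> (- t)" for y
      unfolding mem_K_shift by simp
    have "t \<in> K (\<lambda>x. \<omega> (- t + x)) 0 \<longleftrightarrow> - t \<in> K \<omega> 0"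
      using mem[of 0] K_sym by simp
    moreover have "t + s \<in> K (\<lambda>x. \<omega> (- t + x)) 0 \<longleftrightarrow> s \<in> K \<omega> 0" if "- t \<in> K \<omega> 0"
      using mem[of s] K_eq[OF that] by simp
    moreover have "card (K (\<lambda>x. \<omega> (- t + x)) 0) = card (K \<omega> 0)" if "- t \<in> K \<omega> 0"
      unfolding K' using K_eq[OF that] by (simp add: card_image)
    ultimately show ?thesis by (auto simp: h_def h'_def)
  qed
  have "expectation (\<lambda>\<omega>. real (card {t \<in> K \<omega> 0. t + s \<in> K \<omega> 0}) / real (card (K \<omega> 0))) =
      expectation (\<lambda>\<omega>. \<Sum>t\<in>D. h t (K \<omega> 0))"
  proof (rule integral_cong_AE)
    have "(\<lambda>\<omega>. (\<lambda>A. real (card {t \<in> A. t + s \<in> A}) / real (card A)) (fin_K \<omega> 0)) \<in> borel_measurable P"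
      by (rule measurable_compose[OF measurable_fin_K]) simp
    moreover have "real (card {t \<in> K \<omega> 0. t + s \<in> K \<omega> 0}) / real (card (K \<omega> 0)) =
      (\<lambda>A. real (card {t \<in> A. t + s \<in> A}) / real (card A)) (fin_K \<omega> 0)" for \<omega>
      by (simp add: fin_K_def)
    ultimately show "(\<lambda>\<omega>. real (card {t \<in> K \<omega> 0. t + s \<in> K \<omega> 0}) / real (card (K \<omega> 0))) \<in> borel_measurable P"
      by simp
    show "(\<lambda>\<omega>. \<Sum>t\<in>D. h t (K \<omega> 0)) \<in> borel_measurable P" using int_h(1) by auto
    show "AE \<omega> in P. real (card {t \<in> K \<omega> 0. t + s \<in> K \<omega> 0}) / real (card (K \<omega> 0)) = (\<Sum>t\<in>D. h t (K \<omega> 0))"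
      using sub
    proof eventually_elim
      case (elim \<omega>)
      have "{t \<in> K \<omega> 0. t + s \<in> K \<omega> 0} = {t \<in> D. t \<in> K \<omega> 0 \<and> t + s \<in> K \<omega> 0}" using elim by auto
      then show ?case using D(1) by (simp add: h_def sum.inter_filter[symmetric])
    qed
  qed
  also have "\<dots> = (\<Sum>t\<in>D. expectation (\<lambda>\<omega>. h t (K \<omega> 0)))" using int_h(1) by simp
  also have "\<dots> = (\<Sum>t\<in>D. expectation (\<lambda>\<omega>. h' t (K \<omega> 0)))"
  proof (rule sum.cong[OF refl])
    fix t
    show "expectation (\<lambda>\<omega>. h t (K \<omega> 0)) = expectation (\<lambda>\<omega>. h' t (K \<omega> 0))"
      using expectation_shift[OF inv borel_measurable_integrable[OF int_h(1)[of t]], of t]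
      by (simp add: transport)
  qed
  also have "\<dots> = expectation (\<lambda>\<omega>. \<Sum>t\<in>D. h' t (K \<omega> 0))" using int_h(2) by simp
  also have "\<dots> = expectation (indicator {\<omega>. s \<in> K \<omega> 0})"
  proof (rule integral_cong_AE)
    show "(\<lambda>\<omega>. \<Sum>t\<in>D. h' t (K \<omega> 0)) \<in> borel_measurable P" using int_h(2) by auto
    show "indicator {\<omega>. s \<in> K \<omega> 0} \<in> borel_measurable P" by measurable
    show "AE \<omega> in P. (\<Sum>t\<in>D. h' t (K \<omega> 0)) = indicator {\<omega>. s \<in> K \<omega> 0} \<omega>"
      using sub
    proof eventually_elim
      case (elim \<omega>)
      have fin: "finite (K \<omega> 0)" using elim D(1) by (rule finite_subset)
      have "{t \<in> D. - t \<in> K \<omega> 0} = uminus ` K \<omega> 0" using elim D(2) by (force simp: image_iff)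
      then have card: "card {t \<in> D. - t \<in> K \<omega> 0} = card (K \<omega> 0)" by (simp add: card_image)
      show ?case
      proof (cases "s \<in> K \<omega> 0")
        case True
        then have "card (K \<omega> 0) > 0" using fin by (auto simp: card_gt_0_iff)
        moreover have "(\<Sum>t\<in>D. h' t (K \<omega> 0)) = real (card {t \<in> D. - t \<in> K \<omega> 0}) / card (K \<omega> 0)"
          using D(1) True by (simp add: h'_def sum.inter_filter[symmetric])
        ultimately show ?thesis using True card by simp
      qed (simp add: h'_def)
    qed
  qed
  also have "\<dots> = prob {\<omega>. s \<in> K \<omega> 0}" by (simp add: space_P)
  finally show ?thesis .
qed

lemma prob_connected:
  assumes inv: "invariant_percolation P" and V: "finite V" "\<And>\<omega>. (\<forall>v\<in>V. \<omega> v) \<Longrightarrow> s \<in> K \<omega> 0"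
  shows "1 - real (card V) * prob {\<omega>. \<not> \<omega> 0} \<le> prob {\<omega>. s \<in> K \<omega> 0}"
proof -
  have sites: "{\<omega>. \<not> \<omega> v} \<in> events" for v
  proof -
    have "Measurable.pred P (\<lambda>\<omega>. \<not> \<omega> v)" by measurable
    then show ?thesis by (simp add: pred_def space_P)
  qed
  have conn: "{\<omega>. s \<in> K \<omega> 0} \<in> events"
    using measurable_mem_K[of s 0] by (simp add: pred_def space_P)
  have stat: "prob {\<omega>. \<not> \<omega> v} = prob {\<omega>. \<not> \<omega> 0}" for v
  proof -
    have "prob {\<omega>. \<not> \<omega> 0} = measure (distr P P (\<lambda>\<omega> x. \<omega> (- (- v) + x))) {\<omega>. \<not> \<omega> 0}"
      using inv unfolding invariant_percolation_def by metis
    also have "\<dots> = prob {\<omega>. \<not> \<omega> v}"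
      by (subst measure_distr[OF measurable_shift sites]) (simp add: vimage_def space_P)
    finally show ?thesis by simp
  qed
  have "1 - prob {\<omega>. s \<in> K \<omega> 0} = prob (UNIV - {\<omega>. s \<in> K \<omega> 0})"
    using prob_compl[OF conn] by (simp add: space_P)
  also have "\<dots> \<le> prob (\<Union>v\<in>V. {\<omega>. \<not> \<omega> v})"
    using V sites by (intro finite_measure_mono sets.finite_UN) auto
  also have "\<dots> \<le> (\<Sum>v\<in>V. prob {\<omega>. \<not> \<omega> v})"
    using V(1) sites by (intro measure_UNION_le) auto
  also have "\<dots> = (\<Sum>v\<in>V. prob {\<omega>. \<not> \<omega> 0})" by (intro sum.cong refl stat)
  finally show ?thesis by simp
qed

text \<open>
As the cluster has at most \<open>card D\<close> elements and \<open>1 - 2/q \<le> 0\<close>, replacing \<open>|K| powr (-2/q)\<close> by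
\<open>1/|K|\<close> costs at most a power of the cluster bound; the rest is mass transport.  The summand \<open>1\<close>
keeps the base positive when \<open>D\<close> is empty.
\<close>

lemma expectation_overlap_ge:
  assumes inv: "invariant_percolation P"
    and D: "finite D" "\<And>d. d \<in> D \<Longrightarrow> - d \<in> D" and sub: "AE \<omega> in P. K \<omega> 0 \<subseteq> D"
    and V: "finite V" "\<And>\<omega>. (\<forall>v\<in>V. \<omega> v) \<Longrightarrow> s \<in> K \<omega> 0"
    and q: "0 < q" "q \<le> 2"
  shows "(real (card D) + 1) powr (1 - 2 / q) * (1 - real (card V) * prob {\<omega>. \<not> \<omega> 0})
    \<le> expectation (\<lambda>\<omega>. overlap q (K \<omega> 0) s)"
proof -
  let ?b = "(real (card D) + 1) powr (1 - 2 / q)"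
  let ?r = "\<lambda>\<omega>. real (card {t \<in> K \<omega> 0. t + s \<in> K \<omega> 0}) / real (card (K \<omega> 0))"
  have "?b * (1 - real (card V) * prob {\<omega>. \<not> \<omega> 0}) \<le> ?b * expectation ?r"
    using prob_connected[OF inv V] by (simp add: mass_transport[OF inv D sub] mult_left_mono)
  also have "\<dots> = expectation (\<lambda>\<omega>. ?b * ?r \<omega>)" by (rule integral_mult_right_zero[symmetric])
  also have "\<dots> \<le> expectation (\<lambda>\<omega>. overlap q (K \<omega> 0) s)"
  proof (rule integral_mono_AE')
    show "integrable P (\<lambda>\<omega>. overlap q (K \<omega> 0) s)" using q by (rule integrable_overlap)
    show "AE \<omega> in P. 0 \<le> overlap q (K \<omega> 0) s" by (simp add: overlap_nonneg)
    show "AE \<omega> in P. ?b * ?r \<omega> \<le> overlap q (K \<omega> 0) s"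
      using sub
    proof eventually_elim
      case (elim \<omega>)
      have fin: "finite (K \<omega> 0)" using elim D(1) by (rule finite_subset)
      show ?case
      proof (cases "K \<omega> 0 = {}")
        case False
        define k where "k = real (card (K \<omega> 0))"
        have k: "k \<ge> 1" using False fin by (simp add: k_def Suc_leI card_gt_0_iff)
        have "card (K \<omega> 0) \<le> card D" using elim D(1) by (rule card_mono[rotated])
        then have "k \<le> real (card D) + 1" by (simp add: k_def)
        moreover have "1 - 2 / q \<le> 0" using q by (simp add: field_simps)
        ultimately have "?b \<le> k powr (1 - 2 / q)" using k by (intro powr_mono2') auto
        also have "\<dots> = k * k powr (- 2 / q)" using k by (simp add: powr_diff powr_minus_divide)
        finally have "?b / k \<le> k powr (- 2 / q)" using k by (simp add: field_simps)
        then show ?thesis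
          by (simp add: overlap_def k_def[symmetric] mult_right_mono[of "?b / k" _ "real (card _)", simplified])
      qed (simp add: overlap_def)
    qed
  qed
  finally show ?thesis .
qed

end

text \<open>
A diagonal argument: if each condition \<open>Q k\<close> holds eventually, then \<open>k\<close> can be moved to infinity so
slowly that the current condition holds all the time.
\<close>

lemma slow_index:
  fixes Q :: "nat \<Rightarrow> nat \<Rightarrow> bool"
  assumes "\<And>n. Q 0 n" and ev: "\<And>k. eventually (Q k) sequentially"
  obtains \<kappa> where "filterlim \<kappa> at_top sequentially" "\<And>n. Q (\<kappa> n) n"
proof -
  define \<kappa> where "\<kappa> n = Max {k. k \<le> n \<and> Q k n}" for n
  have fin: "finite {k. k \<le> n \<and> Q k n}" for n by simp
  have "\<kappa> n \<in> {k. k \<le> n \<and> Q k n}" for n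
    unfolding \<kappa>_def using assms(1) by (intro Max_in fin) auto
  moreover have "eventually (\<lambda>n. k \<le> \<kappa> n) sequentially" for k
    using ev[of k] eventually_ge_at_top[of k]
    by eventually_elim (auto simp: \<kappa>_def intro!: Max_ge)
  then have "filterlim \<kappa> at_top sequentially" by (simp add: filterlim_at_top)
  ultimately show thesis by (intro that[of \<kappa>]) auto
qed

text \<open>
The \<open>k\<close>-th Foelner percolation closes the identity with probability at most \<open>1/(k + 1)\<close> but
has large clusters.  It is used for those \<open>n\<close> for which the loss \<open>b k n\<close> in the exponent is
still within \<open>1/(k + 1)\<close> of \<open>1\<close>.
\<close>

lemma (in cayley_graph) approximating_percolations_if_amenable:
  assumes amen: "amenable TYPE('g)" and p: "\<And>n. p n \<in> {1..<2}" "p \<longlonglongrightarrow> 2"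
  shows "\<exists>P. approximating_percolations S p P"
proof -
  define good where "good \<epsilon> Q D \<longleftrightarrow> cayley_percolation S Q \<and> invariant_percolation Q \<and>
    finite D \<and> (\<forall>d\<in>D. - d \<in> D) \<and> (AE \<omega> in Q. \<forall>x. K \<omega> x \<subseteq> (+) x ` D) \<and> measure Q {\<omega>. \<not> \<omega> 0} \<le> \<epsilon>"
    for \<epsilon> :: real and Q :: "('g \<Rightarrow> bool) measure" and D :: "'g set"
  have "\<exists>Q D. good (1 / Suc k) Q D" for k
    by (rule foelner_percolation[OF amen, of "1 / Suc k"]) (auto simp: good_def)
  then obtain Q D where good: "\<And>k. good (1 / Suc k) (Q k) (D k)" by metis
  define b where "b k n = (real (card (D k)) + 1) powr (1 - 2 / p n)" for k n
  have "(\<lambda>n. b k n) \<longlonglongrightarrow> (real (card (D k)) + 1) powr (1 - 2 / 2)" for k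
    unfolding b_def using p by (intro tendsto_intros) auto
  then have b_lim: "(\<lambda>n. b k n) \<longlonglongrightarrow> 1" for k by simp
  obtain \<kappa> where \<kappa>: "filterlim \<kappa> at_top sequentially" "\<And>n. b (\<kappa> n) n \<ge> 1 - 1 / Suc (\<kappa> n)"
  proof (rule slow_index[of "\<lambda>k n. b k n \<ge> 1 - 1 / Suc k"])
    show "\<forall>\<^sub>F n in sequentially. 1 - 1 / Suc k \<le> b k n" for k
      by (rule eventually_mono[OF order_tendstoD(1)[OF b_lim]]) (auto intro: less_imp_le)
  qed (auto simp: b_def)
  define P where "P n = Q (\<kappa> n)" for n
  have P: "cayley_percolation S (P n)" "invariant_percolation (P n)" for n
    using good by (auto simp: good_def P_def)
  have nic: "no_infinite_components (cayley_edges S) (P n)" for n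
  proof -
    have AE: "AE \<omega> in P n. \<forall>x. K \<omega> x \<subseteq> (+) x ` D (\<kappa> n)" and fin: "finite (D (\<kappa> n))"
      using good[of "\<kappa> n"] unfolding good_def P_def by blast+
    show ?thesis unfolding no_infinite_components_def
      using AE
    proof eventually_elim
      case (elim \<omega>)
      show ?case
      proof
        fix x
        have "K \<omega> x \<subseteq> (+) x ` D (\<kappa> n)" using elim by (rule spec)
        then show "finite (K \<omega> x)" using fin by (rule finite_subset[OF _ finite_imageI])
      qed
    qed
  qed
  have conv: "(\<lambda>n. cluster_function S (p n) (P n) s) \<longlonglongrightarrow> 1" for s
  proof -
    obtain V where V: "finite V" "\<And>\<omega>. (\<forall>v\<in>V. \<omega> v) \<Longrightarrow> s \<in> K \<omega> 0"
      using connecting_set[of s] by blast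
    define e where "e n = prob_space.expectation (P n) (\<lambda>\<omega>. overlap (p n) (K \<omega> 0) s)" for n
    have upper: "e n \<le> 1" and cf: "cluster_function S (p n) (P n) s = complex_of_real (e n)"
      and lower: "b (\<kappa> n) n * (1 - real (card V) * (1 / Suc (\<kappa> n))) \<le> e n" for n
    proof -
      interpret P: cayley_percolation S "P n" by (rule P)
      have q: "0 < p n" "p n \<le> 2" using p(1)[of n] by auto
      show "cluster_function S (p n) (P n) s = complex_of_real (e n)"
        by (simp add: P.cluster_function_eq e_def)
      show "e n \<le> 1" unfolding e_def
        by (rule P.integral_le_const[OF P.integrable_overlap[OF q]]) (simp add: overlap_le_1[OF q])
      have "measure (P n) {\<omega>. \<not> \<omega> 0} \<le> 1 / Suc (\<kappa> n)"
        using good[of "\<kappa> n"] unfolding good_def P_def by blast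
      then have "b (\<kappa> n) n * (1 - real (card V) * (1 / Suc (\<kappa> n))) \<le>
          b (\<kappa> n) n * (1 - real (card V) * measure (P n) {\<omega>. \<not> \<omega> 0})"
        by (intro mult_left_mono diff_left_mono) (auto simp: b_def)
      also have "\<dots> \<le> e n"
        unfolding b_def e_def
      proof (rule P.expectation_overlap_ge[OF P(2) _ _ _ V q])
        show "finite (D (\<kappa> n))" "\<And>d. d \<in> D (\<kappa> n) \<Longrightarrow> - d \<in> D (\<kappa> n)"
          using good[of "\<kappa> n"] unfolding good_def by blast+
        have "AE \<omega> in P n. \<forall>x. K \<omega> x \<subseteq> (+) x ` D (\<kappa> n)"
          using good[of "\<kappa> n"] unfolding good_def P_def by blast
        then show "AE \<omega> in P n. K \<omega> 0 \<subseteq> D (\<kappa> n)"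
          by eventually_elim (auto dest!: spec[of _ 0])
      qed
      finally show "b (\<kappa> n) n * (1 - real (card V) * (1 / Suc (\<kappa> n))) \<le> e n" .
    qed
    have inv_lim: "(\<lambda>n. 1 / real (Suc (\<kappa> n))) \<longlonglongrightarrow> 0"
      using filterlim_compose[OF LIMSEQ_inverse_real_of_nat \<kappa>(1)] by (simp add: inverse_eq_divide)
    have "(\<lambda>n. (1 - 1 / Suc (\<kappa> n)) * (1 - real (card V) * (1 / Suc (\<kappa> n)))) \<longlonglongrightarrow> (1 - 0) * (1 - real (card V) * 0)"
      by (intro tendsto_intros inv_lim)
    then have "(\<lambda>n. (1 - 1 / Suc (\<kappa> n)) * (1 - real (card V) * (1 / Suc (\<kappa> n)))) \<longlonglongrightarrow> 1" by simp
    moreover have "\<forall>\<^sub>F n in sequentially. (1 - 1 / Suc (\<kappa> n)) * (1 - real (card V) * (1 / Suc (\<kappa> n))) \<le> e n"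
    proof -
      have "\<forall>\<^sub>F n in sequentially. 1 - real (card V) * (1 / Suc (\<kappa> n)) > 0"
        by (rule order_tendstoD(1)[of _ 1]) (use tendsto_diff[OF tendsto_const tendsto_mult_left[OF inv_lim], of 1 "real (card V)"] in auto)
      then show ?thesis
      proof eventually_elim
        case (elim n)
        then have "(1 - 1 / Suc (\<kappa> n)) * (1 - real (card V) * (1 / Suc (\<kappa> n))) \<le>
            b (\<kappa> n) n * (1 - real (card V) * (1 / Suc (\<kappa> n)))"
          using \<kappa>(2)[of n] by (intro mult_right_mono) auto
        with lower[of n] show ?case by linarith
      qed
    qed
    ultimately have "e \<longlonglongrightarrow> 1"
      using upper by (intro tendsto_sandwich[of _ e sequentially "\<lambda>_. 1"]) auto
    then have "(\<lambda>n. complex_of_real (e n)) \<longlonglongrightarrow> complex_of_real 1" by (rule tendsto_of_real)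
    then show ?thesis by (simp add: cf)
  qed
  have "site_percolation (P n)" for n
    using P(1)[of n]
    by (simp add: site_percolation_def cayley_percolation_def cayley_percolation_axioms_def)
  then show ?thesis using P(2) nic conv unfolding approximating_percolations_def by blast
qed

section \<open>An invariant mean from approximating percolations\<close>

text \<open>
The minus sign converts the approximate invariance of clusters under right translations into
approximate invariance of the functional under left translations.
\<close>

definition cluster_average :: "real \<Rightarrow> 'g::group_add set \<Rightarrow> ('g \<Rightarrow> complex) \<Rightarrow> complex" where
  "cluster_average q A g = complex_of_real (real (card A) powr (- 2 / q)) * (\<Sum>t\<in>A. g (- t))"

lemma norm_cluster_average:
  assumes "\<And>x. norm (g x) \<le> B" "0 < q" "q \<le> 2"
  shows "norm (cluster_average q A g) \<le> B"
proof -
  have B: "0 \<le> B" using assms(1)[of undefined] norm_ge_zero order_trans by blast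
  have "norm (cluster_average q A g) \<le> real (card A) powr (- 2 / q) * (real (card A) * B)"
    unfolding cluster_average_def norm_mult
    by (intro mult_mono) (auto intro: sum_norm_bound assms(1))
  also have "\<dots> = overlap q A 0 * B" by (simp add: overlap_zero)
  also have "\<dots> \<le> 1 * B" using B assms by (intro mult_right_mono overlap_le_1) auto
  finally show ?thesis by simp
qed

text \<open>
Translating by \<open>a\<close> replaces the sum over \<open>A\<close> by the sum over \<open>A + a\<close>.  The terms in the intersection
cancel, and \<open>|A| - |{t \<in> A. t + a \<in> A}|\<close> terms remain on either side.
\<close>

lemma cluster_average_translate:
  assumes A: "finite A" and B: "\<And>x. norm (g x) \<le> B"
  shows "norm (cluster_average q A (\<lambda>x. g (- a + x)) - cluster_average q A g)
    \<le> 2 * B * (overlap q A 0 - overlap q A a)"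
proof -
  define A1 where "A1 = {t \<in> A. t + a \<in> A}"
  define A2 where "A2 = (\<lambda>t. t + a) ` A1"
  have sub: "A1 \<subseteq> A" "A2 \<subseteq> A" by (auto simp: A1_def A2_def)
  have inj: "inj_on (\<lambda>t. t + a) A1" by (auto intro: inj_onI)
  have card2: "card A2 = card A1" unfolding A2_def by (rule card_image[OF inj])
  have "(\<Sum>t\<in>A. g (- a + - t)) = (\<Sum>t\<in>A. g (- (t + a)))" by (simp add: minus_add)
  also have "\<dots> = (\<Sum>t\<in>A - A1. g (- (t + a))) + (\<Sum>t\<in>A1. g (- (t + a)))"
    by (rule sum.subset_diff[OF sub(1) A])
  also have "(\<Sum>t\<in>A1. g (- (t + a))) = (\<Sum>t\<in>A2. g (- t))"
    unfolding A2_def by (simp only: sum.reindex[OF inj] o_def)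
  finally have "(\<Sum>t\<in>A. g (- a + - t)) - (\<Sum>t\<in>A. g (- t)) =
      (\<Sum>t\<in>A - A1. g (- (t + a))) - (\<Sum>t\<in>A - A2. g (- t))"
    using sum.subset_diff[OF sub(2) A, of "\<lambda>t. g (- t)"] by simp
  also have "norm \<dots> \<le> norm (\<Sum>t\<in>A - A1. g (- (t + a))) + norm (\<Sum>t\<in>A - A2. g (- t))"
    by (rule norm_triangle_ineq4)
  also have "\<dots> \<le> real (card (A - A1)) * B + real (card (A - A2)) * B"
    by (intro add_mono sum_norm_bound B)
  also have "\<dots> = 2 * B * (real (card A) - real (card A1))"
    using A sub finite_subset[OF sub(1) A] finite_subset[OF sub(2) A] card_mono[OF A sub(1)]
    by (simp add: card_Diff_subset card2 of_nat_diff algebra_simps)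
  finally have "norm ((\<Sum>t\<in>A. g (- a + - t)) - (\<Sum>t\<in>A. g (- t))) \<le> 2 * B * (real (card A) - real (card A1))" .
  from mult_left_mono[OF this, of "real (card A) powr (- 2 / q)"] show ?thesis
    by (simp add: cluster_average_def right_diff_distrib[symmetric] norm_mult overlap_def A1_def[symmetric])
       (simp add: algebra_simps)
qed

text \<open>
The product of the discs of radius \<open>B g\<close> is compact, so the sequence has a cluster point there.  It is returned with a
filter \<open>G\<close> that converges to it and refines the sequence: every limit along the sequence
persists along \<open>G\<close>, which plays the part of an ultrafilter.
\<close>

lemma pointwise_cluster_point:
  fixes m :: "nat \<Rightarrow> 'a \<Rightarrow> complex"
  assumes bnd: "\<And>n g. norm (m n g) \<le> B g"
  obtains m\<^sub>0 G where "G \<noteq> bot" "\<And>g. ((\<lambda>f. f g) \<longlongrightarrow> m\<^sub>0 g) G"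
    "\<And>(T :: ('a \<Rightarrow> complex) \<Rightarrow> complex) c. (\<lambda>n. T (m n)) \<longlonglongrightarrow> c \<Longrightarrow> (T \<longlongrightarrow> c) G"
proof -
  define X where "X = Pi\<^sub>E UNIV (\<lambda>g. cball (0 :: complex) (B g))"
  have "compact X"
    unfolding X_def compactin_euclidean_iff[symmetric] euclidean_product_topology[symmetric]
      compactin_PiE by (simp add: compactin_euclidean_iff)
  moreover have "eventually (\<lambda>f. f \<in> X) (filtermap m sequentially)"
    using bnd by (simp add: eventually_filtermap X_def PiE_iff)
  moreover have "filtermap m sequentially \<noteq> bot" by (simp add: filtermap_bot_iff)
  ultimately obtain m\<^sub>0 where m0: "inf (nhds m\<^sub>0) (filtermap m sequentially) \<noteq> bot"
    unfolding compact_filter by blast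
  let ?G = "inf (nhds m\<^sub>0) (filtermap m sequentially)"
  show thesis
  proof (rule that[OF m0])
    fix g
    have "open ((\<lambda>f :: 'a \<Rightarrow> complex. f g) -` U)" if "open U" for U
      using that by (rule open_vimage) (rule continuous_on_product_coordinates)
    then have "((\<lambda>f. f g) \<longlongrightarrow> m\<^sub>0 g) (nhds m\<^sub>0)"
      by (force simp: tendsto_def eventually_nhds)
    then show "((\<lambda>f. f g) \<longlongrightarrow> m\<^sub>0 g) ?G" by (rule filterlim_mono) auto
  next
    fix T :: "('a \<Rightarrow> complex) \<Rightarrow> complex" and c
    assume "(\<lambda>n. T (m n)) \<longlonglongrightarrow> c"
    then have "(T \<longlongrightarrow> c) (filtermap m sequentially)" by (simp add: filterlim_filtermap)
    then show "(T \<longlongrightarrow> c) ?G" by (rule filterlim_mono) auto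
  qed
qed

lemma (in cayley_graph) amenable_if_approximating_percolations:
  assumes p: "\<And>n. p n \<in> {1..<2}" and approx: "approximating_percolations S p P"
  shows "amenable TYPE('g)"
proof -
  have q: "0 < p n" "p n \<le> 2" for n using p[of n] by auto
  have perc: "cayley_percolation S (P n)" for n
    using approx cayley_graph_axioms
    by (auto simp: approximating_percolations_def site_percolation_def cayley_percolation_def
        cayley_percolation_axioms_def)
  define E where "E n g = prob_space.expectation (P n) (\<lambda>\<omega>. cluster_average (p n) (fin_K \<omega> 0) g)" for n and g :: "'g \<Rightarrow> complex"
  define m where "m n g = (if bounded (range g) then E n g else 0)" for n and g :: "'g \<Rightarrow> complex"
  have int: "integrable (P n) (\<lambda>\<omega>. cluster_average (p n) (fin_K \<omega> 0) g)"
    and E_bnd: "norm (E n g) \<le> B" if B: "\<And>x. norm (g x) \<le> B" for n g B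
  proof -
    interpret cayley_percolation S "P n" by (rule perc)
    show int: "integrable (P n) (\<lambda>\<omega>. cluster_average (p n) (fin_K \<omega> 0) g)"
      using norm_cluster_average[of g B, OF B q] by (intro integrable_fin_K)
    have "norm (E n g) \<le> expectation (\<lambda>\<omega>. norm (cluster_average (p n) (fin_K \<omega> 0) g))"
      unfolding E_def by (rule integral_norm_bound)
    also have "\<dots> \<le> B"
      using int norm_cluster_average[of g B, OF B q] by (intro integral_le_const) auto
    finally show "norm (E n g) \<le> B" .
  qed
  have bddD: "\<exists>B. \<forall>x. norm (g x) \<le> B" if "bounded (range g)" for g :: "'g \<Rightarrow> complex"
    using that by (auto simp: bounded_iff)
  have int': "integrable (P n) (\<lambda>\<omega>. cluster_average (p n) (fin_K \<omega> 0) g)" if "bounded (range g)" for n g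
    using bddD[OF that] int by blast
  have "\<exists>B. \<forall>n. norm (m n g) \<le> B" for g
  proof (cases "bounded (range g)")
    case True
    then obtain B where "\<And>x. norm (g x) \<le> B" using bddD by blast
    then show ?thesis using E_bnd by (intro exI[of _ B]) (auto simp: m_def True)
  qed (auto simp: m_def)
  then obtain B where bnd: "\<And>n g. norm (m n g) \<le> B g" by metis
  obtain m0 G where G: "G \<noteq> bot" and eval: "\<And>g. ((\<lambda>f. f g) \<longlongrightarrow> m0 g) G"
    and lim: "\<And>(T :: (('g \<Rightarrow> complex) \<Rightarrow> complex) \<Rightarrow> complex) c. (\<lambda>n. T (m n)) \<longlonglongrightarrow> c \<Longrightarrow> (T \<longlongrightarrow> c) G"
    by (rule pointwise_cluster_point[of m B, OF bnd]) blast+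
  \<comment> \<open>A continuous expression in the functional takes at \<open>m0\<close> the value that is its limit along the sequence.\<close>
  have pass: "T m0 = c" if "(T \<longlongrightarrow> T m0) G" "(\<lambda>n. T (m n)) \<longlonglongrightarrow> c"
    for T :: "(('g \<Rightarrow> complex) \<Rightarrow> complex) \<Rightarrow> complex" and c
    using tendsto_unique[OF G that(1) lim[OF that(2)]] .
  have "invariant_mean m0"
    unfolding invariant_mean_def
  proof (intro conjI allI impI)
    fix f g :: "'g \<Rightarrow> complex"
    assume bdd: "bounded (range f)" "bounded (range g)"
    then have bdd': "bounded (range (\<lambda>x. f x + g x))" by (rule bounded_plus_comp)
    have "m n (\<lambda>x. f x + g x) = m n f + m n g" for n
    proof -
      have "cluster_average (p n) A (\<lambda>x. f x + g x) = cluster_average (p n) A f + cluster_average (p n) A g" for A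
        by (simp add: cluster_average_def sum.distrib distrib_left)
      then show ?thesis
        using int'[OF bdd(1), of n] int'[OF bdd(2), of n] bdd bdd' by (simp add: m_def E_def)
    qed
    then have "m0 (\<lambda>x. f x + g x) - (m0 f + m0 g) = 0"
      by (intro pass[of "\<lambda>u. u (\<lambda>x. f x + g x) - (u f + u g)"] tendsto_intros eval) simp
    then show "m0 (\<lambda>x. f x + g x) = m0 f + m0 g" by simp
  next
    fix c and f :: "'g \<Rightarrow> complex"
    assume bdd: "bounded (range f)"
    obtain b where "\<And>x. norm (f x) \<le> b" using bddD[OF bdd] by blast
    then have bdd': "bounded (range (\<lambda>x. c * f x))"
      by (intro boundedI[of _ "norm c * b"]) (auto simp: norm_mult intro!: mult_left_mono)
    have "m n (\<lambda>x. c * f x) = c * m n f" for n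
    proof -
      have "cluster_average (p n) A (\<lambda>x. c * f x) = c * cluster_average (p n) A f" for A
        by (simp add: cluster_average_def sum_distrib_left mult_ac)
      then show ?thesis using bdd bdd' by (simp add: m_def E_def)
    qed
    then have "m0 (\<lambda>x. c * f x) - c * m0 f = 0"
      by (intro pass[of "\<lambda>u. u (\<lambda>x. c * f x) - c * u f"] tendsto_intros eval) simp
    then show "m0 (\<lambda>x. c * f x) = c * m0 f" by simp
  next
    fix f :: "'g \<Rightarrow> complex"
    assume bdd: "bounded (range f)" and nonneg: "range f \<subseteq> \<real>\<^sub>\<ge>\<^sub>0"
    have "m n f \<in> \<real>\<^sub>\<ge>\<^sub>0" for n
    proof -
      define r where "r A = real (card A) powr (- 2 / p n) * (\<Sum>t\<in>A. Re (f (- t)))" for A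
      have f: "f x = complex_of_real (Re (f x))" "Re (f x) \<ge> 0" for x
        using nonneg by (auto simp: complex_nonneg_Reals_iff complex_eq_iff image_subset_iff)
      have "cluster_average (p n) A f = complex_of_real (r A)" for A
        unfolding cluster_average_def r_def by (subst f(1)) simp
      then have "m n f = complex_of_real (\<integral>\<omega>. r (fin_K \<omega> 0) \<partial>P n)" using bdd by (simp add: m_def E_def)
      moreover have "(\<integral>\<omega>. r (fin_K \<omega> 0) \<partial>P n) \<ge> 0"
        by (intro integral_nonneg_AE) (simp add: r_def f(2) sum_nonneg)
      ultimately show ?thesis by simp
    qed
    then have "m n f = complex_of_real (norm (m n f))" for n
      by (metis (no_types, lifting) abs_of_nonneg nonneg_Reals_cases norm_of_real)
    \<comment> \<open>Positivity is expressed as a closed equation, so that it passes to the limit.\<close>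
    then have "m n f - complex_of_real (norm (m n f)) = 0" for n
      by (rule eq_iff_diff_eq_0[THEN iffD1])
    then have "m0 f - complex_of_real (norm (m0 f)) = 0"
      by (intro pass[of "\<lambda>u. u f - complex_of_real (norm (u f))"] tendsto_intros eval)
        (simp only: tendsto_const)
    then have "m0 f = complex_of_real (norm (m0 f))" by simp
    then show "m0 f \<in> \<real>\<^sub>\<ge>\<^sub>0" by (metis nonneg_Reals_of_real_iff norm_ge_zero)
  next
    have bdd: "bounded (range (\<lambda>x :: 'g. 1 :: complex))" by (rule finite_imp_bounded) simp
    have "m n (\<lambda>_. 1) = cluster_function S (p n) (P n) 0" for n
    proof -
      interpret cayley_percolation S "P n" by (rule perc)
      have "cluster_average (p n) A (\<lambda>_. 1) = complex_of_real (overlap (p n) A 0)" for A :: "'g set"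
        by (simp add: cluster_average_def overlap_zero)
      then show ?thesis unfolding cluster_function_eq overlap_fin_K using bdd by (simp add: m_def E_def)
    qed
    then have "(\<lambda>n. m n (\<lambda>_. 1)) \<longlonglongrightarrow> 1" using approx by (simp add: approximating_percolations_def)
    then show "m0 (\<lambda>_. 1) = 1" by (intro pass[of "\<lambda>u. u (\<lambda>_. 1)"] eval)
  next
    fix a and f :: "'g \<Rightarrow> complex"
    assume bdd: "bounded (range f)"
    have bdd': "bounded (range (\<lambda>x. f (- a + x)))"
      by (rule bounded_subset[OF bdd]) auto
    obtain B where B: "\<And>x. norm (f x) \<le> B" using bddD[OF bdd] by blast
    have diff: "norm (m n (\<lambda>x. f (- a + x)) - m n f)
      \<le> 2 * B * norm (cluster_function S (p n) (P n) 0 - cluster_function S (p n) (P n) a)" for n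
    proof -
      interpret cayley_percolation S "P n" by (rule perc)
      have "m n (\<lambda>x. f (- a + x)) - m n f = expectation (\<lambda>\<omega>. cluster_average (p n) (fin_K \<omega> 0) (\<lambda>x. f (- a + x))
          - cluster_average (p n) (fin_K \<omega> 0) f)"
        using int'[OF bdd] int'[OF bdd'] bdd bdd' by (simp add: m_def E_def)
      also have "norm \<dots> \<le> expectation (\<lambda>\<omega>. norm (cluster_average (p n) (fin_K \<omega> 0) (\<lambda>x. f (- a + x))
          - cluster_average (p n) (fin_K \<omega> 0) f))"
        by (rule integral_norm_bound)
      also have "\<dots> \<le> expectation (\<lambda>\<omega>. 2 * B * (overlap (p n) (K \<omega> 0) 0 - overlap (p n) (K \<omega> 0) a))"
        using int'[OF bdd] int'[OF bdd'] cluster_average_translate[OF finite_fin_K B]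
        by (intro integral_mono integrable_norm Bochner_Integration.integrable_diff
              integrable_mult_right integrable_overlap q) (auto simp: overlap_fin_K)
      also have "\<dots> = 2 * B * (expectation (\<lambda>\<omega>. overlap (p n) (K \<omega> 0) 0) - expectation (\<lambda>\<omega>. overlap (p n) (K \<omega> 0) a))"
        using integrable_overlap[OF q[of n]] by simp
      also have "\<dots> \<le> 2 * B * norm (cluster_function S (p n) (P n) 0 - cluster_function S (p n) (P n) a)"
        unfolding cluster_function_eq of_real_diff[symmetric] norm_of_real
        using order_trans[OF norm_ge_zero B] by (intro mult_left_mono) auto
      finally show ?thesis .
    qed
    have lim_cf: "(\<lambda>n. cluster_function S (p n) (P n) s) \<longlonglongrightarrow> 1" for s
      using approx by (simp add: approximating_percolations_def)
    have "(\<lambda>n. 2 * B * norm (cluster_function S (p n) (P n) 0 - cluster_function S (p n) (P n) a))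
        \<longlonglongrightarrow> 2 * B * norm (1 - 1 :: complex)"
      by (intro tendsto_intros lim_cf)
    then have "(\<lambda>n. 2 * B * norm (cluster_function S (p n) (P n) 0 - cluster_function S (p n) (P n) a))
        \<longlonglongrightarrow> 0"
      by simp
    then have "(\<lambda>n. m n (\<lambda>x. f (- a + x)) - m n f) \<longlonglongrightarrow> 0"
      by (rule Lim_null_comparison[rotated]) (rule always_eventually, rule allI, rule diff)
    then have "m0 (\<lambda>x. f (- a + x)) - m0 f = 0"
      by (intro pass[of "\<lambda>u. u (\<lambda>x. f (- a + x)) - u f"] tendsto_intros eval)
    then show "m0 (\<lambda>x. f (- a + x)) = m0 f" by simp
  qed
  then show ?thesis by (auto simp: amenable_def)
qed

section \<open>Operators and their matrices\<close>

lemma ell2_fun_summable: "(\<lambda>x. (cmod (ell2_fun f x))\<^sup>2) summable_on UNIV"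
  using ell2_fun[of f] by simp

lemma L2_set_le_norm: "L2_set (\<lambda>x. cmod (ell2_fun f x)) F \<le> norm f"
proof (cases "finite F")
  case True
  then show ?thesis
    unfolding L2_set_def norm_ell2_def
    by (intro real_sqrt_le_mono finite_sum_le_infsum ell2_fun_summable) auto
qed simp

lemma norm_ell2_le:
  assumes "0 \<le> B" "\<And>F. finite F \<Longrightarrow> L2_set (\<lambda>x. cmod (ell2_fun f x)) F \<le> B"
  shows "norm f \<le> B"
proof -
  have "(\<Sum>\<^sub>\<infinity>x. (cmod (ell2_fun f x))\<^sup>2) \<le> B\<^sup>2"
    using assms by (intro infsum_le_finite_sums ell2_fun_summable) (auto simp: L2_set_def sqrt_le_D)
  then show ?thesis
    using assms(1) unfolding norm_ell2_def by (simp add: real_le_lsqrt)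
qed

lemma cinner_delta_left: "cinner (delta x) f = ell2_fun f x"
proof -
  have "cinner (delta x) f = (\<Sum>\<^sub>\<infinity>y\<in>{x}. ell2_fun f y)"
    unfolding cinner.rep_eq by (rule infsum_cong_neutral) (auto simp: delta.rep_eq)
  then show ?thesis by simp
qed

lemma cinner_delta_right: "cinner f (delta x) = cnj (ell2_fun f x)"
proof -
  have "cinner f (delta x) = (\<Sum>\<^sub>\<infinity>y\<in>{x}. cnj (ell2_fun f y))"
    unfolding cinner.rep_eq by (rule infsum_cong_neutral) (auto simp: delta.rep_eq)
  then show ?thesis by simp
qed

lemma op_entry_eq: "op_entry T x y = ell2_fun (blinfun_apply T (delta y)) x"
  by (simp add: op_entry_def cinner_delta_left)

lemma ell2_fun_sum: "ell2_fun (\<Sum>i\<in>I. f i) x = (\<Sum>i\<in>I. ell2_fun (f i) x)"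
  by (induction I rule: infinite_finite_induct) (simp_all add: zero_ell2.rep_eq plus_ell2.rep_eq)

text \<open>
Finite combinations of basis vectors are dense; estimates for operators are reduced to them, that is, to
finite sums of matrix entries.
\<close>

definition finite_vector :: "'a set \<Rightarrow> ('a \<Rightarrow> complex) \<Rightarrow> 'a ell2" where
  "finite_vector F c = (\<Sum>x\<in>F. scaleC (c x) (delta x))"

lemma ell2_fun_finite_vector:
  "finite F \<Longrightarrow> ell2_fun (finite_vector F c) x = (if x \<in> F then c x else 0)"
  by (simp add: finite_vector_def ell2_fun_sum scaleC.rep_eq delta.rep_eq if_distrib cong: if_cong)

lemma norm_finite_vector:
  assumes F: "finite F"
  shows "norm (finite_vector F c) = L2_set (\<lambda>x. cmod (c x)) F"
proof -
  have "(\<Sum>\<^sub>\<infinity>x. (cmod (ell2_fun (finite_vector F c) x))\<^sup>2) = (\<Sum>\<^sub>\<infinity>x\<in>F. (cmod (c x))\<^sup>2)"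
    by (rule infsum_cong_neutral) (auto simp: ell2_fun_finite_vector[OF F])
  then show ?thesis using F by (simp add: norm_ell2_def L2_set_def)
qed

lemma finite_vector_approximation:
  assumes "\<epsilon> > 0"
  obtains F where "finite F" "norm (f - finite_vector F (ell2_fun f)) \<le> \<epsilon>"
proof -
  obtain F where F: "finite F" "dist (\<Sum>x\<in>F. (cmod (ell2_fun f x))\<^sup>2) (\<Sum>\<^sub>\<infinity>x. (cmod (ell2_fun f x))\<^sup>2) \<le> \<epsilon>\<^sup>2"
    using infsum_finite_approximation[OF ell2_fun_summable[of f], of "\<epsilon>\<^sup>2"] assms by auto
  have "L2_set (\<lambda>x. cmod (ell2_fun (f - finite_vector F (ell2_fun f)) x)) G \<le> \<epsilon>" if G: "finite G" for G
  proof -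
    have "(\<Sum>x\<in>G. (cmod (ell2_fun (f - finite_vector F (ell2_fun f)) x))\<^sup>2) =
        (\<Sum>x\<in>G - F. (cmod (ell2_fun f x))\<^sup>2)"
      using G F(1) by (intro sum.mono_neutral_cong_right)
        (auto simp: minus_ell2.rep_eq ell2_fun_finite_vector)
    also have "\<dots> = (\<Sum>x\<in>G \<union> F. (cmod (ell2_fun f x))\<^sup>2) - (\<Sum>x\<in>F. (cmod (ell2_fun f x))\<^sup>2)"
      using sum.subset_diff[of F "G \<union> F" "\<lambda>x. (cmod (ell2_fun f x))\<^sup>2"] G F(1) by (simp add: Un_Diff)
    also have "\<dots> \<le> (\<Sum>\<^sub>\<infinity>x. (cmod (ell2_fun f x))\<^sup>2) - (\<Sum>x\<in>F. (cmod (ell2_fun f x))\<^sup>2)"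
      using G F(1) by (intro diff_right_mono finite_sum_le_infsum ell2_fun_summable) auto
    also have "\<dots> \<le> \<epsilon>\<^sup>2" using F(2) by (simp add: dist_real_def)
    finally show ?thesis using assms by (simp add: L2_set_def real_le_lsqrt)
  qed
  then have "norm (f - finite_vector F (ell2_fun f)) \<le> \<epsilon>" using assms by (intro norm_ell2_le) auto
  with F(1) show thesis by (rule that)
qed

lemma scaleC_add_right: "scaleC c (f + g) = scaleC c f + scaleC c g"
  by transfer (simp add: distrib_left)

lemma scaleC_diff_right: "scaleC c (f - g) = scaleC c f - scaleC c g"
  by transfer (simp add: right_diff_distrib)

lemma bounded_ops_scaleC: "T \<in> bounded_ops \<Longrightarrow> blinfun_apply T (scaleC c f) = scaleC c (blinfun_apply T f)"
  by (simp add: bounded_ops_def)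

lemma apply_finite_vector:
  assumes "T \<in> bounded_ops"
  shows "ell2_fun (blinfun_apply T (finite_vector F d)) x = (\<Sum>y\<in>F. op_entry T x y * d y)"
  by (simp add: finite_vector_def blinfun.sum_right bounded_ops_scaleC[OF assms] ell2_fun_sum
      scaleC.rep_eq op_entry_eq mult.commute)

text \<open>
The matrix \<open>M\<close> represents a sesquilinear form of norm at most \<open>B\<close> on finitely supported vectors.  For
\<open>B \<ge> 0\<close> these are exactly the matrices of the operators of norm at most \<open>B\<close>, so estimates of
operators and constructions of operators become statements about finite sums.
\<close>

definition form_bounded :: "('a \<Rightarrow> 'a \<Rightarrow> complex) \<Rightarrow> real \<Rightarrow> bool" where
  "form_bounded M B \<longleftrightarrow> (\<forall>F c d. finite F \<longrightarrow>
     cmod (\<Sum>x\<in>F. \<Sum>y\<in>F. cnj (c x) * M x y * d y) \<le>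
       B * (L2_set (\<lambda>x. cmod (c x)) F * L2_set (\<lambda>x. cmod (d x)) F))"

text \<open>
Test the form with the vector \<open>M d\<close> itself on the left and cancel its norm.
\<close>

lemma form_bounded_row_sums:
  assumes M: "form_bounded M B" and fin: "finite F" "finite G" and B: "0 \<le> B"
  shows "L2_set (\<lambda>x. cmod (\<Sum>y\<in>G. M x y * d y)) F \<le> B * L2_set (\<lambda>y. cmod (d y)) G"
proof -
  define u where "u x = (\<Sum>y\<in>G. M x y * d y)" for x
  define L where "L = L2_set (\<lambda>x. cmod (u x)) F"
  \<comment> \<open>The form is tested on a common index set, on which both vectors are extended by zero.\<close>
  let ?H = "F \<union> G"
  let ?c = "\<lambda>x. if x \<in> F then u x else 0"
  let ?d = "\<lambda>y. if y \<in> G then d y else 0"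
  have ext: "L2_set (\<lambda>x. cmod (if x \<in> A then h x else 0)) ?H = L2_set (\<lambda>x. cmod (h x)) A"
    if "A \<subseteq> ?H" for A and h :: "'a \<Rightarrow> complex"
    unfolding L2_set_def
    by (rule arg_cong[where f = sqrt], rule sum.mono_neutral_cong_right) (use fin that in auto)
  have "(\<Sum>x\<in>?H. \<Sum>y\<in>?H. cnj (?c x) * M x y * ?d y) = (\<Sum>x\<in>F. cnj (u x) * u x)"
  proof (rule sum.mono_neutral_cong_right)
    fix x assume "x \<in> F"
    have "(\<Sum>y\<in>?H. cnj (?c x) * M x y * ?d y) = (\<Sum>y\<in>G. cnj (u x) * (M x y * d y))"
      by (rule sum.mono_neutral_cong_right) (use fin \<open>x \<in> F\<close> in auto)
    then show "(\<Sum>y\<in>?H. cnj (?c x) * M x y * ?d y) = cnj (u x) * u x"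
      by (simp add: u_def sum_distrib_left)
  qed (use fin in auto)
  also have "\<dots> = complex_of_real (L\<^sup>2)"
  proof -
    have "cnj (u x) * u x = complex_of_real ((cmod (u x))\<^sup>2)" for x
      by (metis complex_norm_square mult.commute)
    then have "(\<Sum>x\<in>F. cnj (u x) * u x) = complex_of_real (\<Sum>x\<in>F. (cmod (u x))\<^sup>2)" by simp
    then show ?thesis by (simp add: L_def L2_set_def sum_nonneg)
  qed
  finally have form: "(\<Sum>x\<in>?H. \<Sum>y\<in>?H. cnj (?c x) * M x y * ?d y) = complex_of_real (L\<^sup>2)" .
  have "L\<^sup>2 \<le> B * (L * L2_set (\<lambda>y. cmod (d y)) G)"
    using M[unfolded form_bounded_def, rule_format, of ?H ?c ?d] fin
    unfolding form ext[OF Un_upper1] ext[OF Un_upper2] L_def[symmetric] norm_of_real by simp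
  then have "L * L \<le> (B * L2_set (\<lambda>y. cmod (d y)) G) * L" by (simp add: power2_eq_square mult_ac)
  moreover have "L \<ge> 0" "B * L2_set (\<lambda>y. cmod (d y)) G \<ge> 0" using B by (auto simp: L_def)
  ultimately have "L \<le> B * L2_set (\<lambda>y. cmod (d y)) G"
    by (cases "L = 0") (auto simp: mult_le_cancel_right)
  then show ?thesis by (simp add: L_def u_def)
qed

lemma form_bounded_op_entry:
  assumes T: "T \<in> bounded_ops"
  shows "form_bounded (op_entry T) (norm T)"
  unfolding form_bounded_def
proof (intro allI impI)
  fix F :: "'a set" and c d :: "'a \<Rightarrow> complex"
  assume F: "finite F"
  let ?g = "blinfun_apply T (finite_vector F d)"
  have "(\<Sum>x\<in>F. \<Sum>y\<in>F. cnj (c x) * op_entry T x y * d y) = (\<Sum>x\<in>F. cnj (c x) * ell2_fun ?g x)"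
    by (simp add: apply_finite_vector[OF T] sum_distrib_left mult.assoc)
  also have "cmod \<dots> \<le> (\<Sum>x\<in>F. \<bar>cmod (c x)\<bar> * \<bar>cmod (ell2_fun ?g x)\<bar>)"
    by (rule order_trans[OF norm_sum]) (simp add: norm_mult)
  also have "\<dots> \<le> L2_set (\<lambda>x. cmod (c x)) F * L2_set (\<lambda>x. cmod (ell2_fun ?g x)) F"
    by (rule L2_set_mult_ineq)
  also have "\<dots> \<le> L2_set (\<lambda>x. cmod (c x)) F * (norm T * L2_set (\<lambda>x. cmod (d x)) F)"
    using L2_set_le_norm[of ?g F] norm_blinfun[of T "finite_vector F d"]
    by (intro mult_left_mono) (auto simp: norm_finite_vector[OF F])
  finally show "cmod (\<Sum>x\<in>F. \<Sum>y\<in>F. cnj (c x) * op_entry T x y * d y) \<le>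
      norm T * (L2_set (\<lambda>x. cmod (c x)) F * L2_set (\<lambda>x. cmod (d x)) F)"
    by (simp add: mult_ac)
qed

text \<open>
The bound holds on finitely supported vectors by the row sums, and these are dense.
\<close>

lemma norm_le_form_bound:
  assumes T: "T \<in> bounded_ops" and B: "form_bounded (op_entry T) B" "0 \<le> B"
  shows "norm T \<le> B"
proof (rule norm_blinfun_bound[OF B(2)])
  fix f :: "'a ell2"
  have fin: "norm (blinfun_apply T (finite_vector F d)) \<le> B * norm (finite_vector F d)" if F: "finite F" for F d
  proof (rule norm_ell2_le)
    show "L2_set (\<lambda>x. cmod (ell2_fun (blinfun_apply T (finite_vector F d)) x)) G \<le> B * norm (finite_vector F d)"
      if "finite G" for G
      unfolding apply_finite_vector[OF T] norm_finite_vector[OF F]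
      using form_bounded_row_sums[OF B(1) that F B(2)] .
  qed (use B in auto)
  show "norm (blinfun_apply T f) \<le> B * norm f"
  proof (rule field_le_epsilon)
    fix e :: real assume "e > 0"
    define \<epsilon> where "\<epsilon> = e / (norm T + 1)"
    have \<epsilon>: "\<epsilon> > 0" using \<open>e > 0\<close> by (simp add: \<epsilon>_def add_nonneg_pos)
    obtain F where F: "finite F" "norm (f - finite_vector F (ell2_fun f)) \<le> \<epsilon>"
      by (rule finite_vector_approximation[OF \<epsilon>])
    let ?f = "finite_vector F (ell2_fun f)"
    have "norm (blinfun_apply T f) \<le> norm (blinfun_apply T ?f) + norm (blinfun_apply T (f - ?f))"
      using norm_triangle_ineq[of "blinfun_apply T ?f" "blinfun_apply T (f - ?f)"]
      by (simp add: blinfun.diff_right)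
    also have "\<dots> \<le> B * norm ?f + norm T * \<epsilon>"
      by (intro add_mono fin[OF F(1)] order_trans[OF norm_blinfun] mult_left_mono F(2)) simp
    also have "\<dots> \<le> B * norm f + e"
    proof (intro add_mono mult_left_mono B(2))
      show "norm ?f \<le> norm f" unfolding norm_finite_vector[OF F(1)] by (rule L2_set_le_norm)
      show "norm T * \<epsilon> \<le> e"
      proof -
        have "norm T * \<epsilon> \<le> (norm T + 1) * \<epsilon>" using \<epsilon> by (intro mult_right_mono) auto
        also have "norm T + 1 \<noteq> 0" using norm_ge_zero[of T] by linarith
        then have "(norm T + 1) * \<epsilon> = e" by (simp add: \<epsilon>_def)
        finally show ?thesis .
      qed
    qed
    finally show "norm (blinfun_apply T f) \<le> B * norm f + e" .
  qed
qed

lemma bounded_ops_diff: "T \<in> bounded_ops \<Longrightarrow> U \<in> bounded_ops \<Longrightarrow> T - U \<in> bounded_ops"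
  by (simp add: bounded_ops_def blinfun.diff_left scaleC_diff_right)

lemma bounded_ops_add: "T \<in> bounded_ops \<Longrightarrow> U \<in> bounded_ops \<Longrightarrow> T + U \<in> bounded_ops"
  by (simp add: bounded_ops_def blinfun.add_left scaleC_add_right)

lemma bounded_ops_scale: "T \<in> bounded_ops \<Longrightarrow> scale_op c o\<^sub>L T \<in> bounded_ops"
  by (simp add: bounded_ops_def scale_op.rep_eq) (transfer, simp add: mult.left_commute)

lemma op_entry_diff: "op_entry (T - U) x y = op_entry T x y - op_entry U x y"
  by (simp add: op_entry_eq blinfun.diff_left minus_ell2.rep_eq)

lemma op_entry_add: "op_entry (T + U) x y = op_entry T x y + op_entry U x y"
  by (simp add: op_entry_eq blinfun.add_left plus_ell2.rep_eq)

lemma op_entry_scale: "op_entry (scale_op c o\<^sub>L T) x y = c * op_entry T x y"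
  by (simp add: op_entry_eq scale_op.rep_eq scaleC.rep_eq)

lemma bounded_ops_eqI:
  assumes "T \<in> bounded_ops" "U \<in> bounded_ops" "\<And>x y. op_entry T x y = op_entry U x y"
  shows "T = U"
proof -
  have "form_bounded (op_entry (T - U)) 0" by (simp add: form_bounded_def op_entry_diff assms(3))
  then have "norm (T - U) \<le> 0" using assms by (intro norm_le_form_bound bounded_ops_diff) auto
  then show ?thesis by simp
qed

text \<open>
Each row of \<open>M\<close> is square-summable (test the form against the conjugate of the row), so the operator can
be defined by the matrix product.  The row sum estimate survives the limit over finite sets of columns.
\<close>

lemma form_bounded_imp_operator:
  fixes M :: "'a \<Rightarrow> 'a \<Rightarrow> complex"
  assumes M: "form_bounded M B" and B: "0 \<le> B"
  obtains U where "U \<in> bounded_ops" "\<And>x y. op_entry U x y = M x y"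
proof -
  have row: "(\<lambda>y. (cmod (M x y))\<^sup>2) summable_on UNIV" for x
  proof (rule nonneg_bdd_above_summable_on)
    have "(\<Sum>y\<in>F. (cmod (M x y))\<^sup>2) \<le> B\<^sup>2" if F: "finite F" for F
    proof -
      define L where "L = L2_set (\<lambda>y. cmod (M x y)) F"
      have L: "0 \<le> L" and L2: "L\<^sup>2 = (\<Sum>y\<in>F. (cmod (M x y))\<^sup>2)"
        by (simp_all add: L_def L2_set_def sum_nonneg)
      have "(\<Sum>y\<in>F. M x y * cnj (M x y)) = complex_of_real (L\<^sup>2)"
        unfolding L2 of_real_sum by (intro sum.cong refl) (metis complex_norm_square)
      then have "L * L \<le> B * L"
        using form_bounded_row_sums[OF M _ F B, of "{x}" "\<lambda>y. cnj (M x y)"]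
        by (simp add: L2_set_def[of _ "{x}"] L_def[symmetric] norm_power power2_eq_square norm_mult)
      then have "L \<le> B" using L B by (cases "L = 0") (auto simp: mult_le_cancel_right)
      then show ?thesis using L unfolding L2[symmetric] by (intro power_mono) auto
    qed
    then show "bdd_above (sum (\<lambda>y. (cmod (M x y))\<^sup>2) ` {F. F \<subseteq> UNIV \<and> finite F})"
      by (intro bdd_aboveI[of _ "B\<^sup>2"]) auto
  qed simp
  define u where "u f x = (\<Sum>\<^sub>\<infinity>y. M x y * ell2_fun f y)" for f x
  have summable: "(\<lambda>y. M x y * ell2_fun f y) summable_on UNIV" for f x
    using ell2_mult_summable[of "\<lambda>y. cnj (M x y)" "ell2_fun f"] row[of x] ell2_fun_summable[of f] by simp
  have L2_u: "L2_set (\<lambda>x. cmod (u f x)) F \<le> B * norm f" if F: "finite F" for f F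
  proof (rule tendsto_upperbound)
    have "((\<lambda>G. \<Sum>y\<in>G. M x y * ell2_fun f y) \<longlongrightarrow> u f x) (finite_subsets_at_top UNIV)" for x
      using has_sum_infsum[OF summable[of x f]] by (simp add: u_def has_sum_def)
    then show "((\<lambda>G. L2_set (\<lambda>x. cmod (\<Sum>y\<in>G. M x y * ell2_fun f y)) F) \<longlongrightarrow> L2_set (\<lambda>x. cmod (u f x)) F)
        (finite_subsets_at_top UNIV)"
      unfolding L2_set_def by (intro tendsto_intros)
    have "L2_set (\<lambda>x. cmod (\<Sum>y\<in>G. M x y * ell2_fun f y)) F \<le> B * norm f" if "finite G" for G
      using form_bounded_row_sums[OF M F that B, of "ell2_fun f"]
        mult_left_mono[OF L2_set_le_norm[of f G] B] by linarith
    then show "\<forall>\<^sub>F G in finite_subsets_at_top UNIV.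
        L2_set (\<lambda>x. cmod (\<Sum>y\<in>G. M x y * ell2_fun f y)) F \<le> B * norm f"
      by (intro eventually_finite_subsets_at_top_weakI) auto
  qed simp
  have u_summable: "(\<lambda>x. (cmod (u f x))\<^sup>2) summable_on UNIV" for f
  proof (rule nonneg_bdd_above_summable_on)
    have "(\<Sum>x\<in>F. (cmod (u f x))\<^sup>2) \<le> (B * norm f)\<^sup>2" if "finite F" for F
      using L2_u[OF that, of f] by (auto simp: L2_set_def sqrt_le_D)
    then show "bdd_above (sum (\<lambda>x. (cmod (u f x))\<^sup>2) ` {F. F \<subseteq> UNIV \<and> finite F})"
      by (intro bdd_aboveI[of _ "(B * norm f)\<^sup>2"]) auto
  qed simp
  define V where "V f = Abs_ell2 (u f)" for f
  have V: "ell2_fun (V f) = u f" for f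
    unfolding V_def using u_summable by (intro Abs_ell2_inverse) simp
  have add: "u (f + g) x = u f x + u g x" for f g x
    using infsum_add[OF summable summable] by (simp add: u_def plus_ell2.rep_eq distrib_left)
  have scale: "u (scaleC c f) x = c * u f x" for c f x
    using infsum_cmult_right[of c "\<lambda>y. M x y * ell2_fun f y" UNIV] summable
    by (simp add: u_def scaleC.rep_eq mult.left_commute)
  have VscaleC: "V (scaleC c f) = scaleC c (V f)" for c f
    by (simp add: ell2_fun_inject[symmetric] V scaleC.rep_eq scale fun_eq_iff)
  have scaleR: "r *\<^sub>R f = scaleC (complex_of_real r) f" for r and f :: "'a ell2"
    by transfer simp
  have "bounded_linear V"
  proof (rule bounded_linear_intro)
    show "V (f + g) = V f + V g" for f g
      by (simp add: ell2_fun_inject[symmetric] V plus_ell2.rep_eq add fun_eq_iff)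
    show "V (r *\<^sub>R f) = r *\<^sub>R V f" for r f by (simp add: scaleR VscaleC)
    show "norm (V f) \<le> norm f * B" for f
      using L2_u[of _ f] B by (intro norm_ell2_le) (auto simp: V mult.commute)
  qed
  then have ap: "blinfun_apply (Blinfun V) = V" by (rule bounded_linear_Blinfun_apply)
  have "u (delta y) x = M x y" for x y
  proof -
    have "u (delta y) x = (\<Sum>\<^sub>\<infinity>z\<in>{y}. M x z)"
      unfolding u_def by (rule infsum_cong_neutral) (auto simp: delta.rep_eq)
    then show ?thesis by simp
  qed
  then show thesis
    by (intro that[of "Blinfun V"]) (simp_all add: bounded_ops_def op_entry_eq ap V VscaleC)
qed

section \<open>Schur multipliers that are contractions\<close>

definition contractive_schur :: "('g::group_add \<Rightarrow> complex) \<Rightarrow> bool" where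
  "contractive_schur \<phi> \<longleftrightarrow>
     (\<forall>M B. 0 \<le> B \<longrightarrow> form_bounded M B \<longrightarrow> form_bounded (\<lambda>x y. \<phi> (x - y) * M x y) B)"

lemma ex_schur_image:
  assumes "contractive_schur \<phi>" "T \<in> bounded_ops"
  shows "\<exists>!U. is_schur_image \<phi> T U"
proof -
  have "form_bounded (\<lambda>x y. \<phi> (x - y) * op_entry T x y) (norm T)"
    using assms(1) form_bounded_op_entry[OF assms(2)] norm_ge_zero unfolding contractive_schur_def by blast
  then obtain U where "U \<in> bounded_ops" "\<And>x y. op_entry U x y = \<phi> (x - y) * op_entry T x y"
    by (rule form_bounded_imp_operator) auto
  then show ?thesis by (auto simp: is_schur_image_def intro!: ex1I[of _ U] bounded_ops_eqI)
qed

lemma schur_multiplier: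
  assumes "contractive_schur \<phi>" "T \<in> bounded_ops"
  shows "schur_multiplier \<phi> T \<in> bounded_ops"
    and "op_entry (schur_multiplier \<phi> T) x y = \<phi> (x - y) * op_entry T x y"
  using theI'[OF ex_schur_image[OF assms]] by (auto simp: schur_multiplier_def is_schur_image_def)

lemma schur_multiplier_add:
  assumes \<phi>: "contractive_schur \<phi>" and T: "T \<in> bounded_ops" "U \<in> bounded_ops"
  shows "schur_multiplier \<phi> (T + U) = schur_multiplier \<phi> T + schur_multiplier \<phi> U"
  by (rule bounded_ops_eqI)
     (simp_all add: schur_multiplier[OF \<phi>] bounded_ops_add T op_entry_add distrib_left)

lemma schur_multiplier_diff:
  assumes \<phi>: "contractive_schur \<phi>" and T: "T \<in> bounded_ops" "U \<in> bounded_ops"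
  shows "schur_multiplier \<phi> (T - U) = schur_multiplier \<phi> T - schur_multiplier \<phi> U"
  by (rule bounded_ops_eqI)
     (simp_all add: schur_multiplier[OF \<phi>] bounded_ops_diff T op_entry_diff right_diff_distrib)

lemma schur_multiplier_scale:
  assumes \<phi>: "contractive_schur \<phi>" and T: "T \<in> bounded_ops"
  shows "schur_multiplier \<phi> (scale_op c o\<^sub>L T) = scale_op c o\<^sub>L schur_multiplier \<phi> T"
  by (rule bounded_ops_eqI)
     (simp_all add: schur_multiplier[OF \<phi>] bounded_ops_scale T op_entry_scale)

lemma norm_schur_multiplier_le:
  assumes \<phi>: "contractive_schur \<phi>" and T: "T \<in> bounded_ops"
  shows "norm (schur_multiplier \<phi> T) \<le> norm T"
proof (rule norm_le_form_bound)
  have "op_entry (schur_multiplier \<phi> T) = (\<lambda>x y. \<phi> (x - y) * op_entry T x y)"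
    by (simp add: fun_eq_iff schur_multiplier[OF \<phi> T])
  then show "form_bounded (op_entry (schur_multiplier \<phi> T)) (norm T)"
    using \<phi> form_bounded_op_entry[OF T] by (simp add: contractive_schur_def)
qed (simp_all add: schur_multiplier[OF \<phi> T])

lemma closed_bounded_ops: "closed (bounded_ops :: ('a ell2 \<Rightarrow>\<^sub>L 'a ell2) set)"
proof -
  have "bounded_ops = {T :: 'a ell2 \<Rightarrow>\<^sub>L 'a ell2. \<forall>c f. blinfun_apply T (scaleC c f) =
      blinfun_apply (scale_op c) (blinfun_apply T f)}"
    by (simp add: bounded_ops_def scale_op.rep_eq)
  also have "closed \<dots>"
    by (intro closed_Collect_all closed_Collect_eq continuous_intros)
  finally show ?thesis .
qed

lemma schur_multiplier_closure:
  assumes \<phi>: "contractive_schur \<phi>" and A: "A \<subseteq> bounded_ops"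
    and inv: "\<And>T. T \<in> A \<Longrightarrow> schur_multiplier \<phi> T \<in> A" and T: "T \<in> closure A"
  shows "schur_multiplier \<phi> T \<in> closure A"
  unfolding closure_approachable
proof (intro allI impI)
  have cl: "closure A \<subseteq> bounded_ops" using A closed_bounded_ops by (rule closure_minimal)
  fix e :: real assume "e > 0"
  then obtain U where U: "U \<in> A" "dist U T < e" using T unfolding closure_approachable by blast
  have ops: "U \<in> bounded_ops" "T \<in> bounded_ops" using U(1) T A cl by auto
  have "dist (schur_multiplier \<phi> U) (schur_multiplier \<phi> T) = norm (schur_multiplier \<phi> (U - T))"
    by (simp add: dist_norm schur_multiplier_diff[OF \<phi> ops])
  also have "\<dots> \<le> norm (U - T)"
    by (intro norm_schur_multiplier_le[OF \<phi>] bounded_ops_diff ops)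
  finally have "dist (schur_multiplier \<phi> U) (schur_multiplier \<phi> T) < e" using U(2) by (simp add: dist_norm)
  with inv[OF U(1)] show "\<exists>y\<in>A. dist y (schur_multiplier \<phi> T) < e" by blast
qed

lemma schur_multiplier_bounded_maps_on:
  assumes \<phi>: "contractive_schur \<phi>" and A: "A \<subseteq> bounded_ops"
    and inv: "\<And>T. T \<in> A \<Longrightarrow> schur_multiplier \<phi> T \<in> A"
  shows "schur_multiplier \<phi> \<in> bounded_maps_on A"
  unfolding bounded_maps_on_def
  using A inv norm_schur_multiplier_le[OF \<phi>]
  by (auto simp: subset_iff schur_multiplier_add[OF \<phi>] schur_multiplier_scale[OF \<phi>] intro!: exI[of _ 1])

text \<open>
For contractions, convergence on a dense set suffices.
\<close>

lemma sot_tendsto_closure: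
  assumes \<phi>: "\<And>n. contractive_schur (\<phi> n)" and A: "A \<subseteq> bounded_ops"
    and conv: "\<And>T. T \<in> A \<Longrightarrow> (\<lambda>n. norm (schur_multiplier (\<phi> n) T - T)) \<longlonglongrightarrow> 0"
  shows "sot_tendsto (closure A) (\<lambda>n. schur_multiplier (\<phi> n)) id"
  unfolding sot_tendsto_def
proof
  have cl: "closure A \<subseteq> bounded_ops" using A closed_bounded_ops by (rule closure_minimal)
  fix T assume T: "T \<in> closure A"
  show "(\<lambda>n. norm (schur_multiplier (\<phi> n) T - id T)) \<longlonglongrightarrow> 0"
  proof (rule tendstoI)
    fix e :: real assume e: "e > 0"
    then have e3: "e / 3 > 0" by simp
    then obtain U where U: "U \<in> A" "dist U T < e / 3"
      using T unfolding closure_approachable by blast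
    have ev: "\<forall>\<^sub>F n in sequentially. norm (schur_multiplier (\<phi> n) U - U) < e / 3"
      by (rule order_tendstoD(2)[OF conv[OF U(1)] e3])
    have ops: "T \<in> bounded_ops" "U \<in> bounded_ops" using U(1) T A cl by auto
    show "\<forall>\<^sub>F n in sequentially. dist (norm (schur_multiplier (\<phi> n) T - id T)) 0 < e"
      using ev
    proof eventually_elim
      case (elim n)
      have "schur_multiplier (\<phi> n) T - T =
          schur_multiplier (\<phi> n) (T - U) + (schur_multiplier (\<phi> n) U - U) + (U - T)"
        by (simp add: schur_multiplier_diff[OF \<phi> ops])
      then have "norm (schur_multiplier (\<phi> n) T - T) \<le>
          norm (schur_multiplier (\<phi> n) (T - U)) + norm (schur_multiplier (\<phi> n) U - U) + norm (U - T)"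
        by (simp only:) (intro norm_triangle_le add_right_mono norm_triangle_ineq)
      also have "norm (schur_multiplier (\<phi> n) (T - U)) \<le> norm (T - U)"
        by (intro norm_schur_multiplier_le[OF \<phi>] bounded_ops_diff ops)
      finally show ?case
        using elim U(2) by (simp add: dist_norm norm_minus_commute)
    qed
  qed
qed

text \<open>
The difference is supported on the diagonals \<open>x - y = s\<close> with \<open>s \<in> F\<close>, where it is \<open>\<phi> s - 1\<close> times \<open>T\<close>.
A matrix supported on one diagonal is a weighted translation, so its norm is at most the supremum of its
entries.
\<close>

lemma finite_propagation_schur_bound:
  fixes T :: "'g::group_add ell2 \<Rightarrow>\<^sub>L 'g ell2"
  assumes \<phi>: "contractive_schur \<phi>" and T: "T \<in> bounded_ops"
    and F: "finite F" "\<And>x y. op_entry T x y \<noteq> 0 \<Longrightarrow> x - y \<in> F"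
  shows "norm (schur_multiplier \<phi> T - T) \<le> norm T * (\<Sum>s\<in>F. cmod (\<phi> s - 1))"
proof (rule norm_le_form_bound)
  show "schur_multiplier \<phi> T - T \<in> bounded_ops" by (intro bounded_ops_diff schur_multiplier \<phi> T)
  show "0 \<le> norm T * (\<Sum>s\<in>F. cmod (\<phi> s - 1))" by (simp add: sum_nonneg)
  define D where "D x y = op_entry (schur_multiplier \<phi> T - T) x y" for x y
  have D: "D x y = (\<phi> (x - y) - 1) * op_entry T x y" for x y
    by (simp add: D_def op_entry_diff schur_multiplier[OF \<phi> T] left_diff_distrib)
  have entry: "cmod (op_entry T x y) \<le> norm T" for x y
  proof -
    have "cmod (op_entry T x y) \<le> norm (blinfun_apply T (delta y))"
      using L2_set_le_norm[of "blinfun_apply T (delta y)" "{x}"] by (simp add: op_entry_eq L2_set_def)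
    also have "\<dots> \<le> norm T * norm (delta y)" by (rule norm_blinfun)
    also have "delta y = finite_vector {y} (\<lambda>_. 1)"
      by (simp add: ell2_fun_inject[symmetric] fun_eq_iff ell2_fun_finite_vector delta.rep_eq)
    also have "norm \<dots> = 1" by (simp add: norm_finite_vector L2_set_def)
    finally show ?thesis by simp
  qed
  have Dle: "cmod (D x y) \<le> norm T * (\<Sum>s\<in>F. if x = s + y then cmod (\<phi> s - 1) else 0)" for x y
  proof (cases "op_entry T x y = 0")
    case False
    have "(\<Sum>s\<in>F. if x = s + y then cmod (\<phi> s - 1) else 0) = (\<Sum>s\<in>F. if s = x - y then cmod (\<phi> s - 1) else 0)"
      by (intro sum.cong) (auto simp: eq_diff_eq)
    also have "\<dots> = cmod (\<phi> (x - y) - 1)" using F False by simp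
    finally show ?thesis
      using entry[of x y] by (simp add: D norm_mult mult.commute mult_right_mono)
  qed (simp add: D sum_nonneg)
  show "form_bounded (op_entry (schur_multiplier \<phi> T - T)) (norm T * (\<Sum>s\<in>F. cmod (\<phi> s - 1)))"
    unfolding form_bounded_def D_def[symmetric]
  proof (intro allI impI)
    fix H :: "'g set" and c d :: "'g \<Rightarrow> complex"
    assume H: "finite H"
    let ?cd = "L2_set (\<lambda>x. cmod (c x)) H * L2_set (\<lambda>x. cmod (d x)) H"
    have diag: "(\<Sum>x\<in>H. \<Sum>y\<in>H. if x = s + y then cmod (c x) * cmod (d y) else 0) \<le> ?cd" for s
    proof -
      let ?H = "{y\<in>H. s + y \<in> H}"
      have "(\<Sum>x\<in>H. \<Sum>y\<in>H. if x = s + y then cmod (c x) * cmod (d y) else 0) =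
          (\<Sum>y\<in>H. if s + y \<in> H then cmod (c (s + y)) * cmod (d y) else 0)"
        using H by (subst sum.swap) (auto intro!: sum.cong)
      also have "\<dots> = (\<Sum>y\<in>?H. \<bar>cmod (c (s + y))\<bar> * \<bar>cmod (d y)\<bar>)"
        using H by (simp add: sum.inter_filter)
      also have "\<dots> \<le> L2_set (\<lambda>y. cmod (c (s + y))) ?H * L2_set (\<lambda>y. cmod (d y)) ?H"
        by (rule L2_set_mult_ineq)
      also have "\<dots> \<le> ?cd"
      proof (intro mult_mono)
        have "(\<Sum>y\<in>?H. (cmod (c (s + y)))\<^sup>2) = (\<Sum>x\<in>(+) s ` ?H. (cmod (c x))\<^sup>2)"
          by (subst sum.reindex) auto
        also have "\<dots> \<le> (\<Sum>x\<in>H. (cmod (c x))\<^sup>2)" using H by (intro sum_mono2) auto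
        finally show "L2_set (\<lambda>y. cmod (c (s + y))) ?H \<le> L2_set (\<lambda>x. cmod (c x)) H"
          unfolding L2_set_def by (rule real_sqrt_le_mono)
        show "L2_set (\<lambda>y. cmod (d y)) ?H \<le> L2_set (\<lambda>x. cmod (d x)) H"
          unfolding L2_set_def using H by (intro real_sqrt_le_mono sum_mono2) auto
      qed auto
      finally show ?thesis .
    qed
    have "cmod (\<Sum>x\<in>H. \<Sum>y\<in>H. cnj (c x) * D x y * d y) \<le> (\<Sum>x\<in>H. \<Sum>y\<in>H. cmod (c x) * cmod (D x y) * cmod (d y))"
      by (rule order_trans[OF norm_sum sum_mono], rule order_trans[OF norm_sum]) (simp add: norm_mult)
    also have "\<dots> \<le> (\<Sum>x\<in>H. \<Sum>y\<in>H. cmod (c x) * (norm T * (\<Sum>s\<in>F. if x = s + y then cmod (\<phi> s - 1) else 0)) * cmod (d y))"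
      by (intro sum_mono mult_right_mono mult_left_mono Dle) auto
    also have "\<dots> = (\<Sum>x\<in>H. \<Sum>y\<in>H. \<Sum>s\<in>F. norm T * cmod (\<phi> s - 1) * (if x = s + y then cmod (c x) * cmod (d y) else 0))"
      by (intro sum.cong refl) (simp add: sum_distrib_left sum_distrib_right, intro sum.cong, auto)
    also have "\<dots> = (\<Sum>s\<in>F. norm T * cmod (\<phi> s - 1) * (\<Sum>x\<in>H. \<Sum>y\<in>H. if x = s + y then cmod (c x) * cmod (d y) else 0))"
      unfolding sum_distrib_left
      by (rule trans[OF sum.cong[OF refl sum.swap] sum.swap])
    also have "\<dots> \<le> (\<Sum>s\<in>F. norm T * cmod (\<phi> s - 1) * ?cd)"
      by (intro sum_mono mult_left_mono diag) auto
    also have "\<dots> = norm T * (\<Sum>s\<in>F. cmod (\<phi> s - 1)) * ?cd"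
      by (simp only: sum_distrib_left sum_distrib_right mult.assoc)
    finally show "cmod (\<Sum>x\<in>H. \<Sum>y\<in>H. cnj (c x) * D x y * d y) \<le> norm T * (\<Sum>s\<in>F. cmod (\<phi> s - 1)) * ?cd" .
  qed
qed

abbreviation finite_propagation_ops :: "('g::group_add ell2 \<Rightarrow>\<^sub>L 'g ell2) set" where
  "finite_propagation_ops \<equiv> {T \<in> bounded_ops. finite_propagation T}"

lemma uniform_roe_sot_tendsto:
  assumes \<phi>: "\<And>n. contractive_schur (\<phi> n)" and lim: "\<And>s. (\<lambda>n. \<phi> n s) \<longlonglongrightarrow> 1"
  shows "sot_tendsto uniform_roe (\<lambda>n. schur_multiplier (\<phi> n)) id"
  unfolding uniform_roe_def
proof (rule sot_tendsto_closure[OF \<phi>])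
  fix T :: "'a ell2 \<Rightarrow>\<^sub>L 'a ell2" assume "T \<in> finite_propagation_ops"
  then obtain F where T: "T \<in> bounded_ops" and F: "finite F" "\<And>x y. op_entry T x y \<noteq> 0 \<Longrightarrow> x - y \<in> F"
    by (auto simp: finite_propagation_def)
  have "(\<lambda>n. norm T * (\<Sum>s\<in>F. cmod (\<phi> n s - 1))) \<longlonglongrightarrow> norm T * (\<Sum>s\<in>F. cmod (1 - 1))"
    by (intro tendsto_intros lim)
  then have "(\<lambda>n. norm T * (\<Sum>s\<in>F. cmod (\<phi> n s - 1))) \<longlonglongrightarrow> 0" by simp
  then show "(\<lambda>n. norm (schur_multiplier (\<phi> n) T - T)) \<longlonglongrightarrow> 0"
    by (rule Lim_null_comparison[rotated])
       (auto intro!: always_eventually finite_propagation_schur_bound[OF \<phi> T F])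
qed auto

lemma schur_multiplier_uniform_roe:
  assumes \<phi>: "contractive_schur \<phi>" and "T \<in> uniform_roe"
  shows "schur_multiplier \<phi> T \<in> uniform_roe"
  using assms(2) unfolding uniform_roe_def
  by (rule schur_multiplier_closure[OF \<phi>, rotated 2])
     (auto simp: schur_multiplier[OF \<phi>] finite_propagation_def)

lemma uniform_roe_subset: "uniform_roe \<subseteq> bounded_ops"
  unfolding uniform_roe_def by (rule closure_minimal[OF _ closed_bounded_ops]) auto

section \<open>The reduced group algebra\<close>

lemma left_regular_delta: "blinfun_apply (left_regular s) (delta y) = delta (s + y)"
  by (simp add: ell2_fun_inject[symmetric] left_regular.rep_eq translate.rep_eq delta.rep_eq fun_eq_iff)
     (metis add.assoc add.left_inverse add.right_inverse add_0)

lemma left_regular_bounded_ops: "left_regular s \<in> bounded_ops"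
  by (simp add: bounded_ops_def left_regular.rep_eq ell2_fun_inject[symmetric] translate.rep_eq scaleC.rep_eq)

lemma op_entry_left_regular: "op_entry (left_regular s) x y = (if x = s + y then 1 else 0)"
  by (simp add: op_entry_eq left_regular_delta delta.rep_eq)

text \<open>
The linear span of the left translations, built up one term at a time so that closure properties can be
proved by induction.
\<close>

inductive_set group_algebra :: "('g::group_add ell2 \<Rightarrow>\<^sub>L 'g ell2) set" where
  zero: "0 \<in> group_algebra"
| add_term: "T \<in> group_algebra \<Longrightarrow> T + (scale_op c o\<^sub>L left_regular s) \<in> group_algebra"

lemma group_algebra_subset: "group_algebra \<subseteq> finite_propagation_ops"
proof
  fix T :: "'a ell2 \<Rightarrow>\<^sub>L 'a ell2" assume "T \<in> group_algebra"
  then show "T \<in> finite_propagation_ops"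
  proof induction
    case zero
    then show ?case by (auto simp: bounded_ops_def finite_propagation_def op_entry_eq zero_ell2.rep_eq
          scaleC_def ell2_fun_inject[symmetric] Abs_ell2_inverse)
  next
    case (add_term T c s)
    then obtain F where F: "finite F" "\<And>x y. op_entry T x y \<noteq> 0 \<Longrightarrow> x - y \<in> F"
      by (auto simp: finite_propagation_def)
    have "x - y \<in> insert s F" if "op_entry (T + (scale_op c o\<^sub>L left_regular s)) x y \<noteq> 0" for x y
      using that F(2)[of x y] by (auto simp: op_entry_add op_entry_scale op_entry_left_regular split: if_splits)
    with F(1) add_term show ?case
      by (auto simp: finite_propagation_def intro!: exI[of _ "insert s F"] bounded_ops_add bounded_ops_scale left_regular_bounded_ops)
  qed
qed

lemma group_algebra_add: "U \<in> group_algebra \<Longrightarrow> T \<in> group_algebra \<Longrightarrow> T + U \<in> group_algebra"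
  by (induction rule: group_algebra.induct) (auto simp: add.assoc[symmetric] intro: group_algebra.add_term)

lemma scale_op_add: "scale_op c o\<^sub>L (T + U) = (scale_op c o\<^sub>L T) + (scale_op c o\<^sub>L U)"
  by (rule blinfun_eqI) (simp add: blinfun.add_left blinfun.add_right)

lemma scaleC_scaleC: "scaleC c (scaleC d f) = scaleC (c * d) f"
  by transfer (simp add: mult.assoc)

lemma scale_op_scale_op: "scale_op c o\<^sub>L (scale_op d o\<^sub>L T) = scale_op (c * d) o\<^sub>L T"
  by (rule blinfun_eqI) (simp add: scale_op.rep_eq scaleC_scaleC)

lemma group_algebra_term: "scale_op c o\<^sub>L left_regular s \<in> group_algebra"
  using group_algebra.add_term[OF group_algebra.zero] by simp

lemma group_algebra_scale: "T \<in> group_algebra \<Longrightarrow> scale_op c o\<^sub>L T \<in> group_algebra"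
proof (induction rule: group_algebra.induct)
  case zero
  have "scale_op c o\<^sub>L (0 :: 'a ell2 \<Rightarrow>\<^sub>L 'a ell2) = 0" by (rule blinfun_eqI) simp
  then show ?case by (simp add: group_algebra.zero)
qed (simp add: scale_op_add scale_op_scale_op group_algebra.add_term)

lemma left_regular_compose: "left_regular s o\<^sub>L left_regular t = left_regular (s + t)"
  by (rule blinfun_eqI) (simp add: left_regular.rep_eq ell2_fun_inject[symmetric] translate.rep_eq minus_add add.assoc
      fun_eq_iff diff_conv_add_uminus del: add_uminus_conv_diff)

lemma group_algebra_compose:
  assumes "U \<in> group_algebra" "T \<in> group_algebra"
  shows "T o\<^sub>L U \<in> group_algebra"
  using assms(1)
proof induction
  case zero
  have "T o\<^sub>L 0 = 0" by (rule blinfun_eqI) simp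
  then show ?case by (simp add: group_algebra.zero)
next
  case (add_term U c s)
  have "T o\<^sub>L (scale_op c o\<^sub>L left_regular s) \<in> group_algebra"
    using assms(2)
  proof induction
    case zero
    have "0 o\<^sub>L (scale_op c o\<^sub>L left_regular s) = (0 :: 'a ell2 \<Rightarrow>\<^sub>L 'a ell2)" by (rule blinfun_eqI) simp
    then show ?case by (simp add: group_algebra.zero)
  next
    case (add_term T d t)
    have "(T + (scale_op d o\<^sub>L left_regular t)) o\<^sub>L (scale_op c o\<^sub>L left_regular s) =
      (T o\<^sub>L (scale_op c o\<^sub>L left_regular s)) + (scale_op (d * c) o\<^sub>L (left_regular t o\<^sub>L left_regular s))"
      by (rule blinfun_eqI)
         (simp add: blinfun.add_left scale_op.rep_eq bounded_ops_scaleC[OF left_regular_bounded_ops]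
           scaleC_scaleC)
    with add_term show ?case by (simp add: left_regular_compose group_algebra.add_term)
  qed
  moreover have "T o\<^sub>L (U + (scale_op c o\<^sub>L left_regular s)) = (T o\<^sub>L U) + (T o\<^sub>L (scale_op c o\<^sub>L left_regular s))"
    by (rule blinfun_eqI) (simp add: blinfun.add_left blinfun.add_right)
  ultimately show ?case using add_term by (simp add: group_algebra_add)
qed

text \<open>
Adjoints are compared through their matrices, so that the estimate \<open>norm T' \<le> norm T\<close> is an instance of
the symmetry of form bounds.
\<close>

definition entrywise_adjoint :: "('a ell2 \<Rightarrow>\<^sub>L 'a ell2) \<Rightarrow> ('a ell2 \<Rightarrow>\<^sub>L 'a ell2) \<Rightarrow> bool" where
  "entrywise_adjoint T T' \<longleftrightarrow> T \<in> bounded_ops \<and> T' \<in> bounded_ops \<and> (\<forall>x y. op_entry T' x y = cnj (op_entry T y x))"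

lemma entrywise_adjoint_norm:
  assumes "entrywise_adjoint T T'"
  shows "norm T' \<le> norm T"
proof (rule norm_le_form_bound)
  show "T' \<in> bounded_ops" using assms by (simp add: entrywise_adjoint_def)
  show "form_bounded (op_entry T') (norm T)"
    unfolding form_bounded_def
  proof (intro allI impI)
    fix F :: "'a set" and c d :: "'a \<Rightarrow> complex"
    assume F: "finite F"
    have eq: "(\<Sum>x\<in>F. \<Sum>y\<in>F. cnj (c x) * op_entry T' x y * d y) = cnj (\<Sum>y\<in>F. \<Sum>x\<in>F. cnj (d y) * op_entry T y x * c x)"
      using assms by (subst sum.swap) (simp add: entrywise_adjoint_def cnj_sum mult_ac)
    have "form_bounded (op_entry T) (norm T)"
      using assms by (intro form_bounded_op_entry) (simp add: entrywise_adjoint_def)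
    then have "cmod (\<Sum>y\<in>F. \<Sum>x\<in>F. cnj (d y) * op_entry T y x * c x) \<le>
        norm T * (L2_set (\<lambda>x. cmod (d x)) F * L2_set (\<lambda>x. cmod (c x)) F)"
      using F unfolding form_bounded_def by blast
    then show "cmod (\<Sum>x\<in>F. \<Sum>y\<in>F. cnj (c x) * op_entry T' x y * d y) \<le>
        norm T * (L2_set (\<lambda>x. cmod (c x)) F * L2_set (\<lambda>x. cmod (d x)) F)"
      unfolding eq complex_mod_cnj by (simp only: mult.commute)
  qed
qed simp

lemma is_adjoint_imp_entrywise:
  assumes T: "T \<in> bounded_ops" and adj: "is_adjoint T T'"
  shows "entrywise_adjoint T T'"
proof -
  have entry: "ell2_fun (blinfun_apply T' g) x = cinner (blinfun_apply T (delta x)) g" for g x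
    using adj by (simp add: is_adjoint_def cinner_delta_left[symmetric])
  have "blinfun_apply T' (scaleC c g) = scaleC c (blinfun_apply T' g)" for c g
  proof -
    have "cinner f (scaleC c g) = c * cinner f g" for f :: "'a ell2"
    proof -
      have "(\<lambda>x. cnj (ell2_fun f x) * (c * ell2_fun g x)) = (\<lambda>x. c * (cnj (ell2_fun f x) * ell2_fun g x))"
        by (simp add: fun_eq_iff)
      then show ?thesis
        unfolding cinner.rep_eq scaleC.rep_eq by (simp only: infsum_cmult_right cinner_summable)
    qed
    then show ?thesis by (simp add: ell2_fun_inject[symmetric] fun_eq_iff entry scaleC.rep_eq)
  qed
  then show ?thesis
    using T by (simp add: entrywise_adjoint_def bounded_ops_def op_entry_eq entry cinner_delta_right)
qed

lemma group_algebra_adjoint: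
  assumes "T \<in> group_algebra"
  shows "\<exists>T'\<in>group_algebra. entrywise_adjoint T T'"
  using assms
proof induction
  case zero
  have "(0 :: 'a ell2 \<Rightarrow>\<^sub>L 'a ell2) \<in> bounded_ops"
    using group_algebra_subset group_algebra.zero by blast
  then have "entrywise_adjoint 0 (0 :: 'a ell2 \<Rightarrow>\<^sub>L 'a ell2)"
    by (simp add: entrywise_adjoint_def op_entry_eq zero_ell2.rep_eq)
  then show ?case using group_algebra.zero by blast
next
  case (add_term T c s)
  then obtain T' where T': "T' \<in> group_algebra" "entrywise_adjoint T T'" by blast
  have iff: "x = - s + y \<longleftrightarrow> y = s + x" for x y :: 'a by (auto simp: add.assoc[symmetric])
  have "entrywise_adjoint (T + (scale_op c o\<^sub>L left_regular s)) (T' + (scale_op (cnj c) o\<^sub>L left_regular (- s)))"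
    using T'(2) by (simp add: entrywise_adjoint_def bounded_ops_add bounded_ops_scale left_regular_bounded_ops
        op_entry_add op_entry_scale op_entry_left_regular iff)
  then show ?case using group_algebra.add_term[OF T'(1)] by blast
qed

text \<open>
The adjoint of a limit is a limit of adjoints because taking adjoints is isometric.
\<close>

lemma cstar_subalgebra_closure_group_algebra: "cstar_subalgebra (closure group_algebra)"
  unfolding cstar_subalgebra_def
proof (intro conjI ballI allI impI)
  have sub: "group_algebra \<subseteq> bounded_ops" using group_algebra_subset by blast
  show cl: "closure group_algebra \<subseteq> bounded_ops" using sub closed_bounded_ops by (rule closure_minimal)
  show "0 \<in> closure group_algebra" using group_algebra.zero closure_subset by blast
  show "closed (closure group_algebra)" by simp
  fix T :: "'a ell2 \<Rightarrow>\<^sub>L 'a ell2" assume T: "T \<in> closure group_algebra"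
  then obtain t where t: "\<And>n. t n \<in> group_algebra" "t \<longlonglongrightarrow> T" unfolding closure_sequential by blast
  {
    fix U :: "'a ell2 \<Rightarrow>\<^sub>L 'a ell2" assume "U \<in> closure group_algebra"
    then obtain u where u: "\<And>n. u n \<in> group_algebra" "u \<longlonglongrightarrow> U" unfolding closure_sequential by blast
    show "T + U \<in> closure group_algebra"
      unfolding closure_sequential using t u
      by (intro exI[of _ "\<lambda>n. t n + u n"] conjI allI group_algebra_add tendsto_add)
    have "(\<lambda>n. t n o\<^sub>L u n) \<longlonglongrightarrow> (T o\<^sub>L U)"
      using t(2) u(2) by (rule bounded_bilinear.tendsto[OF bounded_bilinear_blinfun_compose])
    then show "T o\<^sub>L U \<in> closure group_algebra"
      unfolding closure_sequential using t u
      by (intro exI[of _ "\<lambda>n. t n o\<^sub>L u n"] conjI allI group_algebra_compose)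
  }
  show "scale_op c o\<^sub>L T \<in> closure group_algebra" for c
  proof -
    have "(\<lambda>n. scale_op c o\<^sub>L t n) \<longlonglongrightarrow> (scale_op c o\<^sub>L T)"
      by (rule bounded_bilinear.tendsto[OF bounded_bilinear_blinfun_compose tendsto_const t(2)])
    then show ?thesis
      unfolding closure_sequential using t
      by (intro exI[of _ "\<lambda>n. scale_op c o\<^sub>L t n"] conjI allI group_algebra_scale)
  qed
  fix T' assume "is_adjoint T T'"
  then have T': "entrywise_adjoint T T'" using T cl by (intro is_adjoint_imp_entrywise) auto
  show "T' \<in> closure group_algebra"
    unfolding closure_approachable
  proof (intro allI impI)
    fix e :: real assume "e > 0"
    then obtain U where U: "U \<in> group_algebra" "dist U T < e" using T unfolding closure_approachable by blast
    obtain U' where U': "U' \<in> group_algebra" "entrywise_adjoint U U'" using group_algebra_adjoint[OF U(1)] by blast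
    have "entrywise_adjoint (U - T) (U' - T')"
      using U'(2) T' by (simp add: entrywise_adjoint_def bounded_ops_diff op_entry_diff)
    then have "dist U' T' < e" using entrywise_adjoint_norm U(2) by (fastforce simp: dist_norm)
    with U'(1) show "\<exists>U'\<in>group_algebra. dist U' T' < e" by blast
  qed
qed

lemma reduced_cstar_eq: "reduced_cstar = closure group_algebra"
proof
  have "left_regular s \<in> group_algebra" for s :: 'a
  proof -
    have "scale_op 1 o\<^sub>L left_regular s = left_regular s"
      by (rule blinfun_eqI) (simp add: scale_op.rep_eq ell2_fun_inject[symmetric] scaleC.rep_eq)
    then show ?thesis using group_algebra_term[of 1 s] by simp
  qed
  then show "reduced_cstar \<subseteq> (closure group_algebra :: ('a ell2 \<Rightarrow>\<^sub>L 'a ell2) set)"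
    unfolding reduced_cstar_def using closure_subset
    by (intro hull_minimal cstar_subalgebra_closure_group_algebra) blast
  have "closure group_algebra \<subseteq> A" if A: "cstar_subalgebra A" "range left_regular \<subseteq> A" for A :: "('a ell2 \<Rightarrow>\<^sub>L 'a ell2) set"
  proof (rule closure_minimal)
    show "closed A" using A by (simp add: cstar_subalgebra_def)
    show "group_algebra \<subseteq> A"
    proof
      fix T :: "'a ell2 \<Rightarrow>\<^sub>L 'a ell2" assume "T \<in> group_algebra"
      then show "T \<in> A"
      proof induction
        case zero
        show ?case using A(1) by (simp add: cstar_subalgebra_def)
      next
        case (add_term T c s)
        have "left_regular s \<in> A" using A(2) by blast
        then show ?case using A(1) add_term.IH unfolding cstar_subalgebra_def by blast
      qed
    qed
  qed
  then show "closure group_algebra \<subseteq> (reduced_cstar :: ('a ell2 \<Rightarrow>\<^sub>L 'a ell2) set)"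
    unfolding reduced_cstar_def hull_def by blast
qed

lemma reduced_cstar_subset_uniform_roe: "reduced_cstar \<subseteq> uniform_roe"
  unfolding reduced_cstar_eq uniform_roe_def by (rule closure_mono[OF group_algebra_subset])

text \<open>
The matrix of a left translation by \<open>s\<close> is supported on the diagonal \<open>x - y = s\<close>, so the Schur multiplier
multiplies it by the scalar \<open>\<phi> s\<close> and preserves the group algebra.
\<close>

lemma schur_multiplier_reduced_cstar:
  assumes \<phi>: "contractive_schur \<phi>" and "T \<in> reduced_cstar"
  shows "schur_multiplier \<phi> T \<in> reduced_cstar"
  using assms(2) unfolding reduced_cstar_eq
proof (rule schur_multiplier_closure[OF \<phi>, rotated 2])
  show sub: "group_algebra \<subseteq> bounded_ops" using group_algebra_subset by blast
  fix T :: "'a ell2 \<Rightarrow>\<^sub>L 'a ell2" assume "T \<in> group_algebra"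
  then show "schur_multiplier \<phi> T \<in> group_algebra"
  proof induction
    case zero
    have 0: "0 \<in> (bounded_ops :: ('a ell2 \<Rightarrow>\<^sub>L 'a ell2) set)" using sub group_algebra.zero by blast
    have "schur_multiplier \<phi> (0 :: 'a ell2 \<Rightarrow>\<^sub>L 'a ell2) = 0"
      using schur_multiplier_diff[OF \<phi> 0 0] by simp
    then show ?case by (simp add: group_algebra.zero)
  next
    case (add_term T c s)
    have "schur_multiplier \<phi> (left_regular s) = scale_op (\<phi> s) o\<^sub>L left_regular s"
      by (rule bounded_ops_eqI)
         (simp_all add: schur_multiplier[OF \<phi>] left_regular_bounded_ops bounded_ops_scale
           op_entry_scale op_entry_left_regular)
    moreover have "T \<in> bounded_ops" using sub add_term.hyps by blast
    ultimately have "schur_multiplier \<phi> (T + (scale_op c o\<^sub>L left_regular s)) =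
        schur_multiplier \<phi> T + (scale_op (c * \<phi> s) o\<^sub>L left_regular s)"
      by (simp add: schur_multiplier_add[OF \<phi>] bounded_ops_scale left_regular_bounded_ops
          schur_multiplier_scale[OF \<phi>] scale_op_scale_op)
    then show ?case using add_term by (simp add: group_algebra.add_term)
  qed
qed

section \<open>The Schur multipliers of cluster functions\<close>

text \<open>
The substitution \<open>v = t + x\<close> turns the condition \<open>t \<in> A \<and> t + (x - y) \<in> A\<close> into
\<open>v - x \<in> A \<and> v - y \<in> A\<close>, in which \<open>x\<close> and \<open>y\<close> are separated: the overlap kernel is a Gram
matrix.
\<close>

lemma overlap_eq_sum:
  fixes F :: "'g::group_add set"
  assumes A: "finite A" and F: "finite F"
  obtains V where "finite V" "\<And>x. x \<in> F \<Longrightarrow> card {v \<in> V. v - x \<in> A} = card A"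
    "\<And>x y. x \<in> F \<Longrightarrow> overlap q A (x - y) =
      real (card A) powr (- 2 / q) * (\<Sum>v\<in>V. of_bool (v - x \<in> A) * of_bool (v - y \<in> A))"
proof
  define V where "V = (\<lambda>(t, x). t + x) ` (A \<times> F)"
  show V: "finite V" using A F by (simp add: V_def)
  have inj: "inj_on (\<lambda>t. t + x) B" for x and B :: "'g set" by (auto intro: inj_onI)
  show "card {v \<in> V. v - x \<in> A} = card A" if "x \<in> F" for x
  proof -
    have "{v \<in> V. v - x \<in> A} = (\<lambda>t. t + x) ` A"
      using that by (force simp: V_def image_iff)
    then show ?thesis by (simp add: card_image[OF inj])
  qed
  show "overlap q A (x - y) =
      real (card A) powr (- 2 / q) * (\<Sum>v\<in>V. of_bool (v - x \<in> A) * of_bool (v - y \<in> A))"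
    if x: "x \<in> F" for x y
  proof -
    have "{v \<in> V. v - x \<in> A \<and> v - y \<in> A} = (\<lambda>t. t + x) ` {t \<in> A. t + (x - y) \<in> A}"
    proof (rule set_eqI)
      fix v
      have "v = (v - x) + x" "(v - x) + (x - y) = v - y" by (simp_all add: add_diff_eq)
      then show "v \<in> {v \<in> V. v - x \<in> A \<and> v - y \<in> A} \<longleftrightarrow> v \<in> (\<lambda>t. t + x) ` {t \<in> A. t + (x - y) \<in> A}"
        using x by (auto simp: V_def image_iff add_diff_eq)
    qed
    then have "card {t \<in> A. t + (x - y) \<in> A} = card {v \<in> V. v - x \<in> A \<and> v - y \<in> A}"
      by (simp add: card_image[OF inj])
    also have "real \<dots> = (\<Sum>v\<in>V. of_bool (v - x \<in> A) * of_bool (v - y \<in> A))"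
      using V by (simp add: of_bool_conj[symmetric] Int_def)
    finally show ?thesis by (simp add: overlap_def)
  qed
qed

lemma of_real_of_bool: "complex_of_real (of_bool b) = of_bool b"
  by (cases b) simp_all

lemma cnj_of_bool: "cnj (of_bool b) = of_bool b"
  by (cases b) simp_all

text \<open>
By the Gram representation the form is a sum over \<open>v\<close> of forms of \<open>M\<close>, evaluated at the restrictions of
\<open>c\<close> and \<open>d\<close> to \<open>-A + v\<close>.  Each point lies in exactly \<open>card A\<close> of these sets, so by the
Cauchy--Schwarz inequality the sum is at most \<open>overlap q A 0 \<le> 1\<close> times the bound for \<open>M\<close>.
\<close>

lemma overlap_form_bound:
  assumes M: "form_bounded M B" "0 \<le> B" and q: "0 < q" "q \<le> 2" and A: "finite A" and F: "finite F"
  shows "cmod (\<Sum>x\<in>F. \<Sum>y\<in>F. cnj (c x) * (complex_of_real (overlap q A (x - y)) * M x y) * d y)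
    \<le> B * (L2_set (\<lambda>x. cmod (c x)) F * L2_set (\<lambda>x. cmod (d x)) F)"
proof -
  obtain V where V: "finite V" "\<And>x. x \<in> F \<Longrightarrow> card {v \<in> V. v - x \<in> A} = card A"
    and ov: "\<And>x y. x \<in> F \<Longrightarrow> overlap q A (x - y) =
      real (card A) powr (- 2 / q) * (\<Sum>v\<in>V. of_bool (v - x \<in> A) * of_bool (v - y \<in> A))"
    by (rule overlap_eq_sum[OF A F, of q]) blast
  define w where "w = real (card A) powr (- 2 / q)"
  have ov': "overlap q A (x - y) = w * (\<Sum>v\<in>V. of_bool (v - x \<in> A) * of_bool (v - y \<in> A))"
    if "x \<in> F" for x y
    using ov[OF that] by (simp only: w_def)
  define cut where "cut u v x = u x * of_bool (v - x \<in> A)" for u :: "'a \<Rightarrow> complex" and v x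
  define N where "N u v = L2_set (\<lambda>x. cmod (cut u v x)) F" for u v
  have cut_sq: "(cmod (cut u v x))\<^sup>2 = (cmod (u x))\<^sup>2 * of_bool (v - x \<in> A)" for u v x
    by (simp add: cut_def)
  have N: "L2_set (N u) V = sqrt (card A) * L2_set (\<lambda>x. cmod (u x)) F" for u
  proof -
    have "(\<Sum>v\<in>V. (N u v)\<^sup>2) = (\<Sum>v\<in>V. \<Sum>x\<in>F. (cmod (u x))\<^sup>2 * of_bool (v - x \<in> A))"
      by (simp add: N_def L2_set_def cut_sq sum_nonneg)
    also have "\<dots> = (\<Sum>x\<in>F. (cmod (u x))\<^sup>2 * (\<Sum>v\<in>V. of_bool (v - x \<in> A)))"
      by (subst sum.swap) (simp add: sum_distrib_left)
    also have "\<dots> = (\<Sum>x\<in>F. (cmod (u x))\<^sup>2 * card A)"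
      using V by (intro sum.cong refl) (simp add: Int_def)
    finally show ?thesis
      by (simp add: L2_set_def real_sqrt_mult[symmetric] sum_distrib_left[symmetric] mult.commute)
  qed
  have "(\<Sum>x\<in>F. \<Sum>y\<in>F. cnj (c x) * (complex_of_real (overlap q A (x - y)) * M x y) * d y) =
      (\<Sum>x\<in>F. \<Sum>y\<in>F. \<Sum>v\<in>V. complex_of_real w * (cnj (cut c v x) * M x y * cut d v y))"
    by (intro sum.cong refl)
       (simp add: ov' cut_def sum_distrib_left sum_distrib_right mult_ac of_real_of_bool cnj_of_bool)
  also have "\<dots> = (\<Sum>v\<in>V. \<Sum>x\<in>F. \<Sum>y\<in>F. complex_of_real w * (cnj (cut c v x) * M x y * cut d v y))"
    by (rule trans[OF sum.cong[OF refl sum.swap] sum.swap])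
  also have "\<dots> = complex_of_real w * (\<Sum>v\<in>V. \<Sum>x\<in>F. \<Sum>y\<in>F. cnj (cut c v x) * M x y * cut d v y)"
    by (simp add: sum_distrib_left)
  also have "cmod \<dots> \<le> w * (\<Sum>v\<in>V. B * (\<bar>N c v\<bar> * \<bar>N d v\<bar>))"
  proof -
    have "cmod (\<Sum>v\<in>V. \<Sum>x\<in>F. \<Sum>y\<in>F. cnj (cut c v x) * M x y * cut d v y) \<le> (\<Sum>v\<in>V. B * (\<bar>N c v\<bar> * \<bar>N d v\<bar>))"
      using M(1) F by (intro sum_norm_le) (simp add: form_bounded_def N_def)
    then show ?thesis by (simp add: norm_mult w_def mult_left_mono)
  qed
  also have "\<dots> = w * B * (\<Sum>v\<in>V. \<bar>N c v\<bar> * \<bar>N d v\<bar>)" by (simp add: sum_distrib_left mult.assoc)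
  also have "\<dots> \<le> w * B * (L2_set (N c) V * L2_set (N d) V)"
    using M(2) by (intro mult_left_mono L2_set_mult_ineq) (simp add: w_def)
  also have "\<dots> = overlap q A 0 * (B * (L2_set (\<lambda>x. cmod (c x)) F * L2_set (\<lambda>x. cmod (d x)) F))"
    by (simp add: N overlap_zero w_def mult_ac)
  also have "\<dots> \<le> 1 * (B * (L2_set (\<lambda>x. cmod (c x)) F * L2_set (\<lambda>x. cmod (d x)) F))"
    using M(2) by (intro mult_right_mono overlap_le_1 q) simp
  finally show ?thesis by simp
qed

text \<open>
Here the Gram representation is used for the points \<open>-s\<close> and \<open>-t\<close>, since \<open>-s + t = -s - (-t)\<close>.
\<close>

lemma overlap_form_nonneg:
  fixes F :: "'g::group_add set"
  assumes A: "finite A" and F: "finite F"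
  shows "(\<Sum>s\<in>F. \<Sum>t\<in>F. cnj (c s) * complex_of_real (overlap q A (- s + t)) * c t) \<in> \<real>\<^sub>\<ge>\<^sub>0"
proof -
  obtain V where ov: "\<And>x y. x \<in> uminus ` F \<Longrightarrow> overlap q A (x - y) =
      real (card A) powr (- 2 / q) * (\<Sum>v\<in>V. of_bool (v - x \<in> A) * of_bool (v - y \<in> A))"
    by (rule overlap_eq_sum[OF A finite_imageI[OF F, of uminus], where q = q]) blast
  define w where "w = real (card A) powr (- 2 / q)"
  define u where "u v = (\<Sum>t\<in>F. of_bool (v + t \<in> A) * c t)" for v
  have cnj_u: "cnj (u v) = (\<Sum>s\<in>F. of_bool (v + s \<in> A) * cnj (c s))" for v
    by (simp add: u_def cnj_of_bool)
  have ov': "overlap q A (- s + t) = w * (\<Sum>v\<in>V. of_bool (v + s \<in> A) * of_bool (v + t \<in> A))" if "s \<in> F" for s t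
    using ov[of "- s" "- t"] that by (simp add: w_def)
  have "(\<Sum>s\<in>F. \<Sum>t\<in>F. cnj (c s) * complex_of_real (overlap q A (- s + t)) * c t) =
      (\<Sum>s\<in>F. \<Sum>t\<in>F. \<Sum>v\<in>V. complex_of_real w * ((of_bool (v + s \<in> A) * cnj (c s)) * (of_bool (v + t \<in> A) * c t)))"
    by (intro sum.cong refl) (simp add: ov' sum_distrib_left sum_distrib_right mult_ac of_real_of_bool)
  also have "\<dots> = (\<Sum>v\<in>V. \<Sum>s\<in>F. \<Sum>t\<in>F. complex_of_real w * ((of_bool (v + s \<in> A) * cnj (c s)) * (of_bool (v + t \<in> A) * c t)))"
    by (rule trans[OF sum.cong[OF refl sum.swap] sum.swap])
  also have "\<dots> = complex_of_real w * (\<Sum>v\<in>V. cnj (u v) * u v)"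
    unfolding cnj_u unfolding u_def sum_product unfolding sum_distrib_left by (rule refl)
  also have "\<dots> = complex_of_real (w * (\<Sum>v\<in>V. (cmod (u v))\<^sup>2))"
  proof -
    have "cnj (u v) * u v = complex_of_real ((cmod (u v))\<^sup>2)" for v
      by (metis complex_norm_square mult.commute)
    then show ?thesis by simp
  qed
  finally show ?thesis
    by (simp only: nonneg_Reals_of_real_iff) (simp add: w_def sum_nonneg)
qed

context cayley_percolation
begin

lemma expectation_overlap_form:
  assumes q: "0 < q" "q \<le> 2"
  shows "integrable P (\<lambda>\<omega>. \<Sum>x\<in>F. \<Sum>y\<in>F. a x y * complex_of_real (overlap q (fin_K \<omega> 0) (k x y)) * b x y)"
    and "(\<Sum>x\<in>F. \<Sum>y\<in>F. a x y * cluster_function S q P (k x y) * b x y) =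
      expectation (\<lambda>\<omega>. \<Sum>x\<in>F. \<Sum>y\<in>F. a x y * complex_of_real (overlap q (fin_K \<omega> 0) (k x y)) * b x y)"
  using integrable_overlap[OF q, unfolded overlap_fin_K]
  by (simp_all add: cluster_function_eq overlap_fin_K)

lemma contractive_schur_cluster_function:
  assumes q: "0 < q" "q \<le> 2"
  shows "contractive_schur (cluster_function S q P)"
proof -
  have "cmod (\<Sum>x\<in>F. \<Sum>y\<in>F. cnj (c x) * (cluster_function S q P (x - y) * M x y) * d y)
      \<le> B * (L2_set (\<lambda>x. cmod (c x)) F * L2_set (\<lambda>x. cmod (d x)) F)"
    if B: "0 \<le> B" and M: "form_bounded M B" and F: "finite F"
    for M :: "'g \<Rightarrow> 'g \<Rightarrow> complex" and B F and c d :: "'g \<Rightarrow> complex"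
  proof -
  let ?bound = "B * (L2_set (\<lambda>x. cmod (c x)) F * L2_set (\<lambda>x. cmod (d x)) F)"
  let ?Z = "\<lambda>\<omega>. \<Sum>x\<in>F. \<Sum>y\<in>F. cnj (c x) * complex_of_real (overlap q (fin_K \<omega> 0) (x - y)) * (M x y * d y)"
  have Z: "cmod (?Z \<omega>) \<le> ?bound" for \<omega>
    using overlap_form_bound[OF M B q finite_fin_K F] by (simp add: mult.assoc)
  have "(\<Sum>x\<in>F. \<Sum>y\<in>F. cnj (c x) * (cluster_function S q P (x - y) * M x y) * d y) = expectation ?Z"
    using expectation_overlap_form(2)[OF q, where F = F and a = "\<lambda>x y. cnj (c x)" and k = "\<lambda>x y. x - y" and b = "\<lambda>x y. M x y * d y"]
    by (simp add: mult.assoc)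
  also have "cmod \<dots> \<le> expectation (\<lambda>\<omega>. cmod (?Z \<omega>))" by (rule integral_norm_bound)
  also have "\<dots> \<le> ?bound"
    by (rule integral_le_const[OF integrable_norm[OF expectation_overlap_form(1)[OF q]]]) (rule always_eventually, rule allI, rule Z)
  finally show ?thesis .
  qed
  then show ?thesis unfolding contractive_schur_def form_bounded_def by blast
qed

lemma positive_definite_cluster_function:
  assumes q: "0 < q" "q \<le> 2"
  shows "positive_definite (cluster_function S q P)"
  unfolding positive_definite_def
proof (intro allI impI)
  fix F :: "'g set" and c assume F: "finite F"
  define Z where "Z \<omega> = (\<Sum>s\<in>F. \<Sum>t\<in>F. cnj (c s) * complex_of_real (overlap q (fin_K \<omega> 0) (- s + t)) * c t)" for \<omega>
  have Z: "Z \<omega> \<in> \<real>\<^sub>\<ge>\<^sub>0" for \<omega> unfolding Z_def by (rule overlap_form_nonneg[OF finite_fin_K F])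
  then have "Z = (\<lambda>\<omega>. complex_of_real (Re (Z \<omega>)))"
    by (simp add: fun_eq_iff complex_eq_iff complex_nonneg_Reals_iff)
  then have "expectation Z = expectation (\<lambda>\<omega>. complex_of_real (Re (Z \<omega>)))" by (rule arg_cong)
  also have "\<dots> = complex_of_real (expectation (\<lambda>\<omega>. Re (Z \<omega>)))" by (rule integral_complex_of_real)
  also have "\<dots> \<in> \<real>\<^sub>\<ge>\<^sub>0"
    using Z unfolding nonneg_Reals_of_real_iff
    by (intro integral_nonneg_AE always_eventually allI) (simp add: complex_nonneg_Reals_iff)
  finally show "(\<Sum>s\<in>F. \<Sum>t\<in>F. cnj (c s) * cluster_function S q P (- s + t) * c t) \<in> \<real>\<^sub>\<ge>\<^sub>0"
    unfolding expectation_overlap_form(2)[OF q] Z_def[abs_def] .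
qed

end

theorem theorem1p6:
  fixes S :: "'g::group_add set" and p :: "nat \<Rightarrow> real"
  assumes "finite S" and "\<forall>s\<in>S. - s \<in> S" and "generates S"
    and "\<forall>n. p n \<in> {1..<2}" and "p \<longlonglongrightarrow> 2"
  shows "(amenable TYPE('g) \<longleftrightarrow> (\<exists>P. approximating_percolations S p P)) \<and>
    (\<forall>P. approximating_percolations S p P \<longrightarrow>
      (let \<phi> = (\<lambda>n. cluster_function S (p n) (P n)) in
        (\<forall>n. positive_definite (\<phi> n) \<and> schur_multiplier_defined (\<phi> n)) \<and>
        (\<forall>A \<in> {reduced_cstar, uniform_roe}.
          (\<forall>n. schur_multiplier (\<phi> n) \<in> bounded_maps_on A) \<and>
          sot_tendsto A (\<lambda>n. schur_multiplier (\<phi> n)) id)))"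
proof -
  interpret cayley_graph S using assms(1-3) by unfold_locales auto
  have p: "p n \<in> {1..<2}" for n using assms(4) by blast
  have q: "0 < p n" "p n \<le> 2" for n using p[of n] by auto
  have equiv: "amenable TYPE('g) \<longleftrightarrow> (\<exists>P. approximating_percolations S p P)"
    using approximating_percolations_if_amenable[OF _ p assms(5)]
      amenable_if_approximating_percolations[where p = p, OF p] by blast
  have more: "(\<forall>n. positive_definite (\<phi> n) \<and> schur_multiplier_defined (\<phi> n)) \<and>
      (\<forall>A \<in> {reduced_cstar, uniform_roe}.
        (\<forall>n. schur_multiplier (\<phi> n) \<in> bounded_maps_on A) \<and> sot_tendsto A (\<lambda>n. schur_multiplier (\<phi> n)) id)"
    if P: "approximating_percolations S p P" and \<phi>: "\<phi> = (\<lambda>n. cluster_function S (p n) (P n))" for P \<phi>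
  proof -
    have perc: "cayley_percolation S (P n)" for n
      using P cayley_graph_axioms
      by (auto simp: approximating_percolations_def site_percolation_def cayley_percolation_def
          cayley_percolation_axioms_def)
    have pd: "positive_definite (\<phi> n)" for n
      unfolding \<phi> by (rule cayley_percolation.positive_definite_cluster_function[OF perc q])
    have contr: "contractive_schur (\<phi> n)" for n
      unfolding \<phi> by (rule cayley_percolation.contractive_schur_cluster_function[OF perc q])
    have lim: "(\<lambda>n. \<phi> n s) \<longlonglongrightarrow> 1" for s
      using P by (simp add: approximating_percolations_def \<phi>)
    have roe: "sot_tendsto uniform_roe (\<lambda>n. schur_multiplier (\<phi> n)) id"
      using contr lim by (rule uniform_roe_sot_tendsto)
    then have red: "sot_tendsto reduced_cstar (\<lambda>n. schur_multiplier (\<phi> n)) id"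
      using reduced_cstar_subset_uniform_roe by (auto simp: sot_tendsto_def)
    have "schur_multiplier (\<phi> n) \<in> bounded_maps_on uniform_roe" for n
      using contr uniform_roe_subset schur_multiplier_uniform_roe[OF contr]
      by (rule schur_multiplier_bounded_maps_on)
    moreover have "schur_multiplier (\<phi> n) \<in> bounded_maps_on reduced_cstar" for n
      using contr order_trans[OF reduced_cstar_subset_uniform_roe uniform_roe_subset]
        schur_multiplier_reduced_cstar[OF contr]
      by (rule schur_multiplier_bounded_maps_on)
    moreover have "schur_multiplier_defined (\<phi> n)" for n
      using ex_schur_image[OF contr] by (simp add: schur_multiplier_defined_def)
    ultimately show ?thesis using pd roe red by simp
  qed
  show ?thesis unfolding Let_def using equiv more by blast
qed

end
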